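(* Let $C_1,C_2$ be constants, let $\varphi(z)=C_1\operatorname{Ai}(-2^{-1/3}z)+C_2\operatorname{Bi}(-2^{-1/3}z)$, $\tau_0(z)=1$ and $\tau_n(z)=\det\left(\frac{d^{j+k}}{dz^{j+k}}\varphi(z)\right)_{j,k=0,\ldots,n-1}$ for $n\ge1$. For $n\ge1$ define $$\sigma_n(z)=\frac{d}{dz}\log\tau_n(z),\qquad p_n(z)=-2\frac{d^2}{dz^2}\log\tau_n(z),\qquad q_n(z)=\frac{d}{dz}\log\frac{\tau_{n-1}(z)}{\tau_n(z)}.$$ For $n\geq 1$ and $s\geq 1$, the functions $q_n(z)$, $p_n(z)$ and $\sigma_n(z)$ admit the following asymptotic expansions as $z\to\infty$ (with $z$ real and positive), excluding arbitrarily small but fixed neighborhoods of the poles of the leading terms in the approximations. The phase functions $\psi_{n,r}$ and coefficients $b_{n,r}^{(0)}$, $d_{n,r}^{(0)}$ are defined in the context. 1. If $C_2\ne0$, then $$\sigma_{2s}(z)=\frac{s^2}{2z}+\frac{s}{2z}\,\frac{b_{2s,s-1}^{(0)}\sin(\psi_{2s,s-1}(z))-d_{2s,s-1}^{(0)}\cos(\psi_{2s,s-1}(z))}{b_{2s,s}^{(0)}}+\mathcal{O}(z^{-5/2}),$$ $$\sigma_{2s-1}(z)=\sqrt{\frac z2}\,\frac{-b_{2s-1,s-1}^{(0)}\sin(\psi_{2s-1,s-1}(z))+d_{2s-1,s-1}^{(0)}\cos(\psi_{2s-1,s-1}(z))}{b_{2s-1,s-1}^{(0)}\cos(\psi_{2s-1,s-1}(z))+d_{2s-1,s-1}^{(0)}\sin(\psi_{2s-1,s-1}(z))}+\mathcal{O}(z^{-1}).$$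 Also, $$p_{2s}(z)=-\frac{\sqrt2\,s}{\sqrt z}\,\frac{b_{2s,s-1}^{(0)}\cos(\psi_{2s,s-1}(z))+d_{2s,s-1}^{(0)}\sin(\psi_{2s,s-1}(z))}{b_{2s,s}^{(0)}}+\mathcal{O}(z^{-2}),$$ $$p_{2s-1}(z)=z\left[1+\left(\frac{b_{2s-1,s-1}^{(0)}\sin(\psi_{2s-1,s-1}(z))-d_{2s-1,s-1}^{(0)}\cos(\psi_{2s-1,s-1}(z))}{b_{2s-1,s-1}^{(0)}\cos(\psi_{2s-1,s-1}(z))+d_{2s-1,s-1}^{(0)}\sin(\psi_{2s-1,s-1}(z))}\right)^2\right]+\mathcal{O}(z^{-1/2}),$$ and $$q_n(z)=(-1)^n\sqrt{\frac z2}\,\frac{-b_{2s-1,s-1}^{(0)}\sin(\psi_{2s-1,s-1}(z))+d_{2s-1,s-1}^{(0)}\cos(\psi_{2s-1,s-1}(z))}{b_{2s-1,s-1}^{(0)}\cos(\psi_{2s-1,s-1}(z))+d_{2s-1,s-1}^{(0)}\sin(\psi_{2s-1,s-1}(z))}+\mathcal{O}(z^{-1}),$$ where in the last formula $s=\lceil n/2\rceil$. 2. If $C_2=0$, then $$\sigma_{2s}(z)=\frac{s^2}{2z}-\frac{s}{2z}\sin(\psi_{2s,s-1}(z))+\mathcal{O}(z^{-5/2}),\qquad \sigma_{2s-1}(z)=\sqrt{\frac z2}\,\cot(\psi_{2s-1,s-1}(z))+\mathcal{O}(z^{-1}).$$ Also, $$p_{2s}(z)=\frac{\sqrt2\,s}{\sqrt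 z}\cos(\psi_{2s,s-1}(z))+\mathcal{O}(z^{-2}),\qquad p_{2s-1}(z)=\frac{z}{\sin^2(\psi_{2s-1,s-1}(z))}+\mathcal{O}(z^{-1/2}),$$ and $$q_n(z)=(-1)^n\sqrt{\frac z2}\,\cot(\psi_{2s-1,s-1}(z))+\mathcal{O}(z^{-1}),\qquad s=\lceil n/2\rceil.$$
   Context: $\operatorname{Ai}$ and $\operatorname{Bi}$ are the standard Airy functions. The phase function is $$\psi_{n,r}(z)=(n-2r)\left(\frac{\sqrt2\,z^{3/2}}{3}+\frac{n\pi}{4}\right),$$ and the coefficients are $$b_{n,r}^{(0)}=\sum_{p=0}^{\lfloor n/2\rfloor}(-1)^pC_1^{2p}C_2^{n-2p}\sum_{q=\max(0,2p-r)}^{\min(2p,n-r)}(-1)^q\binom{r}{2p-q}\binom{n-r}{q},$$ $$d_{n,r}^{(0)}=\sum_{p=0}^{\lceil n/2\rceil-1}(-1)^{p-1}C_1^{2p+1}C_2^{n-2p-1}\sum_{q=\max(0,2p+1-r)}^{\min(2p+1,n-r)}(-1)^q\binom{r}{2p+1-q}\binom{n-r}{q}.$$ The functions $\sigma_n,p_n,q_n$ are the Airy-type special function solutions of, respectively, the symmetric S$_{\rm II}$, Painlevé XXXIV and Painlevé II equations with parameter $\alpha=n-\tfrac12$. *)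

theory Defs
  imports
    "HOL-Analysis.Analysis"
    "HOL-Library.Landau_Symbols"
    "Jordan_Normal_Form.Determinant"
begin

text \<open>
  The Airy functions are given by their Maclaurin series.  The two series \<open>airy_f\<close>, \<open>airy_g\<close> are the
  solutions of \<open>w'' = z w\<close> with \<open>(w(0), w'(0)) = (1, 0)\<close> and \<open>(0, 1)\<close>; the constants are
  \<open>Ai(0) = 3\<^sup>-\<^sup>2\<^sup>/\<^sup>3 / \<Gamma>(2/3)\<close> and \<open>-Ai'(0) = 3\<^sup>-\<^sup>1\<^sup>/\<^sup>3 / \<Gamma>(1/3)\<close>.
\<close>

definition airy_f :: "complex \<Rightarrow> complex" where
  "airy_f z = (\<Sum>k. 3 ^ k * pochhammer (1 / 3) k * z ^ (3 * k) / fact (3 * k))"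

definition airy_g :: "complex \<Rightarrow> complex" where
  "airy_g z = (\<Sum>k. 3 ^ k * pochhammer (2 / 3) k * z ^ (3 * k + 1) / fact (3 * k + 1))"

definition airy_c1 :: real where
  "airy_c1 = 3 powr (- 2 / 3) / Gamma (2 / 3)"

definition airy_c2 :: real where
  "airy_c2 = 3 powr (- 1 / 3) / Gamma (1 / 3)"

definition Ai :: "complex \<Rightarrow> complex" where
  "Ai z = of_real airy_c1 * airy_f z - of_real airy_c2 * airy_g z"

definition Bi :: "complex \<Rightarrow> complex" where
  "Bi z = of_real (sqrt 3) * (of_real airy_c1 * airy_f z + of_real airy_c2 * airy_g z)"

definition airy_phi :: "complex \<Rightarrow> complex \<Rightarrow> complex \<Rightarrow> complex" where
  "airy_phi C1 C2 z =
     C1 * Ai (- of_real (2 powr (- 1 / 3)) * z) + C2 * Bi (- of_real (2 powr (- 1 / 3)) * z)"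

text \<open>For \<open>n = 0\<close> this is the empty determinant, i.e. \<open>1\<close>.\<close>

definition tau :: "complex \<Rightarrow> complex \<Rightarrow> nat \<Rightarrow> complex \<Rightarrow> complex" where
  "tau C1 C2 n z =
     Determinant.det (Matrix.mat n n (\<lambda>(j, k). (deriv ^^ (j + k)) (airy_phi C1 C2) z))"

text \<open>
  \<open>d/dz log f\<close>, independent of any branch of the logarithm; in particular it makes sense where \<open>f\<close>
  takes negative values, where \<open>deriv (\<lambda>z. Ln (f z))\<close> would run into the branch cut.
\<close>

definition log_deriv :: "(complex \<Rightarrow> complex) \<Rightarrow> complex \<Rightarrow> complex" where
  "log_deriv f z = deriv f z / f z"

definition sigma_fun :: "complex \<Rightarrow> complex \<Rightarrow> nat \<Rightarrow> complex \<Rightarrow> complex" where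
  "sigma_fun C1 C2 n z = log_deriv (tau C1 C2 n) z"

definition p_fun :: "complex \<Rightarrow> complex \<Rightarrow> nat \<Rightarrow> complex \<Rightarrow> complex" where
  "p_fun C1 C2 n z = - 2 * deriv (log_deriv (tau C1 C2 n)) z"

definition q_fun :: "complex \<Rightarrow> complex \<Rightarrow> nat \<Rightarrow> complex \<Rightarrow> complex" where
  "q_fun C1 C2 n z = log_deriv (\<lambda>w. tau C1 C2 (n - 1) w / tau C1 C2 n w) z"

definition psi :: "nat \<Rightarrow> nat \<Rightarrow> real \<Rightarrow> real" where
  "psi n r z = (real n - 2 * real r) * (sqrt 2 * z powr (3 / 2) / 3 + real n * pi / 4)"

text \<open>
  Truncated subtraction on \<open>nat\<close> turns \<open>m - r\<close> into \<open>max(0, m - r)\<close>, the lower summation bound below;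
  all other subtractions on \<open>nat\<close> are exact for \<open>r \<le> n\<close> and \<open>n \<ge> 1\<close>.
\<close>

definition b_coeff :: "complex \<Rightarrow> complex \<Rightarrow> nat \<Rightarrow> nat \<Rightarrow> complex" where
  "b_coeff C1 C2 n r =
     (\<Sum>p = 0..nat \<lfloor>real n / 2\<rfloor>. (- 1) ^ p * C1 ^ (2 * p) * C2 ^ (n - 2 * p) *
        (\<Sum>q = 2 * p - r..min (2 * p) (n - r).
           (- 1) ^ q * of_nat (r choose (2 * p - q)) * of_nat ((n - r) choose q)))"

definition d_coeff :: "complex \<Rightarrow> complex \<Rightarrow> nat \<Rightarrow> nat \<Rightarrow> complex" where
  "d_coeff C1 C2 n r =
     (\<Sum>p = 0..nat (\<lceil>real n / 2\<rceil> - 1). (- 1) powi (int p - 1) * C1 ^ (2 * p + 1) * C2 ^ (n - 2 * p - 1) *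
        (\<Sum>q = 2 * p + 1 - r..min (2 * p + 1) (n - r).
           (- 1) ^ q * of_nat (r choose (2 * p + 1 - q)) * of_nat ((n - r) choose q)))"

definition osc_cs :: "complex \<Rightarrow> complex \<Rightarrow> nat \<Rightarrow> nat \<Rightarrow> real \<Rightarrow> complex" where
  "osc_cs C1 C2 n r z =
     b_coeff C1 C2 n r * of_real (cos (psi n r z)) + d_coeff C1 C2 n r * of_real (sin (psi n r z))"

definition osc_sc :: "complex \<Rightarrow> complex \<Rightarrow> nat \<Rightarrow> nat \<Rightarrow> real \<Rightarrow> complex" where
  "osc_sc C1 C2 n r z =
     b_coeff C1 C2 n r * of_real (sin (psi n r z)) - d_coeff C1 C2 n r * of_real (cos (psi n r z))"

text \<open>
  \<open>z \<rightarrow> \<infinity>\<close> along the reals, outside neighbourhoods of fixed size \<open>\<delta>\<close> of the points of \<open>P\<close>, the size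
  being measured in the phase \<open>\<psi>\<close>.  The poles of the leading terms are equally spaced in \<open>\<psi>\<close>, hence
  at distances of order \<open>z\<^sup>-\<^sup>1\<^sup>/\<^sup>2\<close> in \<open>z\<close>, so that neighbourhoods of a fixed size in \<open>z\<close> would eventually
  cover the whole axis.
\<close>

definition at_top_away :: "real \<Rightarrow> (real \<Rightarrow> real) \<Rightarrow> real set \<Rightarrow> real filter" where
  "at_top_away \<delta> \<psi> P = inf at_top (principal {z. \<forall>w\<in>P. \<delta> \<le> \<bar>\<psi> z - \<psi> w\<bar>})"

text \<open>
  The poles on the positive axis of the leading terms whose denominators are \<open>osc_cs\<close> (which has no
  common zeros with the numerator \<open>osc_sc\<close> unless \<open>b\<^sup>2 + d\<^sup>2 = 0\<close>) respectively \<open>sin \<psi>\<close>.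
\<close>

definition osc_poles :: "complex \<Rightarrow> complex \<Rightarrow> nat \<Rightarrow> nat \<Rightarrow> real set" where
  "osc_poles C1 C2 n r = {w. 0 < w \<and> osc_cs C1 C2 n r w = 0}"

definition cot_poles :: "nat \<Rightarrow> nat \<Rightarrow> real set" where
  "cot_poles n r = {w. 0 < w \<and> sin (psi n r w) = 0}"

text \<open>
  For complex constants the expansions require \<open>C1\<^sup>2 + C2\<^sup>2 \<noteq> 0\<close>, since \<open>b_coeff C1 C2 (2 * s) s\<close> equals
  \<open>(C1\<^sup>2 + C2\<^sup>2)\<^sup>s\<close>.  For real constants this only excludes the trivial seed function.
\<close>

lemma nondegenerate_real_iff:
  "(complex_of_real c1)\<^sup>2 + (complex_of_real c2)\<^sup>2 \<noteq> 0 \<longleftrightarrow> c1 \<noteq> 0 \<or> c2 \<noteq> 0"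
proof -
  have "(complex_of_real c1)\<^sup>2 + (complex_of_real c2)\<^sup>2 = complex_of_real (c1\<^sup>2 + c2\<^sup>2)"
    by simp
  then show ?thesis
    by (simp only: of_real_eq_0_iff sum_power2_eq_zero_iff) blast
qed

end

theory Submission
  imports Defs "HOL-Complex_Analysis.Complex_Analysis" "HOL-Probability.Probability"
    "HOL-Real_Asymp.Real_Asymp"
begin

text \<open>
  With \<open>\<chi> = \<surd>2 z\<^sup>3\<^sup>/\<^sup>2 / 3 + \<pi> / 4\<close>, the seed function is, up to a constant factor,
  \<open>(C\<^sub>2 - i C\<^sub>1) exp (i \<chi>) a\<^sub>+ + (C\<^sub>2 + i C\<^sub>1) exp (- i \<chi>) a\<^sub>-\<close> with amplitudes \<open>a\<^sub>\<plusminus>\<close> that are holomorphic and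
  asymptotic to \<open>z\<^sup>-\<^sup>1\<^sup>/\<^sup>4\<close> around the positive axis; they come from a Gaussian integral representing the
  recessive Airy solution. Expanding the Hankel determinant row by row gives
  \<open>\<tau>\<^sub>n\<close> as a sum over \<open>k \<le> n\<close> of \<open>(C\<^sub>2 - i C\<^sub>1)\<^sup>k (C\<^sub>2 + i C\<^sub>1)\<^sup>n\<^sup>-\<^sup>k exp (i (2 k - n) \<chi>)\<close> times a mixed determinant of
  moments concentrated at the two nodes \<open>\<plusminus> i \<chi>'\<close>. In a polynomial basis adapted to the two nodes this
  determinant is, to leading order, a product of Hankel determinants of Gaussian moments of sizes \<open>k\<close> and
  \<open>n - k\<close>, and it decays like \<open>z\<close> to the power \<open>- 3 / 2 (k choose 2 + (n - k) choose 2)\<close>. Hence the middle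
  index dominates if \<open>n\<close> is even, its two neighbours giving the oscillating correction, and the two middle
  indices dominate if \<open>n\<close> is odd. All error terms are holomorphic on discs of radius proportional to \<open>z\<close>, so by
  Cauchy's inequality the expansion may be differentiated.
\<close>

subsection \<open>Power series solutions of the Airy equation\<close>

text \<open>The Hankel determinant cannot be estimated entrywise in its original form: at each node
  the moment matrix has rank one to leading order, so the large contributions to the Leibniz sum
  cancel. In the adapted basis each permutation and each choice of rows can be estimated on its own,
  and a lower bound on the total vanishing order replaces the cancellation. Expansions run in steps
  of z^(-3/2): differentiating an exponential brings a factor of order z^(1/2), differentiating an
  amplitude gains z^(-1). The exponentials are bounded on the real axis only, not on the discs
  needed for Cauchy's inequality, so they are carried as explicit factors (\<open>osym\<close>)
  beside amplitudes controlled on discs (\<open>symb\<close>). Since Ai is given by its Maclaurin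
  series, it is identified with the Gaussian integral through growth: both are bounded on the
  positive axis, where an independent solution is not. This yields only proportionality, which is
  enough because constant factors drop out of logarithmic derivatives.\<close>

fun airy_coeff :: "'a::real_normed_field \<Rightarrow> 'a \<Rightarrow> nat \<Rightarrow> 'a" where
  "airy_coeff a b 0 = a"
| "airy_coeff a b (Suc 0) = b"
| "airy_coeff a b (Suc (Suc 0)) = 0"
| "airy_coeff a b (Suc (Suc (Suc n))) = airy_coeff a b n / (of_nat (n + 2) * of_nat (n + 3))"

text \<open>The recurrences below link index n to n + 3 and may leave residue classes zero, so
  consecutive ratios are of no use. A factor 1/8 every three steps is geometric decay with ratio
  1/2.\<close>

lemma summable_three_step:
  fixes t :: "nat \<Rightarrow> 'a::banach"
  assumes step: "\<And>n. n \<ge> N \<Longrightarrow> norm (t (n + 3)) \<le> norm (t n) / 8"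
  shows "summable t"
proof -
  \<comment> \<open>The maximum covers the terms before the decay sets in; the power of 2
    compensates (1/2)^n there.\<close>
  define C where "C = 2 ^ (N + 3) * Max ((\<lambda>n. norm (t n)) ` {..N + 3})"
  have bound: "norm (t n) \<le> C * (1 / 2) ^ n" for n
  proof (induction n rule: less_induct)
    case (less n)
    show ?case
    proof (cases "n < N + 3")
      case True
      have "norm (t n) \<le> Max ((\<lambda>n. norm (t n)) ` {..N + 3})"
        using True by (intro Max_ge) auto
      moreover have "(0::real) \<le> Max ((\<lambda>n. norm (t n)) ` {..N + 3})"
        by (rule order_trans[OF norm_ge_zero[of "t 0"]], intro Max_ge) auto
      moreover have "(1::real) \<le> 2 ^ (N + 3) * (1 / 2) ^ n"
      proof -
        have "(1::real) = 2 ^ n * (1 / 2) ^ n" by (simp add: power_divide)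
        also have "\<dots> \<le> 2 ^ (N + 3) * (1 / 2) ^ n"
          using True by (intro mult_right_mono power_increasing) auto
        finally show ?thesis .
      qed
      ultimately have "norm (t n) * 1 \<le> Max ((\<lambda>n. norm (t n)) ` {..N + 3}) * (2 ^ (N + 3) * (1 / 2) ^ n)"
        by (intro mult_mono) auto
      thus ?thesis by (simp add: C_def mult_ac)
    next
      case False
      hence "norm (t n) \<le> norm (t (n - 3)) / 8"
        using step[of "n - 3"] by simp
      also have "\<dots> \<le> C * (1 / 2) ^ (n - 3) / 8"
        using less[of "n - 3"] False by simp
      also have "\<dots> = C * (1 / 2) ^ n"
        using False power_add[of "1 / 2 :: real" "n - 3" 3] by (simp add: power3_eq_cube)
      finally show ?thesis .
    qed
  qed
  show ?thesis
    by (rule summable_comparison_test'[OF _ bound])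
      (auto intro!: summable_mult summable_geometric)
qed

lemma summable_airy_coeff:
  fixes a b z :: "'a::{banach, real_normed_field}"
  shows "summable (\<lambda>n. airy_coeff a b n * z ^ n)"
proof (rule summable_three_step)
  fix n :: nat
  define N where "N = nat \<lceil>8 * norm z ^ 3\<rceil>"
  assume "n \<ge> nat \<lceil>8 * norm z ^ 3\<rceil>"
  hence n: "8 * norm z ^ 3 \<le> real n" by linarith
  have "real n \<le> real (n + 2) * real (n + 3)"
    by (simp add: algebra_simps)
  hence *: "8 * norm z ^ 3 \<le> real (n + 2) * real (n + 3)" using n by linarith
  have "norm (airy_coeff a b (n + 3) * z ^ (n + 3)) =
      norm (airy_coeff a b n * z ^ n) * (norm z ^ 3 / (real (n + 2) * real (n + 3)))"
  proof -
    have "norm (2 + of_nat n :: 'a) = real (n + 2)" "norm (3 + of_nat n :: 'a) = real (n + 3)"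
      by (metis norm_of_nat of_nat_add of_nat_numeral add.commute)+
    then show ?thesis
      by (simp add: numeral_3_eq_3 norm_mult norm_divide norm_power power_add mult_ac)
  qed
  also have "\<dots> \<le> norm (airy_coeff a b n * z ^ n) * (1 / 8)"
    using * by (intro mult_left_mono) (auto simp: divide_le_eq mult_ac)
  finally show "norm (airy_coeff a b (n + 3) * z ^ (n + 3)) \<le> norm (airy_coeff a b n * z ^ n) / 8"
    by simp
qed

definition airy_series :: "complex \<Rightarrow> complex \<Rightarrow> complex \<Rightarrow> complex" where
  "airy_series a b z = (\<Sum>n. airy_coeff a b n * z ^ n)"

definition airy_series' :: "complex \<Rightarrow> complex \<Rightarrow> complex \<Rightarrow> complex" where
  "airy_series' a b z = (\<Sum>n. diffs (airy_coeff a b) n * z ^ n)"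

lemma airy_series_deriv: "(airy_series a b has_field_derivative airy_series' a b z) (at z)"
  unfolding airy_series_def[abs_def] airy_series'_def
  by (rule termdiffs_strong_converges_everywhere) (rule summable_airy_coeff)

lemma airy_series'_deriv: "(airy_series' a b has_field_derivative z * airy_series a b z) (at z)"
proof -
  define c where "c = airy_coeff a b"
  have s: "summable (\<lambda>n. diffs c n * z ^ n)" for z :: complex
    unfolding c_def by (rule termdiff_converges_all) (rule summable_airy_coeff)
  have "(airy_series' a b has_field_derivative (\<Sum>n. diffs (diffs c) n * z ^ n)) (at z)"
    unfolding airy_series'_def[abs_def] c_def[symmetric]
    by (rule termdiffs_strong_converges_everywhere) (rule s)
  moreover have "(\<Sum>n. diffs (diffs c) n * z ^ n) = z * airy_series a b z"
  proof -
    have 1: "(\<lambda>n. z * (airy_coeff a b n * z ^ n)) sums (z * airy_series a b z)"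
      unfolding airy_series_def by (intro sums_mult summable_sums summable_airy_coeff)
    have 2: "diffs (diffs c) (Suc n) * z ^ Suc n = z * (airy_coeff a b n * z ^ n)" for n
    proof -
      have "(2 + of_nat n :: complex) = of_nat (n + 2)" "(3 + of_nat n :: complex) = of_nat (n + 3)"
        by auto
      hence "(2 + of_nat n :: complex) \<noteq> 0" "(3 + of_nat n :: complex) \<noteq> 0"
        by (metis Suc_eq_plus1 add_2_eq_Suc' add_Suc_right of_nat_eq_0_iff nat.distinct(1) numeral_3_eq_3)+
      thus ?thesis by (simp add: diffs_def c_def mult_ac add.commute)
    qed
    have "diffs (diffs c) 0 = 0" by (simp add: diffs_def c_def numeral_2_eq_2)
    hence "(\<lambda>n. diffs (diffs c) n * z ^ n) sums (z * airy_series a b z)"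
      using 1 sums_Suc[of "\<lambda>n. diffs (diffs c) n * z ^ n" "z * airy_series a b z"]
      unfolding 2 by simp
    thus ?thesis by (simp add: sums_iff)
  qed
  ultimately show ?thesis by simp
qed

lemma airy_series_0: "airy_series a b 0 = a"
  unfolding airy_series_def using powser_zero[of "airy_coeff a b"] by simp

lemma airy_series'_0: "airy_series' a b 0 = b"
  unfolding airy_series'_def using powser_zero[of "diffs (airy_coeff a b)"] by (simp add: diffs_def)

lemma airy_coeff_linear:
  "airy_coeff a b n = a * airy_coeff 1 0 n + b * airy_coeff 0 1 n"
  by (induction a b n rule: airy_coeff.induct) (auto simp: field_simps simp flip: add_divide_distrib)

lemma airy_coeff_mod:
  "n mod 3 \<noteq> 0 \<Longrightarrow> airy_coeff 1 0 n = 0" "n mod 3 \<noteq> 1 \<Longrightarrow> airy_coeff 0 1 n = 0"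
proof -
  have "(n mod 3 \<noteq> 0 \<longrightarrow> airy_coeff 1 0 n = 0) \<and> (n mod 3 \<noteq> 1 \<longrightarrow> airy_coeff 0 1 n = 0)"
  proof (induction n rule: less_induct)
    case (less n)
    consider "n = 0" | "n = 1" | "n = 2" | m where "n = Suc (Suc (Suc m))"
      by (metis One_nat_def Suc_1 not0_implies_Suc)
    then show ?case
    proof cases
      case 4
      then show ?thesis using less[of m] by (simp add: mod_Suc)
    qed (auto simp: numeral_2_eq_2)
  qed
  thus "n mod 3 \<noteq> 0 \<Longrightarrow> airy_coeff 1 0 n = 0" "n mod 3 \<noteq> 1 \<Longrightarrow> airy_coeff 0 1 n = 0" by auto
qed

lemma airy_series_linear: "airy_series a b z = a * airy_series 1 0 z + b * airy_series 0 1 z"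
proof -
  have "(\<lambda>n. a * (airy_coeff 1 0 n * z ^ n) + b * (airy_coeff 0 1 n * z ^ n)) sums
      (a * airy_series 1 0 z + b * airy_series 0 1 z)"
    unfolding airy_series_def by (intro sums_add sums_mult summable_sums summable_airy_coeff)
  moreover have "airy_coeff a b n * z ^ n = a * (airy_coeff 1 0 n * z ^ n) + b * (airy_coeff 0 1 n * z ^ n)" for n
    by (subst airy_coeff_linear) (simp add: algebra_simps)
  ultimately show ?thesis unfolding airy_series_def[of a b] by (simp add: sums_iff)
qed

lemma airy_coeff_10: "airy_coeff 1 0 (3 * k) = 3 ^ k * pochhammer (1 / 3) k / (fact (3 * k) :: complex)"
proof (induction k)
  case (Suc k)
  define x where "x = complex_of_nat (3 * k)"
  have nz: "x + 1 \<noteq> 0" "x + 2 \<noteq> 0" "x + 3 \<noteq> 0"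
    unfolding x_def
    by (metis of_nat_eq_0_iff of_nat_add of_nat_numeral of_nat_1 add_is_0 zero_neq_numeral zero_neq_one)+
  have f: "fact (3 * Suc k) = (x + 3) * ((x + 2) * ((x + 1) * fact (3 * k)))"
    by (simp add: x_def numeral_3_eq_3 algebra_simps)
  have p: "pochhammer (1 / 3) (Suc k) = pochhammer (1 / 3) k * ((x + 1) / 3)"
    by (simp add: x_def pochhammer_Suc field_simps)
  have c: "airy_coeff 1 0 (3 * Suc k) = airy_coeff 1 0 (3 * k) / ((x + 2) * (x + 3))"
    by (simp add: x_def numeral_3_eq_3 algebra_simps)
  show ?case
    unfolding c f p Suc using nz by (simp add: divide_simps)
qed auto

lemma airy_coeff_01: "airy_coeff 0 1 (3 * k + 1) = 3 ^ k * pochhammer (2 / 3) k / (fact (3 * k + 1) :: complex)"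
proof (induction k)
  case (Suc k)
  define x where "x = complex_of_nat (3 * k + 1)"
  have nz: "x + 1 \<noteq> 0" "x + 2 \<noteq> 0" "x + 3 \<noteq> 0"
    unfolding x_def
    by (metis of_nat_eq_0_iff of_nat_add of_nat_numeral of_nat_1 add_is_0 zero_neq_numeral zero_neq_one)+
  have f: "fact (3 * Suc k + 1) = (x + 3) * ((x + 2) * ((x + 1) * fact (3 * k + 1)))"
    by (simp add: x_def numeral_3_eq_3 algebra_simps)
  have p: "pochhammer (2 / 3) (Suc k) = pochhammer (2 / 3) k * ((x + 1) / 3)"
    by (simp add: x_def pochhammer_Suc field_simps)
  have c: "airy_coeff 0 1 (3 * Suc k + 1) = airy_coeff 0 1 (3 * k + 1) / ((x + 2) * (x + 3))"
    by (simp add: x_def numeral_3_eq_3 algebra_simps)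
  show ?case
    unfolding c f p Suc using nz by (simp add: divide_simps)
qed auto

lemma airy_f_eq: "airy_f = airy_series 1 0"
proof
  fix z
  have "(\<lambda>n. airy_coeff 1 0 n * z ^ n) sums airy_series 1 0 z"
    unfolding airy_series_def by (intro summable_sums summable_airy_coeff)
  hence "(\<lambda>k. airy_coeff 1 0 (3 * k) * z ^ (3 * k)) sums airy_series 1 0 z"
  proof (subst sums_mono_reindex)
    show "airy_coeff 1 0 n * z ^ n = 0" if "n \<notin> range ((*) 3)" for n
      using that airy_coeff_mod(1)[of n]
      by (cases "n mod 3 = 0") (auto simp: image_iff elim!: dvdE simp flip: dvd_eq_mod_eq_0)
  qed (auto simp: strict_mono_def)
  thus "airy_f z = airy_series 1 0 z"
    unfolding airy_f_def airy_coeff_10 by (simp add: sums_iff mult_ac)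
qed

lemma airy_g_eq: "airy_g = airy_series 0 1"
proof
  fix z
  have "(\<lambda>n. airy_coeff 0 1 n * z ^ n) sums airy_series 0 1 z"
    unfolding airy_series_def by (intro summable_sums summable_airy_coeff)
  hence "(\<lambda>k. airy_coeff 0 1 (3 * k + 1) * z ^ (3 * k + 1)) sums airy_series 0 1 z"
  proof (subst sums_mono_reindex[of "\<lambda>k. 3 * k + 1"])
    show "airy_coeff 0 1 n * z ^ n = 0" if "n \<notin> range (\<lambda>k. 3 * k + 1)" for n
    proof (cases "n mod 3 = 1")
      case True
      hence "n = 3 * (n div 3) + 1" using mult_div_mod_eq[of 3 n] by linarith
      with that show ?thesis by blast
    qed (use airy_coeff_mod(2)[of n] in auto)
  qed (auto simp: strict_mono_def)
  thus "airy_g z = airy_series 0 1 z"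
    unfolding airy_g_def airy_coeff_01 by (simp add: sums_iff mult_ac)
qed

lemma airy_wronskian:
  "airy_series 1 0 z * airy_series' 0 1 z - airy_series' 1 0 z * airy_series 0 1 z = 1"
proof -
  have "(\<lambda>z. airy_series 1 0 z * airy_series' 0 1 z - airy_series' 1 0 z * airy_series 0 1 z)
      constant_on UNIV"
    by (rule has_field_derivative_0_imp_constant_on)
      (auto intro!: derivative_eq_intros airy_series_deriv airy_series'_deriv)
  then obtain c where c: "\<And>z. airy_series 1 0 z * airy_series' 0 1 z - airy_series' 1 0 z * airy_series 0 1 z = c"
    unfolding constant_on_def by auto
  from c[of 0] have "c = 1" by (simp add: airy_series_0 airy_series'_0)
  with c show ?thesis by simp
qed

text \<open>Cramer's rule: the Wronskians of \<open>V\<close> with the two series have derivative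
  zero, hence are constant on \<open>D\<close>, and they are the coefficients because the series
  themselves have Wronskian 1.\<close>

lemma airy_solution_eq:
  assumes D: "open D" "connected D"
    and V: "\<And>z. z \<in> D \<Longrightarrow> (V has_field_derivative V' z) (at z)"
    and V': "\<And>z. z \<in> D \<Longrightarrow> (V' has_field_derivative z * V z) (at z)"
  obtains a b where "\<And>z. z \<in> D \<Longrightarrow> V z = a * airy_series 1 0 z + b * airy_series 0 1 z"
proof -
  have "(\<lambda>z. V z * airy_series' 0 1 z - V' z * airy_series 0 1 z) constant_on D"
    by (rule has_field_derivative_0_imp_constant_on)
      (auto intro!: derivative_eq_intros airy_series_deriv airy_series'_deriv V V' D)
  then obtain a where a: "\<And>z. z \<in> D \<Longrightarrow> V z * airy_series' 0 1 z - V' z * airy_series 0 1 z = a"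
    unfolding constant_on_def by auto
  have "(\<lambda>z. airy_series 1 0 z * V' z - airy_series' 1 0 z * V z) constant_on D"
    by (rule has_field_derivative_0_imp_constant_on)
      (auto intro!: derivative_eq_intros airy_series_deriv airy_series'_deriv V V' D)
  then obtain b where b: "\<And>z. z \<in> D \<Longrightarrow> airy_series 1 0 z * V' z - airy_series' 1 0 z * V z = b"
    unfolding constant_on_def by auto
  have "V z = a * airy_series 1 0 z + b * airy_series 0 1 z" if "z \<in> D" for z
  proof -
    have "a * airy_series 1 0 z + b * airy_series 0 1 z = V z *
      (airy_series 1 0 z * airy_series' 0 1 z - airy_series' 1 0 z * airy_series 0 1 z)"
      unfolding a[OF that, symmetric] b[OF that, symmetric] by (simp add: algebra_simps)
    thus ?thesis by (simp add: airy_wronskian)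
  qed
  thus ?thesis using that by blast
qed

text \<open>The first series runs over powers of z^3 only, the second over z times such powers. This
  expresses Ai at rotated arguments in the same basis.\<close>

lemma airy_series_rotate:
  assumes "j ^ 3 = 1"
  shows "airy_series 1 0 (j * z) = airy_series 1 0 z" "airy_series 0 1 (j * z) = j * airy_series 0 1 z"
proof -
  have p: "j ^ n = j ^ (n mod 3)" for n
    using assms by (metis div_mult_mod_eq mult.commute power_add power_mult power_one mult_1)
  have "airy_coeff 1 0 n * (j * z) ^ n = airy_coeff 1 0 n * z ^ n" for n
    using p[of n] airy_coeff_mod(1)[of n] by (cases "n mod 3 = 0") (auto simp: power_mult_distrib)
  thus "airy_series 1 0 (j * z) = airy_series 1 0 z" unfolding airy_series_def by presburger
  have *: "airy_coeff 0 1 n * (j * z) ^ n = j * (airy_coeff 0 1 n * z ^ n)" for n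
    using p[of n] airy_coeff_mod(2)[of n] by (cases "n mod 3 = 1") (auto simp: power_mult_distrib)
  show "airy_series 0 1 (j * z) = j * airy_series 0 1 z"
    unfolding airy_series_def * by (intro suminf_mult summable_airy_coeff)
qed

subsection \<open>The recessive solution as a Laplace-type integral\<close>

text \<open>Shifting the contour in the Fourier integral of Ai(y^2) to the saddle point turns its
  integrand, up to s -> -s and a constant, into exp(-2/3 y^3) times the one here with
  \<open>t = 1\<close>, \<open>k = 0\<close>. The case \<open>t = 0\<close> is the Gaussian used for
  comparison; the powers of \<open>s\<close> arise on differentiating in \<open>y\<close>.\<close>

definition airy_mom :: "real \<Rightarrow> nat \<Rightarrow> complex \<Rightarrow> complex" where
  "airy_mom t k y = (LINT s|lborel. of_real s ^ k * exp (- y * of_real s ^ 2 - \<i> * of_real (t * s ^ 3 / 3)))"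

lemma integrable_gauss_abs:
  assumes "a > 0"
  shows "integrable lborel (\<lambda>s::real. \<bar>s\<bar> ^ k * exp (- a * s ^ 2))"
proof -
  define \<sigma> where "\<sigma> = 1 / sqrt (2 * a)"
  have s: "\<sigma> > 0" "2 * \<sigma>\<^sup>2 = 1 / a" using assms by (auto simp: \<sigma>_def power_divide)
  have "integrable lborel (\<lambda>x. sqrt (2 * pi * \<sigma>\<^sup>2) * (normal_density 0 \<sigma> x * \<bar>x - 0\<bar> ^ k))"
    by (intro integrable_mult_right integrable_normal_moment_abs s)
  moreover have "sqrt (2 * pi * \<sigma>\<^sup>2) * (normal_density 0 \<sigma> x * \<bar>x - 0\<bar> ^ k) = \<bar>x\<bar> ^ k * exp (- a * x ^ 2)" for x
    using s by (simp add: normal_density_def)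
  ultimately show ?thesis by (simp only:)
qed

lemma airy_mom_norm:
  "norm (of_real s ^ k * exp (- y * of_real s ^ 2 - \<i> * of_real (t * s ^ 3 / 3))) = \<bar>s\<bar> ^ k * exp (- Re y * s ^ 2)"
  by (simp add: norm_mult norm_power power2_eq_square)

lemma airy_mom_integrable:
  assumes "Re y > 0"
  shows "integrable lborel (\<lambda>s::real. of_real s ^ k * exp (- y * of_real s ^ 2 - \<i> * of_real (t * s ^ 3 / 3)))"
proof (rule Bochner_Integration.integrable_bound[OF integrable_gauss_abs[of "Re y" k]])
  show "AE s in lborel. norm (of_real s ^ k * exp (- y * of_real s ^ 2 - \<i> * of_real (t * s ^ 3 / 3)))
      \<le> norm (\<bar>s\<bar> ^ k * exp (- Re y * s ^ 2))"
    unfolding airy_mom_norm by simp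
qed (use assms in auto)

text \<open>The increment minus its linear part is bounded by the Taylor remainder of exp. Half of
  the decay rate \<open>Re y\<close> is given up to absorb the growth of that remainder for
  \<open>norm h < a\<close>, which leaves one integrable majorant times the square of
  \<open>norm h\<close>.\<close>

lemma airy_mom_deriv:
  assumes y: "Re y > 0"
  shows "(airy_mom t k has_field_derivative - airy_mom t (k + 2) y) (at y)"
proof -
  define a where "a = Re y / 2"
  have a: "a > 0" using y by (simp add: a_def)
  define C where "C = (LINT s|lborel. \<bar>s\<bar> ^ (k + 4) * exp (- a * s ^ 2))"
  define E where "E = (\<lambda>y s. exp (- y * of_real s ^ 2 - \<i> * of_real (t * s ^ 3 / 3)))"
  have int: "integrable lborel (\<lambda>s. of_real s ^ j * E w s)" if "Re w > 0" for j w
    unfolding E_def using airy_mom_integrable[OF that] .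
  have mom: "airy_mom t j w = (LINT s|lborel. of_real s ^ j * E w s)" for j w
    by (simp add: airy_mom_def E_def)
  have bound: "norm (airy_mom t k (y + h) - airy_mom t k y + h * airy_mom t (k + 2) y) \<le> C * norm h ^ 2"
    if h: "norm h < a" for h
  proof -
    have "\<bar>Re h\<bar> < a" using h abs_Re_le_cmod[of h] by linarith
    hence yh: "Re (y + h) > 0" using a by (simp add: a_def)
    have "airy_mom t k (y + h) - airy_mom t k y + h * airy_mom t (k + 2) y =
        (LINT s|lborel. of_real s ^ k * E (y + h) s - of_real s ^ k * E y s + h * (of_real s ^ (k + 2) * E y s))"
      unfolding mom using int[OF yh, of k] int[OF y, of k] int[OF y, of "k + 2"]
      by (simp add: Bochner_Integration.integral_add Bochner_Integration.integral_diff)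
    also have "norm \<dots> \<le> (LINT s|lborel. norm h ^ 2 * (\<bar>s\<bar> ^ (k + 4) * exp (- a * s ^ 2)))"
    proof (rule Bochner_Integration.integral_norm_bound_integral)
      show "integrable lborel (\<lambda>s. of_real s ^ k * E (y + h) s - of_real s ^ k * E y s + h * (of_real s ^ (k + 2) * E y s))"
        using int[OF yh, of k] int[OF y, of k] int[OF y, of "k + 2"] by auto
      show "integrable lborel (\<lambda>s. norm h ^ 2 * (\<bar>s\<bar> ^ (k + 4) * exp (- a * s ^ 2)))"
        using integrable_gauss_abs[OF a] by auto
      fix s :: real
      define w where "w = - h * of_real s ^ 2"
      have "E (y + h) s = E y s * exp w"
        by (simp add: E_def w_def exp_add[symmetric] algebra_simps)
      hence "of_real s ^ k * E (y + h) s - of_real s ^ k * E y s + h * (of_real s ^ (k + 2) * E y s)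
          = of_real s ^ k * E y s * (exp w - 1 - w)"
        by (simp add: w_def algebra_simps power_add power2_eq_square)
      also have "norm \<dots> = \<bar>s\<bar> ^ k * exp (- Re y * s ^ 2) * norm (exp w - 1 - w)"
        unfolding E_def norm_mult[of _ "exp w - 1 - w"] airy_mom_norm ..
      also have "\<dots> \<le> \<bar>s\<bar> ^ k * exp (- Re y * s ^ 2) * (exp (a * s ^ 2) * (norm h ^ 2 * \<bar>s\<bar> ^ 4))"
      proof (intro mult_left_mono)
        have "norm (exp w - (\<Sum>k\<le>1. w ^ k / fact k)) \<le> exp \<bar>Re w\<bar> * norm w ^ Suc 1 / fact 1"
          by (rule Taylor_exp)
        also have "\<dots> \<le> exp (a * s ^ 2) * norm w ^ Suc 1 / fact 1"
          using \<open>\<bar>Re h\<bar> < a\<close>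
          by (auto simp: w_def power2_eq_square abs_mult intro!: mult_right_mono)
        also have "norm w = norm h * \<bar>s\<bar> ^ 2" by (simp add: w_def norm_mult norm_power)
        finally show "norm (exp w - 1 - w) \<le> exp (a * s ^ 2) * (norm h ^ 2 * \<bar>s\<bar> ^ 4)"
          by (simp add: power_mult_distrib algebra_simps power2_eq_square power4_eq_xxxx)
      qed auto
      also have "\<dots> = norm h ^ 2 * (\<bar>s\<bar> ^ (k + 4) * (exp (- Re y * s ^ 2) * exp (a * s ^ 2)))"
        by (simp add: power_add)
      also have "exp (- Re y * s ^ 2) * exp (a * s ^ 2) = exp (- a * s ^ 2)"
        by (simp add: exp_add[symmetric] a_def field_simps)
      finally show "norm (of_real s ^ k * E (y + h) s - of_real s ^ k * E y s + h * (of_real s ^ (k + 2) * E y s))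
          \<le> norm h ^ 2 * (\<bar>s\<bar> ^ (k + 4) * exp (- a * s ^ 2))" .
    qed
    also have "\<dots> = C * norm h ^ 2" by (simp add: C_def)
    finally show ?thesis .
  qed
  have "((\<lambda>h. (airy_mom t k (y + h) - airy_mom t k y) / h + airy_mom t (k + 2) y) \<longlongrightarrow> 0) (at 0)"
  proof (rule Lim_null_comparison)
    show "\<forall>\<^sub>F h in at 0. norm ((airy_mom t k (y + h) - airy_mom t k y) / h + airy_mom t (k + 2) y) \<le> C * norm h"
      unfolding eventually_at
    proof (intro exI[of _ a] conjI ballI impI a)
      fix h :: complex assume h: "h \<noteq> 0 \<and> dist h 0 < a"
      have "(airy_mom t k (y + h) - airy_mom t k y) / h + airy_mom t (k + 2) y =
          (airy_mom t k (y + h) - airy_mom t k y + h * airy_mom t (k + 2) y) / h"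
        using h by (simp add: field_simps)
      also have "norm \<dots> \<le> C * norm h ^ 2 / norm h"
        using bound[of h] h by (auto simp: norm_divide intro!: divide_right_mono)
      also have "\<dots> = C * norm h" by (simp add: power2_eq_square)
      finally show "norm ((airy_mom t k (y + h) - airy_mom t k y) / h + airy_mom t (k + 2) y) \<le> C * norm h" .
    qed
    have "((\<lambda>h::complex. C * norm h) \<longlongrightarrow> C * norm (0::complex)) (at 0)" by (intro tendsto_intros)
    thus "((\<lambda>h::complex. C * norm h) \<longlongrightarrow> 0) (at 0)" by simp
  qed
  from tendsto_add[OF this tendsto_const[of "- airy_mom t (k + 2) y"]]
  show ?thesis unfolding DERIV_def by simp
qed

text \<open>The derivative of s^k times the exponential integrates to zero over the line. For
  \<open>k = 0\<close> the truncated index \<open>k - 1\<close> is harmless, as its factor is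
  zero.\<close>

lemma airy_mom_rec:
  assumes y: "Re y > 0"
  shows "of_nat k * airy_mom t (k - 1) y = 2 * y * airy_mom t (k + 1) y + \<i> * of_real t * airy_mom t (k + 2) y"
proof -
  define E where "E = (\<lambda>s. exp (- y * of_real s ^ 2 - \<i> * of_real (t * s ^ 3 / 3)))"
  define f where "f = (\<lambda>s. of_nat k * (of_real s ^ (k - 1) * E s) - 2 * y * (of_real s ^ (k + 1) * E s)
      - \<i> * of_real t * (of_real s ^ (k + 2) * E s))"
  have int: "integrable lborel (\<lambda>s. of_real s ^ j * E s)" for j
    unfolding E_def using airy_mom_integrable[OF y] .
  have mom: "airy_mom t j y = (LINT s|lborel. of_real s ^ j * E s)" for j
    by (simp add: airy_mom_def E_def)
  have nrm: "norm (of_real s ^ k * E s) = \<bar>s\<bar> ^ k * exp (- Re y * s ^ 2)" for s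
    unfolding E_def by (rule airy_mom_norm)
  have 1: "((\<lambda>s. \<bar>s\<bar> ^ k * exp (- Re y * s ^ 2)) \<longlongrightarrow> 0) at_top"
    using y by real_asymp
  have 2: "((\<lambda>s. \<bar>s\<bar> ^ k * exp (- Re y * s ^ 2)) \<longlongrightarrow> 0) at_bot"
    using y by real_asymp
  have "(LBINT s=-\<infinity>..\<infinity>. f s) = 0 - 0"
  proof (rule interval_integral_FTC_integrable[where F = "\<lambda>s. of_real s ^ k * E s"])
    show "((\<lambda>s. of_real s ^ k * E s) has_vector_derivative f s) (at s)" for s
    proof -
      have "((\<lambda>z. z ^ k * exp (- y * z ^ 2 - \<i> * of_real (t / 3) * z ^ 3)) has_field_derivative f s) (at (of_real s))"
        by (auto intro!: derivative_eq_intros simp: f_def E_def algebra_simps power2_eq_square)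
      from has_vector_derivative_real_field[OF this]
      show ?thesis unfolding E_def by (simp add: o_def mult_ac)
    qed
    define g where "g = (\<lambda>z. exp (- y * z ^ 2 - \<i> * of_real (t / 3) * z ^ 3))"
    define F where "F = (\<lambda>z. of_nat k * (z ^ (k - 1) * g z) - 2 * y * (z ^ (k + 1) * g z)
      - \<i> * of_real t * (z ^ (k + 2) * g z))"
    have "F holomorphic_on UNIV" unfolding F_def g_def by (intro holomorphic_intros)
    hence "continuous_on UNIV F" by (rule holomorphic_on_imp_continuous_on)
    hence "continuous_on UNIV (\<lambda>s. F (complex_of_real s))"
      by (rule continuous_on_compose2[OF _ continuous_on_of_real_id]) auto
    moreover have "(\<lambda>s. F (complex_of_real s)) = f"
      by (simp add: fun_eq_iff F_def f_def g_def E_def mult.assoc)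
    ultimately have "continuous_on UNIV f" by metis
    thus "isCont f s" for s by (simp add: continuous_on_eq_continuous_at)
    show "set_integrable lborel (einterval (- \<infinity>) \<infinity>) f"
      using int[of "k - 1"] int[of "k + 1"] int[of "k + 2"]
      by (auto simp: set_integrable_def einterval_def f_def)
    show "(((\<lambda>s. of_real s ^ k * E s) \<circ> real_of_ereal) \<longlongrightarrow> 0) (at_right (- \<infinity>))"
      unfolding ereal_tendsto_simps by (rule tendsto_norm_zero_cancel) (use 2 nrm in simp)
    show "(((\<lambda>s. of_real s ^ k * E s) \<circ> real_of_ereal) \<longlongrightarrow> 0) (at_left \<infinity>)"
      unfolding ereal_tendsto_simps by (rule tendsto_norm_zero_cancel) (use 1 nrm in simp)
  qed auto
  hence "(LINT s|lborel. f s) = 0"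
    by (simp add: interval_lebesgue_integral_def set_lebesgue_integral_def einterval_def)
  also have "(LINT s|lborel. f s) = of_nat k * airy_mom t (k - 1) y - 2 * y * airy_mom t (k + 1) y - \<i> * of_real t * airy_mom t (k + 2) y"
    unfolding f_def mom using int[of "k - 1"] int[of "k + 1"] int[of "k + 2"] by simp
  finally show ?thesis by (simp add: algebra_simps)
qed

text \<open>By the recurrence the product with \<open>csqrt y\<close> has derivative zero on the
  half-plane, so the real Gaussian integral at \<open>y = 1\<close> determines it without rotating
  contours.\<close>

lemma airy_mom_gauss: "Re y > 0 \<Longrightarrow> airy_mom 0 0 y = of_real (sqrt pi) / csqrt y"
proof -
  have ne: "y \<notin> \<real>\<^sub>\<le>\<^sub>0" if "Re y > 0" for y using that by (auto simp: complex_nonpos_Reals_iff)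
  have d: "((\<lambda>y. airy_mom 0 0 y * csqrt y) has_field_derivative 0) (at y)" if "Re y > 0" for y
  proof -
    have "((\<lambda>y. airy_mom 0 0 y * csqrt y) has_field_derivative
        (- airy_mom 0 2 y * csqrt y + airy_mom 0 0 y * (1 / (2 * csqrt y)))) (at y)"
      using airy_mom_deriv[OF that, of 0 0, simplified] ne[OF that]
      by (auto intro!: derivative_eq_intros has_field_derivative_csqrt simp: field_simps eval_nat_numeral)
    moreover have "- airy_mom 0 2 y * csqrt y + airy_mom 0 0 y * (1 / (2 * csqrt y)) = 0"
    proof -
      have "airy_mom 0 0 y = 2 * y * airy_mom 0 2 y"
        using airy_mom_rec[OF that, of 1 0] by (simp add: eval_nat_numeral)
      also have "2 * y = 2 * (csqrt y * csqrt y)" by (metis power2_csqrt power2_eq_square)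
      finally show ?thesis using that by (auto simp: field_simps)
    qed
    ultimately show ?thesis by metis
  qed
  have "(\<lambda>y. airy_mom 0 0 y * csqrt y) constant_on {y. Re y > 0}"
    using d by (intro has_field_derivative_0_imp_constant_on)
      (auto simp: open_halfspace_Re_gt intro!: convex_connected convex_halfspace_Re_gt)
  then obtain c where c: "\<And>y. Re y > 0 \<Longrightarrow> airy_mom 0 0 y * csqrt y = c"
    unfolding constant_on_def by auto
  define I where "I = integral\<^sup>L lborel (\<lambda>s::real. exp (- (s ^ 2)))"
  have "airy_mom 0 0 1 = of_real I"
    unfolding airy_mom_def I_def by (simp flip: integral_of_real of_real_exp of_real_power of_real_minus)
  also have "I = sqrt pi * (LINT s|lborel. normal_density 0 (1 / sqrt 2) s)"
    by (simp add: I_def normal_density_def power_divide real_sqrt_mult)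
  also have "(LINT s|lborel. normal_density 0 (1 / sqrt 2) s) = 1"
    by (rule integral_normal_density) auto
  finally have "c = of_real (sqrt pi)" using c[of 1] by simp
  moreover assume "Re y > 0"
  moreover from this have "csqrt y \<noteq> 0" by auto
  ultimately show ?thesis using c[of y] by (simp add: nonzero_eq_divide_eq)
qed

definition airy_U :: "complex \<Rightarrow> complex" where
  "airy_U = airy_mom 1 0"

text \<open>The third Gaussian moment vanishes, so the linear term of exp(-i s^3/3) may be
  subtracted for free, and the remainder, at most s^6/9, is integrated against the Gaussian. The
  sixth moment 15/8 sqrt(pi) a^(-7/2) gives the constant 15/72. The relative error y^(-3) is
  z^(-3/2) for y = csqrt z.\<close>

lemma airy_U_asymp:
  assumes y: "Re y > 0"
  shows "norm (airy_U y - of_real (sqrt pi) / csqrt y) \<le> 15 * sqrt pi / 72 * (Re y) powr (- 7 / 2)"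
proof -
  define a where "a = Re y"
  have a: "a > 0" using y by (simp add: a_def)
  define E where "E = (\<lambda>t s. exp (- y * of_real s ^ 2 - \<i> * of_real (t * s ^ 3 / 3)))"
  have int: "integrable lborel (\<lambda>s. of_real s ^ j * E t s)" for j t
    unfolding E_def using airy_mom_integrable[OF y] .
  have mom: "airy_mom t j y = (LINT s|lborel. of_real s ^ j * E t s)" for t j
    by (simp add: airy_mom_def E_def)
  have "airy_mom 0 1 y = 0" using airy_mom_rec[OF y, of 0 0] y by auto
  hence m3: "airy_mom 0 3 y = 0" using airy_mom_rec[OF y, of 2 0] y by (auto simp: numeral_3_eq_3)
  have "airy_U y - airy_mom 0 0 y = airy_mom 1 0 y - airy_mom 0 0 y + \<i> / 3 * airy_mom 0 3 y"
    by (simp add: m3 airy_U_def)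
  also have "\<dots> = (LINT s|lborel. of_real s ^ 0 * E 1 s - of_real s ^ 0 * E 0 s + \<i> / 3 * (of_real s ^ 3 * E 0 s))"
    unfolding mom using int[of 0 1] int[of 0 0] int[of 3 0] by simp
  also have "norm \<dots> \<le> (LINT s|lborel. 1 / 9 * (\<bar>s\<bar> ^ 6 * exp (- a * s ^ 2)))"
  proof (rule Bochner_Integration.integral_norm_bound_integral)
    show "integrable lborel (\<lambda>s. of_real s ^ 0 * E 1 s - of_real s ^ 0 * E 0 s + \<i> / 3 * (of_real s ^ 3 * E 0 s))"
      using int[of 0 1] int[of 0 0] int[of 3 0] by auto
    show "integrable lborel (\<lambda>s. 1 / 9 * (\<bar>s\<bar> ^ 6 * exp (- a * s ^ 2)))"
      using integrable_gauss_abs[OF a] by (intro integrable_mult_right)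
    fix s :: real
    define w where "w = - \<i> * of_real (s ^ 3 / 3)"
    have "E 1 s = E 0 s * exp w" by (simp add: E_def w_def exp_add[symmetric])
    hence "of_real s ^ 0 * E 1 s - of_real s ^ 0 * E 0 s + \<i> / 3 * (of_real s ^ 3 * E 0 s) = E 0 s * (exp w - 1 - w)"
      by (simp add: w_def algebra_simps)
    also have "norm \<dots> = exp (- a * s ^ 2) * norm (exp w - 1 - w)"
      unfolding norm_mult E_def a_def using airy_mom_norm[of s 0 y 0] by simp
    also have "\<dots> \<le> exp (- a * s ^ 2) * (\<bar>s\<bar> ^ 6 / 9)"
    proof (intro mult_left_mono)
      have "norm (exp w - (\<Sum>k\<le>1. w ^ k / fact k)) \<le> exp \<bar>Re w\<bar> * norm w ^ Suc 1 / fact 1"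
        by (rule Taylor_exp)
      also have "Re w = 0" by (simp add: w_def)
      also have "norm w = \<bar>s\<bar> ^ 3 / 3" by (simp add: w_def norm_mult norm_divide norm_power power_abs)
      finally show "norm (exp w - 1 - w) \<le> \<bar>s\<bar> ^ 6 / 9"
        by (simp add: algebra_simps power_divide flip: power_mult)
    qed auto
    finally show "norm (of_real s ^ 0 * E 1 s - of_real s ^ 0 * E 0 s + \<i> / 3 * (of_real s ^ 3 * E 0 s))
        \<le> 1 / 9 * (\<bar>s\<bar> ^ 6 * exp (- a * s ^ 2))" by (simp add: mult_ac)
  qed
  also have "\<dots> = 1 / 9 * (LINT s|lborel. s ^ 6 * exp (- a * s ^ 2))"
    by (simp add: power_even_abs)
  also have "(LINT s|lborel. s ^ 6 * exp (- a * s ^ 2)) = 15 * sqrt pi / 8 * a powr (- 7 / 2)"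
  proof -
    have "of_real (LINT s|lborel. s ^ 6 * exp (- a * s ^ 2)) = airy_mom 0 6 (of_real a)"
      unfolding airy_mom_def by (simp flip: integral_of_real of_real_exp of_real_power of_real_minus of_real_mult)
    also have "\<dots> = 15 / (8 * of_real a ^ 3) * airy_mom 0 0 (of_real a)"
    proof -
      have a': "Re (of_real a) > 0" "complex_of_real a \<noteq> 0" using a by auto
      have "airy_mom 0 0 (of_real a) = 2 * of_real a * airy_mom 0 2 (of_real a)"
        "3 * airy_mom 0 2 (of_real a) = 2 * of_real a * airy_mom 0 4 (of_real a)"
        "5 * airy_mom 0 4 (of_real a) = 2 * of_real a * airy_mom 0 6 (of_real a)"
        using airy_mom_rec[OF a'(1), of 1 0] airy_mom_rec[OF a'(1), of 3 0] airy_mom_rec[OF a'(1), of 5 0]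
        by (simp_all add: numeral_2_eq_2)
      hence "airy_mom 0 2 (of_real a) = airy_mom 0 0 (of_real a) / (2 * of_real a)"
        "airy_mom 0 4 (of_real a) = 3 * airy_mom 0 2 (of_real a) / (2 * of_real a)"
        "airy_mom 0 6 (of_real a) = 5 * airy_mom 0 4 (of_real a) / (2 * of_real a)"
        using a' by simp_all
      thus ?thesis using a' by (simp add: power3_eq_cube)
    qed
    also have "airy_mom 0 0 (of_real a) = of_real (sqrt pi / sqrt a)"
      using a by (subst airy_mom_gauss) (auto simp: csqrt_of_real_nonneg)
    also have "15 / (8 * of_real a ^ 3) * complex_of_real (sqrt pi / sqrt a) = of_real (15 * sqrt pi / 8 * (1 / (a ^ 3 * sqrt a)))"
      by simp
    also have "1 / (a ^ 3 * sqrt a) = a powr (- 7 / 2)"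
    proof -
      have "a ^ 3 * sqrt a = a powr 3 * a powr (1 / 2)" using a by (simp add: powr_half_sqrt powr_numeral)
      also have "\<dots> = a powr (3 + 1 / 2)" by (simp only: powr_add)
      also have "\<dots> = a powr (7 / 2)" by simp
      finally show ?thesis using a by (simp add: powr_minus field_simps)
    qed
    finally show ?thesis using of_real_eq_iff by blast
  qed
  finally show ?thesis using y by (simp add: airy_mom_gauss a_def)
qed

definition airy_V :: "complex \<Rightarrow> complex" where
  "airy_V z = exp (- 2 / 3 * csqrt z ^ 3) * airy_U (csqrt z)"

text \<open>In the variable y = csqrt z the equation w'' = z w for exp(-2/3 y^3) U(y) reads U'' = (4
  y^2 + 1/y) U' + 2 y U, and this is a combination of the moment recurrences for k = 0, 1,
  2.\<close>

lemma airy_V_solution: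
  obtains V' where "\<And>z. z \<notin> \<real>\<^sub>\<le>\<^sub>0 \<Longrightarrow> (airy_V has_field_derivative V' z) (at z)"
    "\<And>z. z \<notin> \<real>\<^sub>\<le>\<^sub>0 \<Longrightarrow> (V' has_field_derivative z * airy_V z) (at z)"
proof -
  define U1 where "U1 = (\<lambda>y. - airy_mom 1 2 y)"
  define G where "G = (\<lambda>y. exp (- 2 / 3 * y ^ 3) * airy_U y)"
  define H where "H = (\<lambda>y. exp (- 2 / 3 * y ^ 3) * (U1 y - 2 * y ^ 2 * airy_U y) / (2 * y))"
  have U: "(airy_U has_field_derivative U1 y) (at y)" if "Re y > 0" for y
    unfolding airy_U_def U1_def using airy_mom_deriv[OF that, of 1 0] by (simp add: numeral_2_eq_2)
  have U1: "(U1 has_field_derivative (4 * y ^ 2 + 1 / y) * U1 y + 2 * y * airy_U y) (at y)" if "Re y > 0" for y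
  proof -
    have "y \<noteq> 0" using that by auto
    have m: "2 * y * airy_mom 1 1 y + \<i> * airy_mom 1 2 y = 0"
      "airy_mom 1 0 y = 2 * y * airy_mom 1 2 y + \<i> * airy_mom 1 3 y"
      "2 * airy_mom 1 1 y = 2 * y * airy_mom 1 3 y + \<i> * airy_mom 1 4 y"
      using airy_mom_rec[OF that, of 0 1] airy_mom_rec[OF that, of 1 1] airy_mom_rec[OF that, of 2 1]
      by (simp_all add: eval_nat_numeral)
    have "airy_mom 1 4 y = - \<i> * (\<i> * airy_mom 1 4 y)" by simp
    also have "\<i> * airy_mom 1 4 y = 2 * airy_mom 1 1 y - 2 * y * airy_mom 1 3 y"
      using m(3) by simp
    finally have "airy_mom 1 4 y = - 2 * \<i> * airy_mom 1 1 y + 2 * \<i> * y * airy_mom 1 3 y"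
      by (simp add: algebra_simps)
    moreover have "airy_mom 1 1 y = - \<i> * airy_mom 1 2 y / (2 * y)"
      using m(1) \<open>y \<noteq> 0\<close> by (simp add: field_simps eq_neg_iff_add_eq_0 add.commute)
    moreover have "airy_mom 1 3 y = - \<i> * (airy_mom 1 0 y - 2 * y * airy_mom 1 2 y)"
      by (simp add: m(2))
    ultimately have "airy_mom 1 4 y = - 2 * \<i> * (- \<i> * airy_mom 1 2 y / (2 * y)) +
        2 * \<i> * y * (- \<i> * (airy_mom 1 0 y - 2 * y * airy_mom 1 2 y))"
      by (simp only:)
    also have "\<dots> = (4 * y ^ 2 + 1 / y) * U1 y + 2 * y * airy_U y"
      using \<open>y \<noteq> 0\<close> by (simp add: U1_def airy_U_def field_simps power2_eq_square)
    finally have "airy_mom 1 4 y = (4 * y ^ 2 + 1 / y) * U1 y + 2 * y * airy_U y" .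
    moreover have "(U1 has_field_derivative airy_mom 1 4 y) (at y)"
      unfolding U1_def using airy_mom_deriv[OF that, of 1 2]
      by (auto intro!: derivative_eq_intros)
    ultimately show ?thesis by simp
  qed
  have cs: "Re (csqrt z) > 0" if "z \<notin> \<real>\<^sub>\<le>\<^sub>0" for z
  proof (rule ccontr)
    assume "\<not> Re (csqrt z) > 0"
    hence "Re (csqrt z) = 0" using csqrt_principal[of z] by auto
    hence "Re (csqrt z ^ 2) \<le> 0" "Im (csqrt z ^ 2) = 0"
      by (simp_all only: Re_power2 Im_power2) auto
    thus False using that by (simp add: complex_nonpos_Reals_iff)
  qed
  have G: "(G has_field_derivative exp (- 2 / 3 * y ^ 3) * (U1 y - 2 * y ^ 2 * airy_U y)) (at y)" if "Re y > 0" for y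
    unfolding G_def by (auto intro!: derivative_eq_intros U that simp: algebra_simps)
  have H: "(H has_field_derivative 2 * y ^ 3 * exp (- 2 / 3 * y ^ 3) * airy_U y) (at y)" if "Re y > 0" for y
  proof -
    have nz: "y \<noteq> 0" using that by auto
    hence nz2: "2 * y \<noteq> 0" by simp
    define e where "e = exp (- 2 / 3 * y ^ 3)"
    have N: "((\<lambda>y. U1 y - 2 * y ^ 2 * airy_U y) has_field_derivative
        (4 * y ^ 2 + 1 / y) * U1 y + 2 * y * airy_U y - (4 * y * airy_U y + 2 * y ^ 2 * U1 y)) (at y)"
      by (auto intro!: derivative_eq_intros U U1 that)
    have e: "((\<lambda>y. exp (- 2 / 3 * y ^ 3)) has_field_derivative - 2 * y ^ 2 * e) (at y)"
      by (auto intro!: derivative_eq_intros simp: e_def)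
    have d: "((\<lambda>y. 2 * y) has_field_derivative 2) (at y)"
      by (auto intro!: derivative_eq_intros)
    have "((- 2 * y ^ 2 * e * (q - 2 * y ^ 2 * p) +
        ((4 * y ^ 2 + 1 / y) * q + 2 * y * p - (4 * y * p + 2 * y ^ 2 * q)) * e) * (2 * y) -
        (e * (q - 2 * y ^ 2 * p)) * 2) / ((2 * y) * (2 * y)) = 2 * y ^ 3 * e * p" for p q
    proof -
      \<comment> \<open>With a letter for 1/y the claim becomes a polynomial identity modulo r y =
        1.\<close>
      define r where "r = 1 / y"
      have "((- 2 * y ^ 2 * e * (q - 2 * y ^ 2 * p) +
        ((4 * y ^ 2 + r) * q + 2 * y * p - (4 * y * p + 2 * y ^ 2 * q)) * e) * (2 * y) -
        (e * (q - 2 * y ^ 2 * p)) * 2) = (2 * y ^ 3 * e * p) * ((2 * y) * (2 * y)) + 2 * q * e * (r * y - 1)"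
        by (simp add: algebra_simps power2_eq_square power3_eq_cube)
      also have "r * y = 1" using nz by (simp add: r_def)
      finally have "((- 2 * y ^ 2 * e * (q - 2 * y ^ 2 * p) +
        ((4 * y ^ 2 + r) * q + 2 * y * p - (4 * y * p + 2 * y ^ 2 * q)) * e) * (2 * y) -
        (e * (q - 2 * y ^ 2 * p)) * 2) = (2 * y ^ 3 * e * p) * ((2 * y) * (2 * y))"
        by simp
      moreover have "(2 * y) * (2 * y) \<noteq> 0" using nz by simp
      ultimately show ?thesis unfolding r_def[symmetric] by (metis nonzero_mult_div_cancel_right)
    qed
    moreover have "(H has_field_derivative ((- 2 * y ^ 2 * e * (U1 y - 2 * y ^ 2 * airy_U y) +
        ((4 * y ^ 2 + 1 / y) * U1 y + 2 * y * airy_U y - (4 * y * airy_U y + 2 * y ^ 2 * U1 y)) * e) * (2 * y) -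
        (e * (U1 y - 2 * y ^ 2 * airy_U y)) * 2) / ((2 * y) * (2 * y))) (at y)"
      unfolding H_def using DERIV_divide[OF DERIV_mult[OF e N] d nz2] unfolding e_def .
    ultimately show ?thesis unfolding e_def by metis
  qed
  show ?thesis
  proof
    fix z :: complex assume z: "z \<notin> \<real>\<^sub>\<le>\<^sub>0"
    have c: "(csqrt has_field_derivative 1 / (2 * csqrt z)) (at z)"
      using has_field_derivative_csqrt[OF z] by (simp add: inverse_eq_divide)
    have nz: "csqrt z \<noteq> 0" using cs[OF z] by auto
    have z2: "z = csqrt z * csqrt z" by (metis power2_csqrt power2_eq_square)
    have "exp (- 2 / 3 * csqrt z ^ 3) * (U1 (csqrt z) - 2 * csqrt z ^ 2 * airy_U (csqrt z)) * (1 / (2 * csqrt z)) = H (csqrt z)"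
      unfolding H_def by simp
    moreover have "airy_V = (\<lambda>z. G (csqrt z))" by (simp add: fun_eq_iff airy_V_def G_def)
    ultimately show "(airy_V has_field_derivative H (csqrt z)) (at z)"
      using DERIV_chain2[OF G[OF cs[OF z]] c] by (simp only:)
    have "((\<lambda>z. H (csqrt z)) has_field_derivative 2 * csqrt z ^ 3 * exp (- 2 / 3 * csqrt z ^ 3) * airy_U (csqrt z) * (1 / (2 * csqrt z))) (at z)"
      using DERIV_chain2[OF H[OF cs[OF z]] c] .
    also have "2 * csqrt z ^ 3 * exp (- 2 / 3 * csqrt z ^ 3) * airy_U (csqrt z) * (1 / (2 * csqrt z)) =
        csqrt z * csqrt z * airy_V z"
      using nz unfolding airy_V_def power3_eq_cube by simp
    finally show "((\<lambda>z. H (csqrt z)) has_field_derivative z * airy_V z) (at z)"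
      by (simp only: z2[symmetric])
  qed
qed

subsection \<open>The connection formula\<close>

lemma has_bochner_integral_Gamma:
  fixes x :: real
  assumes "x > 0"
  shows "has_bochner_integral lborel (\<lambda>t::real. indicator {0..} t * t powr (x - 1) / exp t) (Gamma x)"
proof (rule has_bochner_integral_nn_integral)
  show "(\<integral>\<^sup>+ t. ennreal (indicator {0..} t * t powr (x - 1) / exp t) \<partial>lborel) = ennreal (Gamma x)"
    using Gamma_conv_nn_integral_real[OF assms] by simp
qed (use assms in \<open>auto intro: Gamma_real_nonneg\<close>)

text \<open>The integral of s^k exp(-s^3/3) over s > 0, evaluated in the variable v = s^3/3;
  \<open>ai_dens\<close> is the integrand in that variable.\<close>

definition ai_mass :: "nat \<Rightarrow> real" where
  "ai_mass k = 3 powr ((real k - 2) / 3) * Gamma ((real k + 1) / 3)"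

definition ai_dens :: "nat \<Rightarrow> real \<Rightarrow> real" where
  "ai_dens k v = indicator {0..} v * (3 * v) powr ((real k - 2) / 3) / exp v"

lemma ai_dens_integral: "has_bochner_integral lborel (ai_dens k) (ai_mass k)"
proof -
  have "has_bochner_integral lborel (\<lambda>t. 3 powr ((real k - 2) / 3) *
      (indicator {0..} t * t powr ((real k + 1) / 3 - 1) / exp t)) (ai_mass k)"
    unfolding ai_mass_def by (intro has_bochner_integral_mult_right has_bochner_integral_Gamma) auto
  also have "(\<lambda>t. 3 powr ((real k - 2) / 3) * (indicator {0..} t * t powr ((real k + 1) / 3 - 1) / exp t)) = ai_dens k"
  proof
    fix t :: real
    have *: "(real k + 1) / 3 - 1 = (real k - 2) / 3" by (simp add: field_simps)
    show "3 powr ((real k - 2) / 3) * (indicator {0..} t * t powr ((real k + 1) / 3 - 1) / exp t) = ai_dens k t"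
      unfolding *
      unfolding ai_dens_def by (auto simp: powr_mult indicator_def)
  qed
  finally show ?thesis .
qed

lemma ai_dens_power: "ai_dens k v = ai_dens 0 v * ((3 * v) powr (1 / 3)) ^ k"
proof (cases "v > 0")
  case True
  have "(real k - 2) / 3 = (real 0 - 2) / 3 + (1 / 3) * real k" by (simp add: field_simps)
  hence "(3 * v) powr ((real k - 2) / 3) = (3 * v) powr ((real 0 - 2) / 3) * ((3 * v) powr (1 / 3)) powr real k"
    by (simp only: powr_add powr_powr)
  thus ?thesis using True by (simp add: ai_dens_def powr_realpow)
qed (auto simp: ai_dens_def indicator_def)

lemma ai_dens_nonneg: "ai_dens k v \<ge> 0"
  by (simp add: ai_dens_def)

lemma ai_mass_step: "ai_mass (k + 3) = (real k + 1) * ai_mass k"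
proof -
  have 1: "(real (k + 3) + 1) / 3 = (real k + 1) / 3 + 1" "(real (k + 3) - 2) / 3 = (real k - 2) / 3 + 1"
    by (simp_all add: field_simps)
  have 2: "Gamma ((real k + 1) / 3 + 1) = (real k + 1) / 3 * Gamma ((real k + 1) / 3)"
    by (rule Gamma_plus1) (auto elim!: nonpos_Ints_cases)
  show ?thesis
    unfolding ai_mass_def 1 2 powr_add by simp
qed

lemma ai_mass_nonneg: "ai_mass k \<ge> 0"
  by (auto simp: ai_mass_def intro!: mult_nonneg_nonneg Gamma_real_nonneg)

lemma summable_ai_mass:
  assumes "x \<ge> 0"
  shows "summable (\<lambda>k. x ^ k / fact k * ai_mass k)"
proof (rule summable_three_step)
  fix n :: nat
  assume "n \<ge> nat \<lceil>8 * x ^ 3\<rceil>"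
  hence "8 * x ^ 3 \<le> real n" by linarith
  also have "\<dots> \<le> real (n + 2) * real (n + 3)" by (simp add: algebra_simps)
  finally have *: "8 * x ^ 3 \<le> real (n + 2) * real (n + 3)" .
  have "x ^ (n + 3) / fact (n + 3) * ai_mass (n + 3) =
      (x ^ n / fact n * ai_mass n) * (x ^ 3 / (real (n + 2) * real (n + 3)))"
  proof -
    have "fact (n + 3) = (real n + 3) * ((real n + 2) * ((real n + 1) * fact n))"
      by (simp add: numeral_3_eq_3 algebra_simps)
    thus ?thesis unfolding ai_mass_step by (simp add: power_add divide_simps)
  qed
  also have "norm \<dots> \<le> (x ^ n / fact n * ai_mass n) * (1 / 8)"
  proof -
    have "x ^ 3 / (real (n + 2) * real (n + 3)) \<le> 1 / 8" using * by (simp add: divide_le_eq mult_ac)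
    hence "(x ^ n / fact n * ai_mass n) * (x ^ 3 / (real (n + 2) * real (n + 3))) \<le> (x ^ n / fact n * ai_mass n) * (1 / 8)"
      using assms by (intro mult_left_mono mult_nonneg_nonneg divide_nonneg_nonneg ai_mass_nonneg) auto
    moreover have "0 \<le> (x ^ n / fact n * ai_mass n) * (x ^ 3 / (real (n + 2) * real (n + 3)))"
      using assms by (auto intro!: mult_nonneg_nonneg divide_nonneg_nonneg ai_mass_nonneg)
    ultimately show ?thesis by simp
  qed
  finally show "norm (x ^ (n + 3) / fact (n + 3) * ai_mass (n + 3)) \<le> norm (x ^ n / fact n * ai_mass n) / 8"
    using assms ai_mass_nonneg by simp
qed

lemma airy_coeff_of_real: "airy_coeff (of_real a) (of_real b) n = of_real (airy_coeff a b n)"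
  by (induction a b n rule: airy_coeff.induct) auto

text \<open>The Maclaurin series of the integral of \<open>exp (- s\<^sup>3 / 3 - x s e\<^sup>\<pi>\<^sup>i\<^sup>/\<^sup>3)\<close> over \<open>s > 0\<close>, in the variable
  \<open>v = s\<^sup>3 / 3\<close>; the integral is bounded for \<open>x \<ge> 0\<close>.\<close>

lemma airy_series_bounded:
  fixes x :: real
  assumes x: "x \<ge> 0"
  defines "r0 \<equiv> sin (pi / 3) * ai_mass 0" and "r1 \<equiv> - sin (pi / 3) * ai_mass 1"
  shows "norm (airy_series (of_real r0) (of_real r1) (of_real x)) \<le> ai_mass 0"
proof -
  \<comment> \<open>On the ray through \<open>\<rho>\<close> the cube is negative, so exp(t^3/3 - x
    t) decays along it; for x \<ge> 0 the factor with x is at most 1 in modulus because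
    \<open>Re \<rho>\<close> is 1/2.\<close>
  define \<rho> where "\<rho> = cis (pi / 3)"
  define a where "a = (\<lambda>v. (3 * v) powr (1 / 3) :: real)"
  define t where "t = (\<lambda>k v. \<rho> * (- of_real x * \<rho>) ^ k / fact k * complex_of_real (ai_dens k v))"
  have rho3: "\<rho> ^ 3 = - 1" unfolding \<rho>_def Complex.DeMoivre by simp
  have rho: "norm \<rho> = 1" by (simp add: \<rho>_def)
  have t_int: "has_bochner_integral lborel (t k) (\<rho> * (- of_real x * \<rho>) ^ k / fact k * of_real (ai_mass k))" for k
    unfolding t_def by (intro has_bochner_integral_mult_right has_bochner_integral_of_real ai_dens_integral)
  have t_norm: "norm (t k v) = x ^ k / fact k * ai_dens k v" for k v
    using x rho by (simp add: t_def norm_mult norm_divide norm_power ai_dens_nonneg)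
  have t_eq: "t k v = \<rho> * of_real (ai_dens 0 v) * ((- of_real x * \<rho> * of_real (a v)) ^ k / fact k)" for k v
    unfolding t_def by (subst ai_dens_power)
      (simp only: a_def power_mult_distrib of_real_mult of_real_power times_divide_eq_right times_divide_eq_left mult_ac)
  have t_sums: "(\<lambda>k. t k v) sums (\<rho> * of_real (ai_dens 0 v) * exp (- of_real x * \<rho> * of_real (a v)))" for v
    unfolding t_eq using exp_converges[of "- of_real x * \<rho> * of_real (a v)"]
    by (intro sums_mult) (simp add: scaleR_conv_of_real divide_inverse mult.commute)
  have "(\<lambda>k. integral\<^sup>L lborel (t k)) sums (LINT v|lborel. (\<Sum>k. t k v))"
  proof (rule sums_integral)
    show "integrable lborel (t k)" for k using t_int[of k] by (rule integrable.intros)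
    have "summable (\<lambda>k. norm (t k v))" for v
    proof -
      have "norm (t k v) = ai_dens 0 v * ((x * a v) ^ k /\<^sub>R fact k)" for k
        unfolding t_norm by (subst ai_dens_power) (simp add: a_def power_mult_distrib field_simps)
      thus ?thesis using exp_converges[of "x * a v"]
        by (auto intro!: summable_mult sums_summable)
    qed
    thus "AE v in lborel. summable (\<lambda>k. norm (t k v))" by simp
    have "(LINT v|lborel. norm (t k v)) = x ^ k / fact k * ai_mass k" for k
      unfolding t_norm using has_bochner_integral_mult_right[OF ai_dens_integral[of k], of "x ^ k / fact k"]
      by (intro has_bochner_integral_integral_eq) auto
    thus "summable (\<lambda>k. LINT v|lborel. norm (t k v))" using summable_ai_mass[OF x] by simp
  qed
  also have "(\<lambda>k. integral\<^sup>L lborel (t k)) = (\<lambda>k. \<rho> * (- of_real x * \<rho>) ^ k / fact k * of_real (ai_mass k))"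
    using has_bochner_integral_integral_eq[OF t_int] by (rule ext)
  finally have sums: "(\<lambda>k. Im (\<rho> * (- of_real x * \<rho>) ^ k / fact k * of_real (ai_mass k))) sums
      Im (LINT v|lborel. (\<Sum>k. t k v))"
    by (rule sums_Im)
  \<comment> \<open>The integral along the ray solves the Airy equation only up to a real boundary
    term at 0. Imaginary parts remove it: the coefficient at n = 2 is a multiple of
    \<open>Im (\<rho> ^ 3)\<close>, which is 0.\<close>
  have "airy_coeff p q n = Im (\<rho> ^ (n + 1)) * (- 1) ^ n * ai_mass n / fact n" if "p = r0" "q = r1" for p q n
    using that
  proof (induction p q n rule: airy_coeff.induct)
    case 1
    thus ?case by (simp add: r0_def \<rho>_def)
  next
    case 2
    have "Im (\<rho> ^ 2) = sin (pi / 3)"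
      unfolding \<rho>_def Complex.DeMoivre using sin_pi_minus[of "pi / 3"] by (simp add: field_simps)
    with 2 show ?case by (simp add: r1_def power2_eq_square)
  next
    case 3
    thus ?case using rho3 by (simp add: numeral_3_eq_3 mult.assoc)
  next
    case (4 p q n)
    have "\<rho> ^ (n + 3 + 1) = \<rho> ^ 3 * \<rho> ^ (n + 1)" by (simp only: flip: power_add) simp
    hence "\<rho> ^ (n + 3 + 1) = - (\<rho> ^ (n + 1))" by (simp add: rho3)
    moreover have "fact (n + 3) = (real n + 3) * ((real n + 2) * ((real n + 1) * fact n))"
      by (simp add: numeral_3_eq_3 algebra_simps)
    moreover have "Suc (Suc (Suc n)) = n + 3" by simp
    moreover have "- X * (- 1) ^ (n + 3) * ((real n + 1) * m) / ((real n + 3) * ((real n + 2) * ((real n + 1) * F)))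
        = X * (- 1) ^ n * m / F / ((real n + 2) * (real n + 3))" if "F \<noteq> 0" for X m F :: real
      using that by (simp add: divide_simps power_add)
    ultimately have "Im (\<rho> ^ (Suc (Suc (Suc n)) + 1)) * (- 1) ^ Suc (Suc (Suc n)) * ai_mass (Suc (Suc (Suc n))) / fact (Suc (Suc (Suc n)))
        = Im (\<rho> ^ (n + 1)) * (- 1) ^ n * ai_mass n / fact n / ((real n + 2) * (real n + 3))"
      by (simp only: ai_mass_step uminus_complex.sel fact_nonzero not_False_eq_True)
    with 4 show ?case by simp
  qed
  hence r: "airy_coeff r0 r1 n = Im (\<rho> ^ (n + 1)) * (- 1) ^ n * ai_mass n / fact n" for n by blast
  have "Im (\<rho> * (- of_real x * \<rho>) ^ k / fact k * of_real (ai_mass k)) = airy_coeff r0 r1 k * x ^ k" for k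
  proof -
    have "\<rho> * (- of_real x * \<rho>) ^ k / fact k * of_real (ai_mass k) = of_real ((- 1) ^ k * x ^ k / fact k * ai_mass k) * \<rho> ^ (k + 1)"
    proof -
      have "(- of_real x * \<rho>) ^ k = ((- 1) * of_real x * \<rho>) ^ k" by simp
      also have "\<dots> = (- 1) ^ k * of_real x ^ k * \<rho> ^ k" by (simp only: power_mult_distrib)
      finally have *: "(- of_real x * \<rho>) ^ k = (- 1) ^ k * of_real x ^ k * \<rho> ^ k" .
      show ?thesis unfolding * by simp
    qed
    hence "Im (\<rho> * (- of_real x * \<rho>) ^ k / fact k * of_real (ai_mass k)) =
        Im (of_real ((- 1) ^ k * x ^ k / fact k * ai_mass k) * \<rho> ^ (k + 1))"
      by (rule arg_cong)
    also have "\<dots> = (- 1) ^ k * x ^ k / fact k * ai_mass k * Im (\<rho> ^ (k + 1))"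
      by (simp only: times_complex.sel Re_complex_of_real Im_complex_of_real)
    finally show ?thesis unfolding r by (simp only: mult_ac times_divide_eq_right times_divide_eq_left)
  qed
  with sums have "(\<lambda>k. airy_coeff r0 r1 k * x ^ k) sums Im (LINT v|lborel. (\<Sum>k. t k v))" by simp
  hence "(\<lambda>k. of_real (airy_coeff r0 r1 k * x ^ k) :: complex) sums of_real (Im (LINT v|lborel. (\<Sum>k. t k v)))"
    by (rule sums_of_real)
  hence "airy_series (of_real r0) (of_real r1) (of_real x) = of_real (Im (LINT v|lborel. (\<Sum>k. t k v)))"
    unfolding airy_series_def airy_coeff_of_real by (simp add: sums_iff)
  hence "norm (airy_series (of_real r0) (of_real r1) (of_real x)) \<le> norm (LINT v|lborel. (\<Sum>k. t k v))"
    by (simp add: abs_Im_le_cmod)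
  also have "(\<lambda>v. \<Sum>k. t k v) = (\<lambda>v. \<rho> * of_real (ai_dens 0 v) * exp (- of_real x * \<rho> * of_real (a v)))"
    using t_sums by (simp add: sums_iff)
  also have "norm (LINT v|lborel. \<rho> * of_real (ai_dens 0 v) * exp (- of_real x * \<rho> * of_real (a v))) \<le> (LINT v|lborel. ai_dens 0 v)"
  proof -
    have 1: "norm (\<rho> * of_real (ai_dens 0 v) * exp (- of_real x * \<rho> * of_real (a v))) \<le> ai_dens 0 v" for v
    proof -
      have "exp (- x * Re \<rho> * a v) \<le> 1"
        using x by (auto simp: \<rho>_def cos_60 a_def)
      thus ?thesis
        using rho ai_dens_nonneg[of 0 v] by (simp add: norm_mult mult_left_le)
    qed
    have "norm (LINT v|lborel. \<rho> * of_real (ai_dens 0 v) * exp (- of_real x * \<rho> * of_real (a v))) \<le>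
        (LINT v|lborel. norm (\<rho> * of_real (ai_dens 0 v) * exp (- of_real x * \<rho> * of_real (a v))))"
      by (rule integral_norm_bound)
    also have "\<dots> \<le> (LINT v|lborel. ai_dens 0 v)"
      by (rule integral_mono_AE'[OF integrable.intros[OF ai_dens_integral]]) (use 1 ai_dens_nonneg in auto)
    finally show ?thesis .
  qed
  also have "\<dots> = ai_mass 0" using ai_dens_integral by (rule has_bochner_integral_integral_eq)
  finally show ?thesis .
qed

text \<open>All coefficients are nonnegative and the linear one is 1. Linear growth is enough to
  tell this solution from bounded ones.\<close>

lemma airy_series_01_ge:
  assumes "x \<ge> 0"
  shows "norm (airy_series 0 1 (of_real x)) \<ge> x"
proof -
  have nn: "airy_coeff 0 1 n \<ge> (0::real)" for n
    by (induction "0::real" "1::real" n rule: airy_coeff.induct) auto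
  have s: "summable (\<lambda>n. airy_coeff 0 1 n * x ^ n)" by (rule summable_airy_coeff)
  have "x = (\<Sum>n\<in>{1}. airy_coeff 0 1 n * x ^ n)" by simp
  also have "\<dots> \<le> (\<Sum>n. airy_coeff 0 1 n * x ^ n)"
    using s nn assms by (intro sum_le_suminf) auto
  finally have "x \<le> (\<Sum>n. airy_coeff 0 1 n * x ^ n)" .
  moreover have "(\<lambda>n. complex_of_real (airy_coeff 0 1 n * x ^ n)) sums of_real (\<Sum>n. airy_coeff 0 1 n * x ^ n)"
    by (intro sums_of_real summable_sums s)
  hence "airy_series 0 1 (of_real x) = of_real (\<Sum>n. airy_coeff 0 1 n * x ^ n)"
    unfolding airy_series_def using airy_coeff_of_real[of 0 1, where 'a = complex] by (simp add: sums_iff)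
  ultimately show ?thesis using assms by simp
qed

text \<open>\<open>airy_V\<close> for x \<ge> 1 and the solution of
  \<open>airy_series_bounded\<close> are bounded. Were their coefficient vectors independent,
  eliminating the first series would bound a nonzero multiple of the second. So they are
  proportional, and the bounded series is itself a multiple of \<open>Ai\<close>.\<close>

lemma airy_V_eq_Ai:
  obtains K where "K \<noteq> 0" "\<And>z. z \<notin> \<real>\<^sub>\<le>\<^sub>0 \<Longrightarrow> airy_V z = K * Ai z"
proof -
  obtain V' where V': "\<And>z. z \<notin> \<real>\<^sub>\<le>\<^sub>0 \<Longrightarrow> (airy_V has_field_derivative V' z) (at z)"
    "\<And>z. z \<notin> \<real>\<^sub>\<le>\<^sub>0 \<Longrightarrow> (V' has_field_derivative z * airy_V z) (at z)"
    using airy_V_solution by blast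
  obtain a b where ab: "\<And>z. z \<notin> \<real>\<^sub>\<le>\<^sub>0 \<Longrightarrow> airy_V z = a * airy_series 1 0 z + b * airy_series 0 1 z"
  proof (rule airy_solution_eq[of "- \<real>\<^sub>\<le>\<^sub>0" airy_V V'])
    show "connected (- \<real>\<^sub>\<le>\<^sub>0 :: complex set)"
    proof (rule starlike_imp_connected)
      have "(\<real>\<^sub>\<le>\<^sub>0 :: complex set) = complex_of_real ` {..0}"
        by (auto simp: complex_nonpos_Reals_iff complex_eq_iff image_iff)
      thus "starlike (- \<real>\<^sub>\<le>\<^sub>0 :: complex set)"
        using starlike_slotted_complex_plane_left[of 0] by simp
    qed
  qed (use V' in auto)
  define r0 r1 where "r0 = sin (pi / 3) * ai_mass 0" and "r1 = - sin (pi / 3) * ai_mass 1"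
  define S where "S = airy_series (of_real r0) (of_real r1)"
  have S: "S z = of_real r0 * airy_series 1 0 z + of_real r1 * airy_series 0 1 z" for z
    unfolding S_def by (rule airy_series_linear)
  have Sb: "norm (S (of_real x)) \<le> ai_mass 0" if "x \<ge> 0" for x
    unfolding S_def r0_def r1_def using airy_series_bounded[OF that] .
  have Vx: "norm (airy_V (of_real x)) \<le> norm (airy_U (of_real (sqrt x)))"
    "norm (airy_U (of_real (sqrt x)) - of_real (sqrt pi / sqrt (sqrt x))) \<le> 15 * sqrt pi / 72 * sqrt x powr (- 7 / 2)"
    "airy_V (of_real x) = exp (- 2 / 3 * of_real (sqrt x) ^ 3) * airy_U (of_real (sqrt x))" if "x > 0" for x
  proof -
    show 1: "airy_V (of_real x) = exp (- 2 / 3 * of_real (sqrt x) ^ 3) * airy_U (of_real (sqrt x))"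
      using that by (simp add: airy_V_def csqrt_of_real_nonneg)
    have "norm (exp (- 2 / 3 * complex_of_real (sqrt x) ^ 3)) \<le> 1"
      using that by (simp flip: of_real_power)
    thus "norm (airy_V (of_real x)) \<le> norm (airy_U (of_real (sqrt x)))"
      unfolding 1 norm_mult by (rule mult_left_le_one_le[rotated 2]) auto
    show "norm (airy_U (of_real (sqrt x)) - of_real (sqrt pi / sqrt (sqrt x))) \<le> 15 * sqrt pi / 72 * sqrt x powr (- 7 / 2)"
      using airy_U_asymp[of "of_real (sqrt x)"] that by (simp add: csqrt_of_real_nonneg)
  qed
  have Vb: "norm (airy_V (of_real x)) \<le> 2 * sqrt pi" if "x \<ge> 1" for x
  proof -
    have "sqrt x powr (- 7 / 2) \<le> 1" using that powr_mono2'[of "- 7 / 2" 1 "sqrt x"] by simp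
    hence "15 * sqrt pi / 72 * sqrt x powr (- 7 / 2) \<le> sqrt pi * 1"
      by (intro mult_mono) auto
    moreover have "norm (complex_of_real (sqrt pi / sqrt (sqrt x))) \<le> sqrt pi"
      using that by (simp add: norm_divide divide_le_eq)
    moreover note norm_triangle_sub[of "airy_U (of_real (sqrt x))" "complex_of_real (sqrt pi / sqrt (sqrt x))"]
    ultimately show ?thesis using Vx(1,2)[of x] that by linarith
  qed
  \<comment> \<open>This excludes K = 0: at 1 the error is at most 15/72 of the leading term
    \<open>sqrt pi\<close>.\<close>
  have V1: "airy_V 1 \<noteq> 0"
  proof
    assume "airy_V 1 = 0"
    hence "airy_U 1 = 0" using Vx(3)[of 1] by simp
    with Vx(2)[of 1] have "sqrt pi \<le> 15 * sqrt pi / 72" by simp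
    thus False by simp
  qed
  have eq: "of_real r0 * b = a * of_real r1"
  proof (rule ccontr)
    assume *: "of_real r0 * b \<noteq> a * of_real r1"
    define d where "d = of_real r0 * b - a * of_real r1"
    have d: "norm d > 0" using * by (simp add: d_def)
    define B where "B = norm r0 * (2 * sqrt pi) + norm a * ai_mass 0"
    have "norm d * x \<le> B" if "x \<ge> 1" for x :: real
    proof -
      have nr: "complex_of_real x \<notin> \<real>\<^sub>\<le>\<^sub>0" using that by (simp add: complex_nonpos_Reals_iff)
      have "d * airy_series 0 1 (of_real x) = of_real r0 * airy_V (of_real x) - a * S (of_real x)"
        unfolding ab[OF nr] S d_def by (simp add: algebra_simps)
      hence "norm (d * airy_series 0 1 (of_real x)) \<le> norm (of_real r0 * airy_V (of_real x)) + norm (a * S (of_real x))"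
        by (simp add: norm_triangle_ineq4)
      also have "\<dots> \<le> B"
        unfolding B_def norm_mult using Vb[OF that] Sb[of x] that by (intro add_mono mult_mono) auto
      finally have "norm d * norm (airy_series 0 1 (of_real x)) \<le> B" by (simp add: norm_mult)
      moreover have "norm d * x \<le> norm d * norm (airy_series 0 1 (of_real x))"
        using airy_series_01_ge[of x] that by (intro mult_left_mono) auto
      ultimately show ?thesis by linarith
    qed
    from this[of "max 1 ((\<bar>B\<bar> + 1) / norm d)"] have "norm d * ((\<bar>B\<bar> + 1) / norm d) \<le> B"
      using d by (smt (verit) mult_left_mono norm_ge_zero)
    thus False using d by simp
  qed
  \<comment> \<open>Multiplying \<open>airy_c1\<close> and \<open>airy_c2\<close> by this common
    product of Gamma values turns them into \<open>ai_mass 0\<close> and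
    \<open>ai_mass 1\<close>.\<close>
  define G where "G = Gamma (1 / 3) * Gamma (2 / 3 :: real)"
  have G: "G > 0" by (simp add: G_def Gamma_real_pos)
  have sp: "sin (pi / 3) > (0::real)" by (simp add: sin_60)
  have "Gamma (1 / 3 :: real) > 0" "Gamma (2 / 3 :: real) > 0"
    by (rule Gamma_real_pos, simp)+
  hence g3: "Gamma (1 / 3 :: real) \<noteq> 0" "Gamma (2 / 3 :: real) \<noteq> 0"
    by linarith+
  have r: "r0 = sin (pi / 3) * G * airy_c1" "r1 = - (sin (pi / 3) * G * airy_c2)"
    using g3 by (auto simp: r0_def r1_def ai_mass_def G_def airy_c1_def airy_c2_def)
  have r0: "r0 \<noteq> 0" using sp G g3 by (auto simp: r(1) airy_c1_def)
  define K where "K = a / of_real r0 * of_real (sin (pi / 3) * G)"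
  have K: "airy_V z = K * Ai z" if "z \<notin> \<real>\<^sub>\<le>\<^sub>0" for z
  proof -
    have "b = a / of_real r0 * of_real r1" using eq r0 by (simp add: field_simps)
    hence "airy_V z = a / of_real r0 * (of_real r0 * airy_series 1 0 z + of_real r1 * airy_series 0 1 z)"
      using ab[OF that] r0 by (simp add: algebra_simps)
    also have "of_real r0 * airy_series 1 0 z + of_real r1 * airy_series 0 1 z = of_real (sin (pi / 3) * G) * Ai z"
      by (simp add: r Ai_def airy_f_eq airy_g_eq algebra_simps)
    finally show ?thesis by (simp add: K_def)
  qed
  moreover have "K \<noteq> 0" using V1 K[of 1] by auto
  ultimately show ?thesis using that by blast
qed

section \<open>Amplitudes of the two exponential waves\<close>

definition airy_chi :: "complex \<Rightarrow> complex" where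
  "airy_chi z = of_real (sqrt 2 / 3) * csqrt z ^ 3 + of_real (pi / 4)"

text \<open>Here \<open>\<sigma>\<close> is the sign \<open>1\<close> or \<open>-1\<close>.\<close>

definition airy_amp_arg :: "real \<Rightarrow> complex \<Rightarrow> complex" where
  "airy_amp_arg \<sigma> z = cis (- \<sigma> * pi / 6) * of_real (2 powr (- 1 / 6)) * csqrt z"

text \<open>Up to an exponential and a constant this is Ai at \<open>- 2 powr (- 1 / 3) * z\<close>
  rotated by \<sigma> 2 pi/3; \<open>airy_amp_arg \<sigma> z\<close> is the square root of that
  argument. The prefactors normalise the leading term to z^(-1/4).\<close>

definition airy_amp :: "real \<Rightarrow> complex \<Rightarrow> complex" where
  "airy_amp \<sigma> z = cis (- \<sigma> * pi / 12) * airy_U (airy_amp_arg \<sigma> z) / of_real (sqrt pi * 2 powr (1 / 12))"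

lemma Re_csqrt_ge:
  assumes "Re z > 0"
  shows "\<bar>Im (csqrt z)\<bar> \<le> Re (csqrt z)" "Re (csqrt z) > 0" "norm (csqrt z) \<le> 2 * Re (csqrt z)"
proof -
  have "Re (csqrt z ^ 2) > 0" using assms by simp
  hence "Im (csqrt z) ^ 2 < Re (csqrt z) ^ 2" by (simp only: Re_power2)
  hence "\<bar>Im (csqrt z)\<bar> < \<bar>Re (csqrt z)\<bar>" using abs_le_square_iff not_le by metis
  thus *: "\<bar>Im (csqrt z)\<bar> \<le> Re (csqrt z)" "Re (csqrt z) > 0"
    using csqrt_principal[of z] by (auto simp del: csqrt.simps)
  show "norm (csqrt z) \<le> 2 * Re (csqrt z)" using cmod_le[of "csqrt z"] * by linarith
qed

text \<open>\<open>csqrt z\<close> has argument at most pi/4 in modulus, and a rotation by pi/6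
  keeps it in a sector strictly inside the right half-plane, where real part and modulus are
  comparable. The constant 1/16 is not sharp.\<close>

lemma Re_airy_amp_arg:
  assumes "Re z > 0" "\<sigma> \<in> {1, -1}"
  shows "Re (airy_amp_arg \<sigma> z) \<ge> 1 / 16 * sqrt (norm z)" "Re (airy_amp_arg \<sigma> z) > 0"
proof -
  have n: "norm (csqrt z) = sqrt (norm z)"
    by (metis norm_power norm_ge_zero power2_csqrt real_sqrt_unique)
  have "Re (airy_amp_arg \<sigma> z) = 2 powr (- 1 / 6) * (sqrt 3 / 2 * Re (csqrt z) + \<sigma> * Im (csqrt z) / 2)"
    using assms(2) by (auto simp: airy_amp_arg_def cos_30 sin_30 algebra_simps)
  moreover have "\<sigma> * Im (csqrt z) \<ge> - Re (csqrt z)"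
    using Re_csqrt_ge(1)[OF assms(1)] assms(2) by (auto simp del: csqrt.simps)
  moreover have "sqrt 3 \<ge> (3 / 2 :: real)" by (rule real_le_rsqrt) (simp add: power2_eq_square)
  hence "sqrt 3 / 2 * Re (csqrt z) \<ge> 3 / 4 * Re (csqrt z)"
    using Re_csqrt_ge(2)[OF assms(1)] by (intro mult_right_mono) auto
  ultimately have "Re (airy_amp_arg \<sigma> z) \<ge> 2 powr (- 1 / 6) * (1 / 4 * Re (csqrt z))"
    by (auto intro!: mult_left_mono)
  moreover have "(2::real) powr (- 1 / 6) \<ge> 2 powr (- 1)" by (intro powr_mono) auto
  hence "2 powr (- 1 / 6) * (1 / 4 * Re (csqrt z)) \<ge> 1 / 2 * (1 / 4 * Re (csqrt z))"
    using Re_csqrt_ge(2)[OF assms(1)] by (intro mult_right_mono) (auto simp: powr_minus)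
  ultimately show *: "Re (airy_amp_arg \<sigma> z) \<ge> 1 / 16 * sqrt (norm z)"
    using Re_csqrt_ge(3)[OF assms(1)] n by linarith
  have "z \<noteq> 0" using assms(1) by auto
  hence "1 / 16 * sqrt (norm z) > 0" by simp
  with * show "Re (airy_amp_arg \<sigma> z) > 0" by linarith
qed

lemma airy_amp_holomorphic:
  assumes "\<sigma> \<in> {1, -1}"
  shows "airy_amp \<sigma> holomorphic_on {z. Re z > 0}"
proof -
  have *: "airy_U holomorphic_on {y. Re y > 0}"
  proof (rule holomorphic_onI)
    fix x assume "x \<in> {y. Re y > 0}"
    thus "airy_U field_differentiable at x within {y. Re y > 0}"
      using airy_mom_deriv[of x 1 0] unfolding airy_U_def field_differentiable_def
      by (blast intro: has_field_derivative_at_within)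
  qed
  have **: "airy_amp_arg \<sigma> holomorphic_on {z. Re z > 0}"
    unfolding airy_amp_arg_def by (intro holomorphic_intros) (auto simp: complex_nonpos_Reals_iff)
  have pos: "Re (airy_amp_arg \<sigma> z) > 0" if "Re z > 0" for z
    using Re_airy_amp_arg(2)[OF that assms] .
  have "(\<lambda>z. airy_U (airy_amp_arg \<sigma> z)) holomorphic_on {z. Re z > 0}"
    using holomorphic_on_compose_gen[OF ** *] pos by (auto simp: o_def)
  thus ?thesis unfolding airy_amp_def by (intro holomorphic_intros) auto
qed

lemma airy_amp_asymp:
  assumes z: "Re z > 0" and s: "\<sigma> \<in> {1, -1}"
  shows "norm (airy_amp \<sigma> z - 1 / csqrt (csqrt z)) \<le> 2 ^ 15 * norm z powr (- 7 / 4)"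
proof -
  define y where "y = airy_amp_arg \<sigma> z"
  have nz: "norm z > 0" using z by auto
  have ya: "Re y \<ge> 1 / 16 * sqrt (norm z)" unfolding y_def by (rule Re_airy_amp_arg(1)[OF z s])
  have ypos: "Re y > 0" unfolding y_def by (rule Re_airy_amp_arg(2)[OF z s])
  define p where "p = csqrt (csqrt z)"
  have p2: "p ^ 2 = csqrt z" by (simp add: p_def)
  have p: "\<bar>Im p\<bar> \<le> Re p" "Re p > 0" unfolding p_def
    using Re_csqrt_ge(2)[OF z] Re_csqrt_ge(1,2)[of "csqrt z"] by auto
  \<comment> \<open>Only the branch has to be checked: \<open>p\<close> lies in the sector of
    half-angle pi/4, and rotation by pi/12 leaves its real part positive because cos(pi/12) >
    sin(pi/12).\<close>
  have cy: "csqrt y = cis (- \<sigma> * pi / 12) * of_real (2 powr (- 1 / 12)) * p"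
  proof (rule csqrt_unique)
    have "cis (- \<sigma> * pi / 12) ^ 2 = cis (- \<sigma> * pi / 6)" by (simp add: Complex.DeMoivre mult.commute)
    moreover have "complex_of_real (2 powr (- 1 / 12)) ^ 2 = of_real (2 powr (- 1 / 6))"
      by (simp flip: of_real_power powr_realpow' add: powr_powr)
    ultimately show "(cis (- \<sigma> * pi / 12) * of_real (2 powr (- 1 / 12)) * p)\<^sup>2 = y"
      unfolding y_def airy_amp_arg_def power_mult_distrib p2 by simp
    have c: "cos (\<sigma> * pi / 12) > sin (pi / 12)" "\<bar>sin (\<sigma> * pi / 12)\<bar> \<le> sin (pi / 12)"
    proof -
      have "cos (\<sigma> * pi / 12) = cos (pi / 12)" using s by auto
      also have "cos (pi / 12) = sin (pi / 2 - pi / 12)" by (simp add: sin_cos_eq)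
      also have "\<dots> > sin (pi / 12)" by (rule sin_monotone_2pi) auto
      finally show "cos (\<sigma> * pi / 12) > sin (pi / 12)" .
      have "sin (pi / 12) \<ge> 0" by (rule sin_ge_zero) auto
      thus "\<bar>sin (\<sigma> * pi / 12)\<bar> \<le> sin (pi / 12)" using s by auto
    qed
    have "\<bar>sin (\<sigma> * pi / 12) * Im p\<bar> \<le> sin (pi / 12) * Re p"
      unfolding abs_mult using c(2) p by (intro mult_mono) auto
    also have "\<dots> < cos (\<sigma> * pi / 12) * Re p" using c(1) p by (intro mult_strict_right_mono)
    finally have "cos (\<sigma> * pi / 12) * Re p + sin (\<sigma> * pi / 12) * Im p > 0" by linarith
    hence "2 powr (- 1 / 12) * (cos (\<sigma> * pi / 12) * Re p + sin (\<sigma> * pi / 12) * Im p) > 0"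
      by (intro mult_pos_pos) auto
    thus "0 < Re (cis (- \<sigma> * pi / 12) * of_real (2 powr (- 1 / 12)) * p) \<or>
      Re (cis (- \<sigma> * pi / 12) * of_real (2 powr (- 1 / 12)) * p) = 0 \<and>
      0 \<le> Im (cis (- \<sigma> * pi / 12) * of_real (2 powr (- 1 / 12)) * p)"
      by (simp add: algebra_simps)
  qed
  define c where "c = cis (- \<sigma> * pi / 12) / of_real (sqrt pi * 2 powr (1 / 12))"
  have "c * (of_real (sqrt pi) / csqrt y) = 1 / p"
    unfolding cy c_def by (simp add: powr_minus field_simps)
  hence "airy_amp \<sigma> z - 1 / p = c * (airy_U y - of_real (sqrt pi) / csqrt y)"
    unfolding airy_amp_def y_def[symmetric] by (simp add: right_diff_distrib c_def)
  also have "norm \<dots> \<le> 1 * (15 * sqrt pi / 72 * (Re y) powr (- 7 / 2))"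
    unfolding norm_mult
  proof (intro mult_mono airy_U_asymp ypos)
    have "1 * 1 \<le> sqrt pi * 2 powr (1 / 12)"
      using pi_ge_two by (intro mult_mono ge_one_powr_ge_zero) auto
    thus "norm c \<le> 1" by (simp add: c_def norm_divide norm_mult)
  qed auto
  also have "\<dots> \<le> 2 * (Re y) powr (- 7 / 2)"
  proof -
    have "sqrt pi \<le> 2" using pi_less_4 by (intro real_le_lsqrt) auto
    thus ?thesis by (auto intro!: mult_right_mono)
  qed
  also have "\<dots> \<le> 2 * (1 / 16 * sqrt (norm z)) powr (- 7 / 2)"
    using ya nz by (intro mult_left_mono powr_mono2') auto
  also have "(1 / 16 * sqrt (norm z)) powr (- 7 / 2) = (1 / 16) powr (- 7 / 2) * sqrt (norm z) powr (- 7 / 2)"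
    by (rule powr_mult)
  also have "(1 / 16 :: real) powr (- 7 / 2) = 2 ^ 14"
  proof -
    have *: "(1 / 16 :: real) = 2 powr (- 4)" by (simp add: powr_minus)
    show ?thesis unfolding * powr_powr by simp
  qed
  also have "sqrt (norm z) powr (- 7 / 2) = norm z powr (- 7 / 4)"
    using nz by (simp add: powr_powr flip: powr_half_sqrt)
  finally show ?thesis by (simp add: p_def)
qed

text \<open>On the oscillatory side Ai and Bi are combinations of Ai at the arguments rotated by the
  two nontrivial cube roots of unity, where the integral representation applies. One constant
  \<open>k\<close> serves for all \<open>C1\<close>, \<open>C2\<close>.\<close>

lemma airy_phi_decomposition:
  obtains k where "k \<noteq> 0" "\<And>C1 C2 z. Re z > 0 \<Longrightarrow> airy_phi C1 C2 z =
    k * ((C2 - \<i> * C1) * exp (\<i> * airy_chi z) * airy_amp 1 z + (C2 + \<i> * C1) * exp (- \<i> * airy_chi z) * airy_amp (-1) z)"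
proof -
  obtain K where K: "K \<noteq> 0" "\<And>z. z \<notin> \<real>\<^sub>\<le>\<^sub>0 \<Longrightarrow> airy_V z = K * Ai z" by (rule airy_V_eq_Ai) blast
  define k where "k = of_real (sqrt pi * 2 powr (1 / 12)) / K"
  have "airy_phi C1 C2 z =
    k * ((C2 - \<i> * C1) * exp (\<i> * airy_chi z) * airy_amp 1 z + (C2 + \<i> * C1) * exp (- \<i> * airy_chi z) * airy_amp (-1) z)"
    if z: "Re z > 0" for C1 C2 z
  proof -
    define w where "w = - of_real (2 powr (- 1 / 3)) * z"
    define j where "j = (\<lambda>\<sigma>. cis (\<sigma> * (2 * pi / 3)))"
    have jj: "j \<sigma> ^ 3 = 1" if "\<sigma> \<in> {1, -1}" for \<sigma>
      using that by (auto simp: j_def Complex.DeMoivre complex_eq_iff)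
    have Aij: "Ai (j \<sigma> * w) = of_real airy_c1 * airy_f w - of_real airy_c2 * (j \<sigma> * airy_g w)" if "\<sigma> \<in> {1, -1}" for \<sigma>
      unfolding Ai_def airy_f_eq airy_g_eq using airy_series_rotate[OF jj[OF that]] by simp
    have A: "Ai (j \<sigma> * w) = k * exp (\<sigma> * \<i> * airy_chi z) * airy_amp \<sigma> z * cis (- \<sigma> * pi / 6)" if s: "\<sigma> \<in> {1, -1}" for \<sigma>
    proof -
      have arg: "csqrt (j \<sigma> * w) = airy_amp_arg \<sigma> z"
      proof (rule csqrt_unique)
        have "cis (- \<sigma> * pi / 6) ^ 2 = cis (- \<sigma> * pi / 3)" by (simp add: Complex.DeMoivre mult.commute)
        also have "\<dots> = - j \<sigma>"
          using s by (auto simp: j_def complex_eq_iff cos_60 sin_60 cos_120 sin_120)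
        finally have "cis (- \<sigma> * pi / 6) ^ 2 = - j \<sigma>" .
        moreover have "complex_of_real (2 powr (- 1 / 6)) ^ 2 = of_real (2 powr (- 1 / 3))"
          by (simp flip: of_real_power powr_realpow' add: powr_powr)
        ultimately show "(airy_amp_arg \<sigma> z)\<^sup>2 = j \<sigma> * w"
          unfolding airy_amp_arg_def power_mult_distrib w_def by simp
        show "0 < Re (airy_amp_arg \<sigma> z) \<or> Re (airy_amp_arg \<sigma> z) = 0 \<and> 0 \<le> Im (airy_amp_arg \<sigma> z)"
          using Re_airy_amp_arg(2)[OF z s] by blast
      qed
      have "Re (csqrt (j \<sigma> * w)) > 0"
        unfolding arg using Re_airy_amp_arg(2)[OF z s] .
      hence "j \<sigma> * w \<notin> \<real>\<^sub>\<le>\<^sub>0"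
        by (auto elim!: nonpos_Reals_cases simp: csqrt_of_real_nonpos simp del: csqrt.simps)
      hence "Ai (j \<sigma> * w) = airy_V (j \<sigma> * w) / K" using K by simp
      also have "airy_V (j \<sigma> * w) = exp (- 2 / 3 * airy_amp_arg \<sigma> z ^ 3) * airy_U (airy_amp_arg \<sigma> z)"
        by (simp add: airy_V_def arg)
      also have "airy_amp_arg \<sigma> z ^ 3 = - \<sigma> * \<i> * of_real (1 / sqrt 2) * csqrt z ^ 3"
      proof -
        have "cis (- \<sigma> * pi / 6) ^ 3 = - \<sigma> * \<i>"
          using s by (auto simp: Complex.DeMoivre complex_eq_iff)
        moreover have "complex_of_real (2 powr (- 1 / 6)) ^ 3 = of_real (1 / sqrt 2)"
        proof -
          have "((2::real) powr (- 1 / 6)) ^ 3 = 2 powr (- (1 / 2))" by (simp add: powr_power)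
          also have "\<dots> = 1 / sqrt 2" by (simp add: powr_minus_divide powr_half_sqrt)
          finally show ?thesis by (simp only: flip: of_real_power)
        qed
        ultimately show ?thesis unfolding airy_amp_arg_def power_mult_distrib by simp
      qed
      also have "- 2 / 3 * (- \<sigma> * \<i> * of_real (1 / sqrt 2) * csqrt z ^ 3) = \<sigma> * \<i> * airy_chi z - \<sigma> * \<i> * of_real (pi / 4)"
      proof -
        have "sqrt 2 / 3 = 2 / 3 * (1 / sqrt 2)" by (simp add: field_simps)
        hence "complex_of_real (sqrt 2 / 3) = of_real (2 / 3 * (1 / sqrt 2))" by (simp only:)
        also have "\<dots> = 2 / 3 * of_real (1 / sqrt 2)" by simp
        finally have "complex_of_real (sqrt 2 / 3) = 2 / 3 * of_real (1 / sqrt 2)" .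
        moreover have "- 2 / 3 * (- \<sigma> * \<i> * q * c) = \<sigma> * \<i> * (s * c + p) - \<sigma> * \<i> * p"
          if "s = 2 / 3 * q" for q s p c :: complex
          unfolding that by (simp add: algebra_simps)
        ultimately show ?thesis unfolding airy_chi_def by blast
      qed
      also have "exp (\<sigma> * \<i> * airy_chi z - \<sigma> * \<i> * of_real (pi / 4)) = exp (\<sigma> * \<i> * airy_chi z) * cis (- \<sigma> * pi / 4)"
      proof -
        have "exp (a - \<sigma> * \<i> * of_real (pi / 4)) = exp a * exp (- (\<sigma> * \<i> * of_real (pi / 4)))" for a
          by (simp only: diff_conv_add_uminus exp_add)
        moreover have "- (\<sigma> * \<i> * of_real (pi / 4)) = \<i> * of_real (- \<sigma> * pi / 4)" by simp
        ultimately show ?thesis by (simp only: cis_conv_exp)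
      qed
      \<comment> \<open>The pi/12 part is built into \<open>airy_amp\<close>; the pi/6 part cancels
        against the connection coefficients below.\<close>
      also have "cis (- \<sigma> * pi / 4) = cis (- \<sigma> * pi / 6) * cis (- \<sigma> * pi / 12)"
        unfolding cis_mult by (rule arg_cong[of _ _ cis]) (simp add: field_simps)
      finally have "Ai (j \<sigma> * w) = exp (\<sigma> * \<i> * airy_chi z) * (cis (- \<sigma> * pi / 6) * cis (- \<sigma> * pi / 12)) *
          airy_U (airy_amp_arg \<sigma> z) / K" .
      moreover have "complex_of_real (sqrt pi * 2 powr (1 / 12)) \<noteq> 0" by simp
      ultimately show ?thesis
        unfolding k_def airy_amp_def by simp
    qed
    have "airy_phi C1 C2 z = (C1 * (- j 1) + C2 * cis (pi / 6)) * Ai (j 1 * w) + (C1 * (- j (-1)) + C2 * cis (- pi / 6)) * Ai (j (-1) * w)"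
    proof -
      have 1: "j 1 + j (-1) = -1" "j 1 ^ 2 + j (-1) ^ 2 = -1"
        by (auto simp: j_def complex_eq_iff cos_120 sin_120 Re_power2 Im_power2 power_divide)
      have 2: "cis (pi / 6) + cis (- pi / 6) = of_real (sqrt 3)"
        by (auto simp: complex_eq_iff cos_30 sin_30)
      have 3: "cis (pi / 6) * j 1 + cis (- pi / 6) * j (-1) = - of_real (sqrt 3)"
        by (auto simp: j_def complex_eq_iff cos_30 sin_30 cos_120 sin_120)
      define F G where "F = of_real airy_c1 * airy_f w" and "G = of_real airy_c2 * airy_g w"
      have "Ai w = F - G" by (simp add: Ai_def F_def G_def)
      moreover have "Bi w = of_real (sqrt 3) * F - (- of_real (sqrt 3)) * G"
        by (simp add: Bi_def F_def G_def algebra_simps)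
      moreover have "Ai (j \<sigma> * w) = F - j \<sigma> * G" if "\<sigma> \<in> {1, -1}" for \<sigma>
        using Aij[OF that] by (simp add: F_def G_def)
      hence "Ai (j 1 * w) = F - j 1 * G" "Ai (j (-1) * w) = F - j (-1) * G" by auto
      moreover have "airy_phi C1 C2 z = C1 * Ai w + C2 * Bi w"
        by (simp add: airy_phi_def w_def)
      moreover have "F - G = - (j 1 + j (-1)) * F + (j 1 ^ 2 + j (-1) ^ 2) * G" unfolding 1 by simp
      ultimately have "airy_phi C1 C2 z = C1 * (- (j 1 + j (-1)) * F + (j 1 ^ 2 + j (-1) ^ 2) * G) +
          C2 * ((cis (pi / 6) + cis (- pi / 6)) * F - (cis (pi / 6) * j 1 + cis (- pi / 6) * j (-1)) * G)"
        unfolding 2 3 by simp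
      thus ?thesis
        unfolding \<open>Ai (j 1 * w) = F - j 1 * G\<close> \<open>Ai (j (-1) * w) = F - j (-1) * G\<close>
        by (simp only:) (simp add: algebra_simps power2_eq_square)
    qed
    also have "C1 * (- j 1) + C2 * cis (pi / 6) = (C2 - \<i> * C1) * cis (pi / 6)"
      by (simp add: algebra_simps) (simp add: j_def complex_eq_iff cos_30 sin_30 cos_120 sin_120)
    also have "C1 * (- j (-1)) + C2 * cis (- pi / 6) = (C2 + \<i> * C1) * cis (- pi / 6)"
      by (simp add: algebra_simps) (simp add: j_def complex_eq_iff cos_30 sin_30 cos_120 sin_120)
    also have "Ai (j 1 * w) = k * exp (\<i> * airy_chi z) * airy_amp 1 z * cis (- pi / 6)"
      using A[of 1] by simp
    also have "Ai (j (-1) * w) = k * exp (- \<i> * airy_chi z) * airy_amp (-1) z * cis (pi / 6)"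
      using A[of "-1"] by simp
    finally have "airy_phi C1 C2 z = (C2 - \<i> * C1) * k * exp (\<i> * airy_chi z) * airy_amp 1 z * (cis (pi / 6) * cis (- pi / 6)) +
       (C2 + \<i> * C1) * k * exp (- \<i> * airy_chi z) * airy_amp (-1) z * (cis (- pi / 6) * cis (pi / 6))"
      by (simp only: mult_ac)
    also have "cis (pi / 6) * cis (- pi / 6) = 1"
      by (simp add: cis_mult)
    also have "cis (- pi / 6) * cis (pi / 6) = 1"
      by (simp add: cis_mult)
    finally show ?thesis by (simp add: algebra_simps)
  qed
  moreover have "k \<noteq> 0" using K(1) by (simp add: k_def)
  ultimately show ?thesis using that by blast
qed

subsection \<open>Symbols\<close>

text \<open>Functions of size \<open>O(x\<^sup>m)\<close> on discs centred at \<open>x\<close> whose radius is proportional to \<open>x\<close>. By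
  Cauchy's inequality, differentiation lowers the exponent by one.\<close>

definition symb :: "real \<Rightarrow> (complex \<Rightarrow> complex) \<Rightarrow> bool" where
  "symb m f \<longleftrightarrow> f holomorphic_on {z. Re z > 0} \<and>
     (\<exists>\<rho> C. 0 < \<rho> \<and> \<rho> < 1 \<and> eventually (\<lambda>x. \<forall>w\<in>ball (of_real x) (\<rho> * x). norm (f w) \<le> C * x powr m) at_top)"

text \<open>Fixing the gap between leading term and error at 3/2, the order of
  1/\<open>airy_chi\<close>, lets leading coefficients be added and multiplied like numbers. The
  value \<open>c = 0\<close> is allowed and records a gain of 3/2.\<close>

definition asy :: "real \<Rightarrow> complex \<Rightarrow> (complex \<Rightarrow> complex) \<Rightarrow> bool" where
  "asy m c f \<longleftrightarrow> symb (m - 3 / 2) (\<lambda>z. f z - c * z powr of_real m)"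

lemma symbI:
  assumes "f holomorphic_on {z. Re z > 0}" "0 < \<rho>" "\<rho> < 1"
    and "eventually (\<lambda>x. \<forall>w\<in>ball (of_real x) (\<rho> * x). norm (f w) \<le> C * x powr m) at_top"
  shows "symb m f"
  using assms unfolding symb_def by blast

lemma Re_ball_pos:
  assumes "w \<in> ball (of_real x) (\<rho> * x)" "\<rho> < 1" "x > 0"
  shows "Re w > 0"
proof -
  have "norm (of_real x - w) < \<rho> * x" using assms by (simp add: dist_norm)
  moreover have "\<bar>x - Re w\<bar> \<le> norm (of_real x - w)" using abs_Re_le_cmod[of "of_real x - w"] by simp
  moreover have "\<rho> * x < 1 * x" using assms by (intro mult_strict_right_mono) auto
  ultimately show ?thesis by linarith
qed

lemma symb_exp_eq: "symb m f \<Longrightarrow> m = m' \<Longrightarrow> symb m' f"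
  by simp

lemma asy_exp_eq: "asy m c f \<Longrightarrow> m = m' \<Longrightarrow> c = c' \<Longrightarrow> asy m' c' f"
  by simp

lemma symb_holomorphic: "symb m f \<Longrightarrow> f holomorphic_on {z. Re z > 0}"
  by (simp add: symb_def)

lemma symb_bigo:
  assumes "symb m f"
  shows "(\<lambda>x. f (of_real x)) \<in> O[at_top](\<lambda>x. complex_of_real (x powr m))"
proof -
  obtain \<rho> C where *: "0 < \<rho>" "eventually (\<lambda>x. \<forall>w\<in>ball (of_real x) (\<rho> * x). norm (f w) \<le> C * x powr m) at_top"
    using assms unfolding symb_def by blast
  show ?thesis
  proof (rule bigoI[of _ C])
    show "eventually (\<lambda>x. norm (f (of_real x)) \<le> C * norm (complex_of_real (x powr m))) at_top"
      using *(2) eventually_gt_at_top[of 0]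
    proof eventually_elim
      case (elim x)
      thus ?case using *(1) by auto
    qed
  qed
qed

lemma symb_cong:
  assumes "symb m f" "\<And>z. Re z > 0 \<Longrightarrow> f z = g z"
  shows "symb m g"
proof -
  obtain \<rho> C where *: "0 < \<rho>" "\<rho> < 1" "eventually (\<lambda>x. \<forall>w\<in>ball (of_real x) (\<rho> * x). norm (f w) \<le> C * x powr m) at_top"
    using assms unfolding symb_def by blast
  have pos: "Re w > 0" if "w \<in> ball (of_real x) (\<rho> * x)" "x > 0" for x w
    by (rule Re_ball_pos[OF that(1) *(2) that(2)])
  show ?thesis
  proof (rule symbI[of _ \<rho> C])
    show "g holomorphic_on {z. Re z > 0}"
      by (rule holomorphic_transform[OF symb_holomorphic[OF assms(1)]]) (use assms(2) in auto)
    show "eventually (\<lambda>x. \<forall>w\<in>ball (of_real x) (\<rho> * x). norm (g w) \<le> C * x powr m) at_top"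
      using *(3) eventually_gt_at_top[of 0] by eventually_elim (use pos assms(2) in force)
  qed (use * in auto)
qed

lemma symb_le:
  assumes "symb m f" "m \<le> m'"
  shows "symb m' f"
proof -
  obtain \<rho> C where *: "0 < \<rho>" "\<rho> < 1" "eventually (\<lambda>x. \<forall>w\<in>ball (of_real x) (\<rho> * x). norm (f w) \<le> C * x powr m) at_top"
    using assms unfolding symb_def by blast
  show ?thesis
  proof (rule symbI[of _ \<rho> "\<bar>C\<bar>"])
    show "eventually (\<lambda>x. \<forall>w\<in>ball (of_real x) (\<rho> * x). norm (f w) \<le> \<bar>C\<bar> * x powr m') at_top"
      using *(3) eventually_ge_at_top[of 1]
    proof eventually_elim
      case (elim x)
      have "C * x powr m \<le> \<bar>C\<bar> * x powr m'"
        using elim assms(2) by (intro mult_mono powr_mono) auto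
      with elim show ?case by force
    qed
  qed (use * symb_holomorphic[OF assms(1)] in auto)
qed

lemma symb_add:
  assumes "symb m f" "symb m g"
  shows "symb m (\<lambda>z. f z + g z)"
proof -
  obtain \<rho> C where *: "0 < \<rho>" "\<rho> < 1" "eventually (\<lambda>x. \<forall>w\<in>ball (of_real x) (\<rho> * x). norm (f w) \<le> C * x powr m) at_top"
    using assms unfolding symb_def by blast
  obtain \<rho>' C' where **: "0 < \<rho>'" "\<rho>' < 1" "eventually (\<lambda>x. \<forall>w\<in>ball (of_real x) (\<rho>' * x). norm (g w) \<le> C' * x powr m) at_top"
    using assms unfolding symb_def by blast
  show ?thesis
  proof (rule symbI[of _ "min \<rho> \<rho>'" "C + C'"])
    show "eventually (\<lambda>x. \<forall>w\<in>ball (of_real x) (min \<rho> \<rho>' * x). norm (f w + g w) \<le> (C + C') * x powr m) at_top"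
      using *(3) **(3) eventually_gt_at_top[of 0]
    proof eventually_elim
      case (elim x)
      show ?case
      proof
        fix w assume w: "w \<in> ball (complex_of_real x) (min \<rho> \<rho>' * x)"
        have "min \<rho> \<rho>' * x \<le> \<rho> * x" "min \<rho> \<rho>' * x \<le> \<rho>' * x"
          using elim by (auto intro!: mult_right_mono)
        hence "norm (f w) \<le> C * x powr m" "norm (g w) \<le> C' * x powr m" using w elim
          unfolding mem_ball by (meson less_le_trans mem_ball)+
        thus "norm (f w + g w) \<le> (C + C') * x powr m"
          using norm_triangle_ineq[of "f w" "g w"] by (simp add: algebra_simps)
      qed
    qed
  qed (use * ** assms[THEN symb_holomorphic] in \<open>auto intro!: holomorphic_intros\<close>)
qed

lemma symb_mult:
  assumes "symb m f" "symb m' g"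
  shows "symb (m + m') (\<lambda>z. f z * g z)"
proof -
  obtain \<rho> C where *: "0 < \<rho>" "\<rho> < 1" "eventually (\<lambda>x. \<forall>w\<in>ball (of_real x) (\<rho> * x). norm (f w) \<le> C * x powr m) at_top"
    using assms unfolding symb_def by blast
  obtain \<rho>' C' where **: "0 < \<rho>'" "\<rho>' < 1" "eventually (\<lambda>x. \<forall>w\<in>ball (of_real x) (\<rho>' * x). norm (g w) \<le> C' * x powr m') at_top"
    using assms unfolding symb_def by blast
  show ?thesis
  proof (rule symbI[of _ "min \<rho> \<rho>'" "\<bar>C\<bar> * \<bar>C'\<bar>"])
    show "eventually (\<lambda>x. \<forall>w\<in>ball (of_real x) (min \<rho> \<rho>' * x). norm (f w * g w) \<le> (\<bar>C\<bar> * \<bar>C'\<bar>) * x powr (m + m')) at_top"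
      using *(3) **(3) eventually_gt_at_top[of 0]
    proof eventually_elim
      case (elim x)
      show ?case
      proof
        fix w assume w: "w \<in> ball (complex_of_real x) (min \<rho> \<rho>' * x)"
        have "min \<rho> \<rho>' * x \<le> \<rho> * x" "min \<rho> \<rho>' * x \<le> \<rho>' * x"
          using elim by (auto intro!: mult_right_mono)
        hence "norm (f w) \<le> C * x powr m" "norm (g w) \<le> C' * x powr m'" using w elim
          unfolding mem_ball by (meson less_le_trans mem_ball)+
        moreover have "C * x powr m \<le> \<bar>C\<bar> * x powr m" "C' * x powr m' \<le> \<bar>C'\<bar> * x powr m'"
          by (auto intro!: mult_right_mono)
        ultimately have "norm (f w) * norm (g w) \<le> (\<bar>C\<bar> * x powr m) * (\<bar>C'\<bar> * x powr m')"
          by (intro mult_mono) auto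
        thus "norm (f w * g w) \<le> (\<bar>C\<bar> * \<bar>C'\<bar>) * x powr (m + m')"
          by (simp add: norm_mult powr_add mult_ac)
      qed
    qed
  qed (use * ** assms[THEN symb_holomorphic] in \<open>auto intro!: holomorphic_intros\<close>)
qed

lemma symb_powr: "symb a (\<lambda>z. z powr of_real a)"
proof (rule symbI[of _ "1 / 2" "2 powr \<bar>a\<bar>"])
  show "(\<lambda>z. z powr of_real a) holomorphic_on {z. Re z > 0}"
    by (intro holomorphic_intros) (auto simp: complex_nonpos_Reals_iff)
  show "eventually (\<lambda>x. \<forall>w\<in>ball (complex_of_real x) (1 / 2 * x). norm (w powr of_real a) \<le> 2 powr \<bar>a\<bar> * x powr a) at_top"
    using eventually_gt_at_top[of 0]
  proof eventually_elim
    case (elim x)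
    show ?case
    proof
      fix w assume "w \<in> ball (complex_of_real x) (1 / 2 * x)"
      hence w: "norm (of_real x - w) < x / 2" by (simp add: dist_norm)
      have lo: "norm w \<ge> x / 2" and hi: "norm w \<le> 2 * x"
        using norm_triangle_sub[of "of_real x" w] norm_triangle_sub[of w "of_real x"] w elim
        by (auto simp: norm_minus_commute)
      have "norm (w powr of_real a) = norm w powr a"
        using norm_powr_real_powr'[of "of_real a" w] by simp
      also have "\<dots> \<le> 2 powr \<bar>a\<bar> * x powr a"
      proof (cases "a \<ge> 0")
        case True
        have "norm w powr a \<le> (2 * x) powr a" using True hi by (intro powr_mono2) auto
        thus ?thesis using True elim by (simp add: powr_mult)
      next
        case False
        have "norm w powr a \<le> (1 / 2 * x) powr a" using False lo elim by (intro powr_mono2') auto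
        also have "\<dots> = (1 / 2) powr a * x powr a" by (rule powr_mult)
        also have "(1 / 2 :: real) powr a = 2 powr (- a)" by (simp add: powr_minus powr_divide divide_simps)
        finally show ?thesis using False by simp
      qed
      finally show "norm (w powr of_real a) \<le> 2 powr \<bar>a\<bar> * x powr a" .
    qed
  qed
qed auto

lemma symb_const: "symb 0 (\<lambda>z. c)"
  by (rule symbI[of _ "1 / 2" "norm c"]) (auto intro: eventually_mono[OF eventually_gt_at_top[of 0]])

lemma symb_0: "symb m (\<lambda>z. 0)"
  by (rule symbI[of _ "1 / 2" 0]) auto

lemma symb_cmult: "symb m f \<Longrightarrow> symb m (\<lambda>z. c * f z)"
  using symb_mult[OF symb_const[of c], of m f] by simp

lemma symb_sum: "(\<And>i. i \<in> I \<Longrightarrow> symb m (f i)) \<Longrightarrow> symb m (\<lambda>z. \<Sum>i\<in>I. f i z)"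
  by (induction I rule: infinite_finite_induct) (auto intro: symb_0 symb_add)

lemma symb_prod:
  assumes "finite I" "\<And>i. i \<in> I \<Longrightarrow> symb (m i) (f i)"
  shows "symb (\<Sum>i\<in>I. m i) (\<lambda>z. \<Prod>i\<in>I. f i z)"
  using assms by (induction I rule: finite_induct) (auto intro: symb_const[of 1] symb_mult)

lemma symb_powr_mult: "symb m f \<Longrightarrow> symb (a + m) (\<lambda>z. z powr of_real a * f z)"
  by (intro symb_mult symb_powr)

lemma symb_deriv:
  assumes "symb m f"
  shows "symb (m - 1) (deriv f)"
proof -
  obtain \<rho> C where *: "0 < \<rho>" "\<rho> < 1" "eventually (\<lambda>x. \<forall>w\<in>ball (of_real x) (\<rho> * x). norm (f w) \<le> C * x powr m) at_top"
    using assms unfolding symb_def by blast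
  have hol: "f holomorphic_on {z. Re z > 0}" using assms by (rule symb_holomorphic)
  have pos: "Re w > 0" if "w \<in> ball (of_real x) (\<rho> * x)" "x > 0" for x w
    by (rule Re_ball_pos[OF that(1) *(2) that(2)])
  show ?thesis
  proof (rule symbI[of _ "\<rho> / 2" "3 / \<rho> * C"])
    show "deriv f holomorphic_on {z. Re z > 0}"
      using hol by (intro holomorphic_deriv) (auto simp: open_halfspace_Re_gt)
    show "eventually (\<lambda>x. \<forall>w\<in>ball (of_real x) (\<rho> / 2 * x). norm (deriv f w) \<le> 3 / \<rho> * C * x powr (m - 1)) at_top"
      using *(3) eventually_gt_at_top[of 0]
    proof eventually_elim
      case (elim x)
      show ?case
      proof
        fix w assume w: "w \<in> ball (complex_of_real x) (\<rho> / 2 * x)"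
        \<comment> \<open>As 1/2 + 1/3 < 1, a disc of this radius about a point of the smaller ball
          stays in the ball where \<open>f\<close> is bounded.\<close>
        define r where "r = \<rho> * x / 3"
        have r: "r > 0" using elim * by (simp add: r_def)
        have sub: "cball w r \<subseteq> ball (of_real x) (\<rho> * x)"
        proof
          fix v assume "v \<in> cball w r"
          hence "dist (of_real x) v < \<rho> / 2 * x + r"
            using w dist_triangle[of "complex_of_real x" v w] by auto
          also have "\<dots> \<le> \<rho> * x" using elim * by (simp add: r_def)
          finally show "v \<in> ball (of_real x) (\<rho> * x)" by simp
        qed
        have sub2: "cball w r \<subseteq> {z. Re z > 0}" using sub pos elim by blast
        have "norm ((deriv ^^ 1) f w) \<le> fact 1 * (C * x powr m) / r ^ 1"
        proof (rule Cauchy_inequality)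
          show "f holomorphic_on ball w r"
            using sub2 by (intro holomorphic_on_subset[OF hol]) (auto simp: subset_iff)
          show "continuous_on (cball w r) f"
            using sub2 by (intro holomorphic_on_imp_continuous_on holomorphic_on_subset[OF hol])
          show "norm (f v) \<le> C * x powr m" if "norm (w - v) = r" for v
            using elim sub that by (auto simp: dist_norm subset_iff)
        qed (rule r)
        also have "fact 1 * (C * x powr m) / r ^ 1 = 3 / \<rho> * C * x powr (m - 1)"
          using elim * by (simp add: r_def powr_diff)
        finally show "norm (deriv f w) \<le> 3 / \<rho> * C * x powr (m - 1)" by simp
      qed
    qed
  qed (use * in auto)
qed

lemma asy_symb: "asy m c f \<Longrightarrow> symb m f"
proof -
  assume "asy m c f"
  hence "symb m (\<lambda>z. f z - c * z powr of_real m)"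
    unfolding asy_def by (rule symb_le) simp
  from symb_add[OF this symb_cmult[OF symb_powr[of m], of c]] show ?thesis by simp
qed

lemma asy_0: "symb (m - 3 / 2) f \<Longrightarrow> asy m 0 f"
  by (simp add: asy_def)

lemma asy_powr: "asy m 1 (\<lambda>z. z powr of_real m)"
  by (simp add: asy_def symb_0)

lemma asy_const: "asy 0 c (\<lambda>z. c)"
  unfolding asy_def by (rule symb_cong[OF symb_0]) auto

lemma asy_cong:
  assumes "asy m c f" "\<And>z. Re z > 0 \<Longrightarrow> f z = g z"
  shows "asy m c g"
  using assms unfolding asy_def by (auto elim: symb_cong)

lemma asy_add: "asy m c f \<Longrightarrow> asy m d g \<Longrightarrow> asy m (c + d) (\<lambda>z. f z + g z)"
  unfolding asy_def by (drule (1) symb_add) (simp add: algebra_simps)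

lemma asy_mult:
  assumes "asy m c f" "asy m' d g"
  shows "asy (m + m') (c * d) (\<lambda>z. f z * g z)"
proof -
  have "symb (m - 3 / 2 + m') (\<lambda>z. (f z - c * z powr of_real m) * g z)"
    using assms by (intro symb_mult) (auto simp: asy_def intro: asy_symb)
  hence 1: "symb (m + m' - 3 / 2) (\<lambda>z. (f z - c * z powr of_real m) * g z)" by (simp add: algebra_simps)
  have "symb (m + (m' - 3 / 2)) (\<lambda>z. c * z powr of_real m * (g z - d * z powr of_real m'))"
    using assms by (intro symb_mult symb_cmult symb_powr) (auto simp: asy_def)
  hence 2: "symb (m + m' - 3 / 2) (\<lambda>z. c * z powr of_real m * (g z - d * z powr of_real m'))"
    by (simp add: algebra_simps)
  show ?thesis unfolding asy_def
    by (rule symb_cong[OF symb_add[OF 1 2]]) (simp add: algebra_simps powr_add)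
qed

lemma asy_cmult: "asy m c f \<Longrightarrow> asy m (d * c) (\<lambda>z. d * f z)"
  using asy_mult[OF asy_const[of d], of m c f] by simp

lemma asy_powr_mult: "asy m c f \<Longrightarrow> asy (a + m) c (\<lambda>z. z powr of_real a * f z)"
  using asy_mult[OF asy_powr[of a], of m c f] by simp

lemma asy_sum: "(\<And>i. i \<in> I \<Longrightarrow> asy m (c i) (f i)) \<Longrightarrow> asy m (\<Sum>i\<in>I. c i) (\<lambda>z. \<Sum>i\<in>I. f i z)"
proof (induction I rule: infinite_finite_induct)
  case (insert x F)
  thus ?case by (auto intro: asy_add)
qed (auto simp: asy_def symb_0)

lemma asy_prod:
  assumes "finite I" "\<And>i. i \<in> I \<Longrightarrow> asy (m i) (c i) (f i)"
  shows "asy (\<Sum>i\<in>I. m i) (\<Prod>i\<in>I. c i) (\<lambda>z. \<Prod>i\<in>I. f i z)"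
  using assms by (induction I rule: finite_induct) (auto intro: asy_const[of 1] asy_mult)

subsection \<open>Centred moments\<close>

text \<open>The local frequency: the derivative of \<open>airy_chi\<close>.\<close>

definition om :: "complex \<Rightarrow> complex" where
  "om z = of_real (1 / sqrt 2) * z powr of_real (1 / 2)"

definition om' :: "complex \<Rightarrow> complex" where
  "om' z = of_real (1 / (2 * sqrt 2)) * z powr of_real (- 1 / 2)"

lemma om_deriv: "Re z > 0 \<Longrightarrow> (om has_field_derivative om' z) (at z)"
  unfolding om_def[abs_def] om'_def
  by (auto intro!: derivative_eq_intros simp: complex_nonpos_Reals_iff)

lemma csqrt_powr: "Re z > 0 \<Longrightarrow> csqrt z = z powr of_real (1 / 2)"
  by (subst csqrt_conv_powr) auto

lemma airy_chi_deriv: "Re z > 0 \<Longrightarrow> (airy_chi has_field_derivative om z) (at z)"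
proof -
  assume z: "Re z > 0"
  hence nr: "z \<notin> \<real>\<^sub>\<le>\<^sub>0" by (simp add: complex_nonpos_Reals_iff)
  have nz: "csqrt z \<noteq> 0" using z by auto
  have "(airy_chi has_field_derivative
      of_real (sqrt 2 / 3) * (of_nat 3 * (inverse (2 * csqrt z) * csqrt z ^ (3 - Suc 0))) + 0) (at z)"
    unfolding airy_chi_def[abs_def]
    by (intro DERIV_add DERIV_cmult DERIV_power DERIV_const has_field_derivative_csqrt nr)
  also have "of_real (sqrt 2 / 3) * (of_nat 3 * (inverse (2 * csqrt z) * csqrt z ^ (3 - Suc 0))) + 0 = of_real (sqrt 2 / 2) * csqrt z"
    using nz by (simp add: field_simps power2_eq_square del: csqrt.simps)
  also have "sqrt 2 / 2 = 1 / sqrt (2::real)" by (simp add: field_simps)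
  finally show ?thesis using csqrt_powr[OF z] by (simp add: om_def)
qed

text \<open>Let t^j stand for the j-th derivative of the wave exp(\<sigma> i chi) times its
  amplitude. Then \<open>amp \<sigma> k\<close> times the exponential represents (t - \<sigma> i
  om)^k: a derivative in z multiplies by t and, through \<open>om'\<close>, removes one bracket.
  Apart from the term \<open>deriv\<close> this is the recursion of Gaussian moments with variance
  \<sigma> i om'.\<close>

fun amp :: "real \<Rightarrow> nat \<Rightarrow> complex \<Rightarrow> complex" where
  "amp \<sigma> 0 = airy_amp \<sigma>"
| "amp \<sigma> (Suc k) = (\<lambda>z. deriv (amp \<sigma> k) z + \<sigma> * \<i> * of_nat k * om' z * amp \<sigma> (k - 1) z)"

text \<open>Index \<open>m\<close> means the moment of order 2 m of a Gaussian of variance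
  \<open>v\<close>; \<open>gmom\<close> below runs over all orders.\<close>

fun gauss_moment :: "complex \<Rightarrow> nat \<Rightarrow> complex" where
  "gauss_moment v 0 = 1"
| "gauss_moment v (Suc m) = of_nat (2 * m + 1) * v * gauss_moment v m"

lemma amp_0_asy:
  assumes s: "\<sigma> \<in> {1, -1}"
  shows "asy (- 1 / 4) 1 (airy_amp \<sigma>)"
proof -
  have eq: "1 / csqrt (csqrt z) = z powr of_real (- 1 / 4)" if "Re z > 0" for z
  proof -
    have z: "z \<noteq> 0" using that by auto
    have "\<bar>Im (Ln z)\<bar> < pi / 2" by (rule Re_Ln_pos_lt_imp[OF that])
    hence "Ln (exp (Ln z / 2)) = Ln z / 2" by (intro Ln_exp) auto
    moreover have "csqrt z = exp (Ln z / 2)" "csqrt z \<noteq> 0" using z by (auto simp: csqrt_exp_Ln)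
    ultimately have "csqrt (csqrt z) = exp (Ln z / 2 / 2)" by (metis csqrt_exp_Ln)
    thus ?thesis using z by (simp add: powr_def exp_minus inverse_eq_divide)
  qed
  have "symb (- 7 / 4) (\<lambda>z. airy_amp \<sigma> z - 1 * z powr of_real (- 1 / 4))"
  proof (rule symbI[of _ "1 / 2" "2 ^ 15 * 2 powr (7 / 4)"])
    show "(\<lambda>z. airy_amp \<sigma> z - 1 * z powr of_real (- 1 / 4)) holomorphic_on {z. Re z > 0}"
      by (intro holomorphic_intros airy_amp_holomorphic s) (auto simp: complex_nonpos_Reals_iff)
    show "eventually (\<lambda>x. \<forall>w\<in>ball (complex_of_real x) (1 / 2 * x).
        norm (airy_amp \<sigma> w - 1 * w powr of_real (- 1 / 4)) \<le> 2 ^ 15 * 2 powr (7 / 4) * x powr (- 7 / 4)) at_top"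
      using eventually_gt_at_top[of 0]
    proof eventually_elim
      case (elim x)
      show ?case
      proof
        fix w assume "w \<in> ball (complex_of_real x) (1 / 2 * x)"
        hence w: "norm (of_real x - w) < x / 2" by (simp add: dist_norm)
        have lo: "norm w \<ge> 1 / 2 * x"
          using norm_triangle_sub[of "of_real x" w] w elim by auto
        have "\<bar>x - Re w\<bar> < x / 2" using w abs_Re_le_cmod[of "of_real x - w"] by auto
        hence pos: "Re w > 0" by linarith
        have "norm (airy_amp \<sigma> w - 1 * w powr of_real (- 1 / 4)) \<le> 2 ^ 15 * norm w powr (- 7 / 4)"
          using airy_amp_asymp[OF pos s] eq[OF pos] by simp
        also have "norm w powr (- 7 / 4) \<le> (1 / 2 * x) powr (- 7 / 4)"
          using lo elim by (intro powr_mono2') auto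
        also have "(1 / 2 * x) powr (- 7 / 4) = (1 / 2) powr (- 7 / 4) * x powr (- 7 / 4)" by (rule powr_mult)
        also have "(1 / 2 :: real) powr (- 7 / 4) = 2 powr (7 / 4)"
          by (simp add: powr_minus powr_divide)
        finally show "norm (airy_amp \<sigma> w - 1 * w powr of_real (- 1 / 4)) \<le> 2 ^ 15 * 2 powr (7 / 4) * x powr (- 7 / 4)"
          by simp
      qed
    qed
  qed auto
  thus ?thesis unfolding asy_def by simp
qed

text \<open>A derivative gains z^(-1), a factor \<open>om'\<close> only z^(-1/2). At even order the
  \<open>om'\<close> term therefore dominates, by exactly 3/2. At odd order both terms have the same
  size, and a bound is all that is needed.\<close>

lemma amp_asy:
  assumes s: "\<sigma> \<in> {1, -1}"
  shows "asy (- 1 / 4 - real m / 2) (gauss_moment (\<sigma> * \<i> * of_real (1 / (2 * sqrt 2))) m) (amp \<sigma> (2 * m)) \<and>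
    symb (- 5 / 4 - real m / 2) (amp \<sigma> (2 * m + 1))"
proof (induction m)
  case 0
  have "symb (- 1 / 4) (airy_amp \<sigma>)" by (rule asy_symb[OF amp_0_asy[OF s]])
  from symb_deriv[OF this] have "symb (- 5 / 4) (deriv (airy_amp \<sigma>))" by simp
  thus ?case using amp_0_asy[OF s] by simp
next
  case (Suc m)
  define v where "v = \<sigma> * \<i> * of_real (1 / (2 * sqrt 2))"
  have o: "asy (- 1 / 2) (of_real (1 / (2 * sqrt 2))) om'"
    unfolding om'_def using asy_cmult[OF asy_powr[of "- 1 / 2"], of "of_real (1 / (2 * sqrt 2))"] by simp
  have 1: "asy (- 1 / 4 - real (Suc m) / 2) (gauss_moment v (Suc m)) (amp \<sigma> (2 * m + 2))"
  proof -
    have "symb (- 5 / 4 - real m / 2 - 1) (deriv (amp \<sigma> (2 * m + 1)))"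
      using Suc by (intro symb_deriv) auto
    hence "asy (- 1 / 4 - real (Suc m) / 2) 0 (deriv (amp \<sigma> (2 * m + 1)))"
      by (intro asy_0) (erule symb_exp_eq, simp add: field_simps)
    moreover have "asy (- 1 / 2 + (- 1 / 4 - real m / 2)) ((\<sigma> * \<i> * of_nat (2 * m + 1)) * (of_real (1 / (2 * sqrt 2)) * gauss_moment v m))
        (\<lambda>z. (\<sigma> * \<i> * of_nat (2 * m + 1)) * (om' z * amp \<sigma> (2 * m) z))"
      using Suc by (intro asy_cmult asy_mult o) (auto simp: v_def)
    hence "asy (- 1 / 4 - real (Suc m) / 2) ((\<sigma> * \<i> * of_nat (2 * m + 1)) * (of_real (1 / (2 * sqrt 2)) * gauss_moment v m))
        (\<lambda>z. (\<sigma> * \<i> * of_nat (2 * m + 1)) * (om' z * amp \<sigma> (2 * m) z))"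
      by (rule asy_exp_eq) (simp_all add: field_simps)
    ultimately have "asy (- 1 / 4 - real (Suc m) / 2) (0 + (\<sigma> * \<i> * of_nat (2 * m + 1)) * (of_real (1 / (2 * sqrt 2)) * gauss_moment v m))
        (\<lambda>z. deriv (amp \<sigma> (2 * m + 1)) z + (\<sigma> * \<i> * of_nat (2 * m + 1)) * (om' z * amp \<sigma> (2 * m) z))"
      by (rule asy_add)
    moreover have "amp \<sigma> (2 * m + 2) = (\<lambda>z. deriv (amp \<sigma> (2 * m + 1)) z + (\<sigma> * \<i> * of_nat (2 * m + 1)) * (om' z * amp \<sigma> (2 * m) z))"
      using amp.simps(2)[of \<sigma> "2 * m + 1"] by (simp add: mult.assoc)
    ultimately show ?thesis by (simp add: v_def mult_ac)
  qed
  have 2: "symb (- 5 / 4 - real (Suc m) / 2) (amp \<sigma> (2 * m + 3))"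
  proof -
    have "symb (- 1 / 4 - real (Suc m) / 2 - 1) (deriv (amp \<sigma> (2 * m + 2)))"
      using 1 by (intro symb_deriv) (rule asy_symb)
    hence a: "symb (- 5 / 4 - real (Suc m) / 2) (deriv (amp \<sigma> (2 * m + 2)))" by (rule symb_exp_eq) (simp add: field_simps)
    have "symb (- 1 / 2 + (- 5 / 4 - real m / 2)) (\<lambda>z. (\<sigma> * \<i> * of_nat (2 * m + 2)) * (om' z * amp \<sigma> (2 * m + 1) z))"
      using Suc asy_symb[OF o] by (intro symb_cmult symb_mult) auto
    hence b: "symb (- 5 / 4 - real (Suc m) / 2) (\<lambda>z. (\<sigma> * \<i> * of_nat (2 * m + 2)) * (om' z * amp \<sigma> (2 * m + 1) z))"
      by (rule symb_exp_eq) (simp add: field_simps)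
    have "amp \<sigma> (2 * m + 3) = (\<lambda>z. deriv (amp \<sigma> (2 * m + 2)) z + (\<sigma> * \<i> * of_nat (2 * m + 2)) * (om' z * amp \<sigma> (2 * m + 1) z))"
      using amp.simps(2)[of \<sigma> "2 * m + 2"] by (simp add: mult.assoc eval_nat_numeral)
    thus ?thesis using symb_add[OF a b] by simp
  qed
  show ?case using 1 2 by (simp add: v_def eval_nat_numeral)
qed

text \<open>Dividing by powers of \<open>om\<close> moves the nodes to the fixed points \<sigma> i;
  the factor z^(1/4) makes the moment of order 0 tend to 1.\<close>

definition mom :: "real \<Rightarrow> nat \<Rightarrow> complex \<Rightarrow> complex" where
  "mom \<sigma> k z = z powr of_real (1 / 4) * amp \<sigma> k z / om z ^ k"

lemma om_nz: "Re z > 0 \<Longrightarrow> om z \<noteq> 0"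
  by (auto simp: om_def)

lemma om_power: "Re z > 0 \<Longrightarrow> 1 / om z ^ k = of_real (sqrt 2) ^ k * z powr of_real (- real k / 2)"
proof -
  assume z: "Re z > 0"
  have "om z ^ k = of_real (1 / sqrt 2) ^ k * z powr (of_nat k * of_real (1 / 2))"
  proof -
    have "(z powr of_real (1 / 2)) ^ k = z powr (of_nat k * of_real (1 / 2))"
      using z by (auto simp: powr_def simp flip: exp_of_nat_mult)
    thus ?thesis unfolding om_def power_mult_distrib by (simp only:)
  qed
  also have "of_nat k * complex_of_real (1 / 2) = of_real (real k / 2)" by simp
  finally have X: "om z ^ k = of_real (1 / sqrt 2) ^ k * z powr of_real (real k / 2)" .
  show ?thesis unfolding X by (simp add: powr_minus power_divide inverse_eq_divide)
qed

text \<open>\<open>(k + 1) div 2\<close> rounds up: the bound for an odd moment is that of the next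
  even one, which later penalises entries of odd order. The powers of sqrt 2 in \<open>om\<close>
  turn the variance \<sigma> i / (2 sqrt 2) into \<sigma> i / sqrt 2.\<close>

lemma mom_asy:
  assumes s: "\<sigma> \<in> {1, -1}"
  shows "asy (- 3 / 2 * real m) (gauss_moment (\<sigma> * \<i> / of_real (sqrt 2)) m) (mom \<sigma> (2 * m))"
    and "symb (- 3 / 2 * real ((k + 1) div 2)) (mom \<sigma> k)"
proof -
  have sc: "gauss_moment (c * v) m = c ^ m * gauss_moment v m" for c v m
    by (induction m) (auto simp: mult_ac)
  show 1: "asy (- 3 / 2 * real m) (gauss_moment (\<sigma> * \<i> / of_real (sqrt 2)) m) (mom \<sigma> (2 * m))" for m
  proof -
    have "asy (- real m + (1 / 4 + (- 1 / 4 - real m / 2))) (of_real (sqrt 2) ^ (2 * m) * gauss_moment (\<sigma> * \<i> * of_real (1 / (2 * sqrt 2))) m)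
      (\<lambda>z. of_real (sqrt 2) ^ (2 * m) * (z powr of_real (- real m) * (z powr of_real (1 / 4) * amp \<sigma> (2 * m) z)))"
      using amp_asy[OF s, of m] by (intro asy_cmult asy_powr_mult) auto
    hence "asy (- real m + (1 / 4 + (- 1 / 4 - real m / 2))) (of_real (sqrt 2) ^ (2 * m) * gauss_moment (\<sigma> * \<i> * of_real (1 / (2 * sqrt 2))) m) (mom \<sigma> (2 * m))"
    proof (rule asy_cong)
      fix z :: complex assume z: "Re z > 0"
      have "mom \<sigma> (2 * m) z = z powr of_real (1 / 4) * amp \<sigma> (2 * m) z * (1 / om z ^ (2 * m))"
        by (simp add: mom_def)
      thus "of_real (sqrt 2) ^ (2 * m) * (z powr of_real (- real m) * (z powr of_real (1 / 4) * amp \<sigma> (2 * m) z)) = mom \<sigma> (2 * m) z"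
        unfolding om_power[OF z] by simp
    qed
    moreover have "- real m + (1 / 4 + (- 1 / 4 - real m / 2)) = - 3 / 2 * real m" by simp
    moreover have "complex_of_real (sqrt 2) ^ (2 * m) = 2 ^ m"
      by (simp add: power_mult flip: of_real_power)
    moreover have "2 ^ m * gauss_moment (\<sigma> * \<i> * of_real (1 / (2 * sqrt 2))) m = gauss_moment (\<sigma> * \<i> / of_real (sqrt 2)) m"
      unfolding sc[symmetric] by simp
    ultimately show ?thesis by metis
  qed
  show "symb (- 3 / 2 * real ((k + 1) div 2)) (mom \<sigma> k)"
  proof (cases "even k")
    case True
    then obtain m where "k = 2 * m" by blast
    thus ?thesis using asy_symb[OF 1[of m]] by simp
  next
    case False
    then obtain m where k: "k = 2 * m + 1" by (metis oddE)
    have "symb (- real k / 2 + (1 / 4 + (- 5 / 4 - real m / 2)))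
      (\<lambda>z. of_real (sqrt 2) ^ k * (z powr of_real (- real k / 2) * (z powr of_real (1 / 4) * amp \<sigma> k z)))"
      using amp_asy[OF s, of m] unfolding k by (intro symb_cmult symb_powr_mult) auto
    hence "symb (- real k / 2 + (1 / 4 + (- 5 / 4 - real m / 2))) (mom \<sigma> k)"
    proof (rule symb_cong)
      fix z :: complex assume z: "Re z > 0"
      have "mom \<sigma> k z = z powr of_real (1 / 4) * amp \<sigma> k z * (1 / om z ^ k)"
        by (simp add: mom_def)
      thus "of_real (sqrt 2) ^ k * (z powr of_real (- real k / 2) * (z powr of_real (1 / 4) * amp \<sigma> k z)) = mom \<sigma> k z"
        unfolding om_power[OF z] by simp
    qed
    moreover have "- real k / 2 + (1 / 4 + (- 5 / 4 - real m / 2)) = - 3 / 2 * real ((k + 1) div 2)"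
      by (simp add: k field_simps)
    ultimately show ?thesis by metis
  qed
qed

subsection \<open>Determinants indexed by natural numbers\<close>

text \<open>The Leibniz formula on plain index functions, because asymptotics are taken in each
  permutation term separately.\<close>

definition ldet :: "nat \<Rightarrow> (nat \<Rightarrow> nat \<Rightarrow> complex) \<Rightarrow> complex" where
  "ldet n f = (\<Sum>\<pi>\<in>{\<pi>. \<pi> permutes {0..<n}}. signof \<pi> * (\<Prod>i=0..<n. f i (\<pi> i)))"

lemma permutes_in_range: "\<pi> permutes {0..<n::nat} \<Longrightarrow> i < n \<Longrightarrow> \<pi> i < n"
  using permutes_in_image[of \<pi> "{0..<n}" i] by auto

lemma ldet_eq_det: "ldet n f = Determinant.det (Matrix.mat n n (\<lambda>(i, j). f i j))"
  unfolding ldet_def by (subst det_def') (auto intro!: sum.cong prod.cong dest: permutes_in_range)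

lemma ldet_cong: "(\<And>i j. i < n \<Longrightarrow> j < n \<Longrightarrow> f i j = g i j) \<Longrightarrow> ldet n f = ldet n g"
  unfolding ldet_def by (auto intro!: sum.cong prod.cong dest: permutes_in_range)

lemma ldet_scale: "ldet n (\<lambda>i j. u i * v j * f i j) = (\<Prod>i=0..<n. u i) * (\<Prod>i=0..<n. v i) * ldet n f"
proof -
  have "(\<Prod>i=0..<n. v (\<pi> i)) = (\<Prod>i=0..<n. v i)" if "\<pi> permutes {0..<n}" for \<pi>
    using prod.permute[OF that, of v] by (simp add: o_def)
  thus ?thesis unfolding ldet_def
    by (auto simp: prod.distrib sum_distrib_left mult_ac intro!: sum.cong)
qed

lemma ldet_mult: "ldet n (\<lambda>i j. \<Sum>k<n. f i k * g k j) = ldet n f * ldet n g"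
proof -
  have "Matrix.mat n n (\<lambda>(i, j). f i j) * Matrix.mat n n (\<lambda>(i, j). g i j) =
      Matrix.mat n n (\<lambda>(i, j). \<Sum>k<n. f i k * g k j)"
    by (rule eq_matI) (auto simp: scalar_prod_def atLeast0LessThan)
  thus ?thesis unfolding ldet_eq_det by (simp flip: det_mult[of _ n])
qed

lemma ldet_transpose: "ldet n (\<lambda>i j. f j i) = ldet n f"
proof -
  have "Matrix.mat n n (\<lambda>(i, j). f j i) = transpose_mat (Matrix.mat n n (\<lambda>(i, j). f i j))"
    by (rule eq_matI) auto
  thus ?thesis unfolding ldet_eq_det by (simp add: det_transpose[of _ n])
qed

lemma ldet_lower:
  assumes "\<And>i j. i < j \<Longrightarrow> j < n \<Longrightarrow> f i j = 0"
  shows "ldet n f = (\<Prod>i<n. f i i)"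
  unfolding ldet_eq_det
  by (subst det_lower_triangular[of n]) (auto simp: assms prod_list_diag_prod atLeast0LessThan)

lemma ldet_upper:
  assumes "\<And>i j. j < i \<Longrightarrow> i < n \<Longrightarrow> f i j = 0"
  shows "ldet n f = (\<Prod>i<n. f i i)"
  using ldet_lower[of n "\<lambda>i j. f j i"] ldet_transpose[of n f] assms by simp

lemma ldet_block:
  assumes "\<And>i j. i < r \<Longrightarrow> j < p \<Longrightarrow> f (p + i) j = 0"
  shows "ldet (p + r) f = ldet p f * ldet r (\<lambda>i j. f (p + i) (p + j))"
proof -
  have "Matrix.mat (p + r) (p + r) (\<lambda>(i, j). f i j) =
    four_block_mat (Matrix.mat p p (\<lambda>(i, j). f i j)) (Matrix.mat p r (\<lambda>(i, j). f i (p + j)))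
      (0\<^sub>m r p) (Matrix.mat r r (\<lambda>(i, j). f (p + i) (p + j)))"
  proof (rule eq_matI, goal_cases)
    case (1 i j)
    thus ?case using assms[of "i - p" j] by (cases "i < p"; cases "j < p") auto
  qed auto
  thus ?thesis unfolding ldet_eq_det by (simp add: det_four_block_mat_lower_left_zero[of _ p _ r])
qed

subsection \<open>The mixed coefficients of a pencil\<close>

definition mixed_coeff :: "nat \<Rightarrow> nat \<Rightarrow> (nat \<Rightarrow> nat \<Rightarrow> complex) \<Rightarrow> (nat \<Rightarrow> nat \<Rightarrow> complex) \<Rightarrow> complex" where
  "mixed_coeff n k M N = (\<Sum>S\<in>{S \<in> Pow {0..<n}. card S = k}. ldet n (\<lambda>i j. if i \<in> S then M i j else N i j))"

lemma ldet_pencil: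
  "ldet n (\<lambda>i j. a * M i j + b * N i j) = (\<Sum>k\<le>n. a ^ k * b ^ (n - k) * mixed_coeff n k M N)"
proof -
  have prod: "(\<Prod>i=0..<n. a * M i (\<pi> i) + b * N i (\<pi> i)) =
     (\<Sum>S\<in>Pow {0..<n}. a ^ card S * b ^ (n - card S) * (\<Prod>i=0..<n. if i \<in> S then M i (\<pi> i) else N i (\<pi> i)))" for \<pi>
  proof -
    have "(\<Prod>i=0..<n. a * M i (\<pi> i) + b * N i (\<pi> i)) =
       (\<Sum>S\<in>Pow {0..<n}. (\<Prod>i\<in>S. a * M i (\<pi> i)) * (\<Prod>i\<in>{0..<n} - S. b * N i (\<pi> i)))"
      by (rule prod_add) simp
    also have "\<dots> = (\<Sum>S\<in>Pow {0..<n}. a ^ card S * b ^ (n - card S) * (\<Prod>i=0..<n. if i \<in> S then M i (\<pi> i) else N i (\<pi> i)))"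
    proof (rule sum.cong)
      fix S assume "S \<in> Pow {0..<n}"
      hence S: "S \<subseteq> {0..<n}" by simp
      hence fin: "finite S" by (rule finite_subset) simp
      have "(\<Prod>i=0..<n. if i \<in> S then M i (\<pi> i) else N i (\<pi> i)) =
          (\<Prod>i\<in>{0..<n} - S. if i \<in> S then M i (\<pi> i) else N i (\<pi> i)) * (\<Prod>i\<in>S. if i \<in> S then M i (\<pi> i) else N i (\<pi> i))"
        using S by (intro prod.subset_diff) auto
      also have "\<dots> = (\<Prod>i\<in>{0..<n} - S. N i (\<pi> i)) * (\<Prod>i\<in>S. M i (\<pi> i))" by simp
      finally show "(\<Prod>i\<in>S. a * M i (\<pi> i)) * (\<Prod>i\<in>{0..<n} - S. b * N i (\<pi> i)) =
          a ^ card S * b ^ (n - card S) * (\<Prod>i=0..<n. if i \<in> S then M i (\<pi> i) else N i (\<pi> i))"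
        using S fin by (simp add: prod.distrib card_Diff_subset mult_ac)
    qed simp
    finally show ?thesis .
  qed
  have "ldet n (\<lambda>i j. a * M i j + b * N i j) = (\<Sum>S\<in>Pow {0..<n}. a ^ card S * b ^ (n - card S) *
      ldet n (\<lambda>i j. if i \<in> S then M i j else N i j))"
    unfolding ldet_def prod sum_distrib_left
    by (subst sum.swap) (simp add: mult_ac)
  also have "\<dots> = (\<Sum>k\<le>n. \<Sum>S\<in>{S \<in> Pow {0..<n}. card S = k}. a ^ card S * b ^ (n - card S) *
      ldet n (\<lambda>i j. if i \<in> S then M i j else N i j))"
    by (rule sum.group[symmetric]) (auto dest: card_mono[rotated])
  also have "\<dots> = (\<Sum>k\<le>n. a ^ k * b ^ (n - k) * mixed_coeff n k M N)"
    unfolding mixed_coeff_def sum_distrib_left by (intro sum.cong refl) auto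
  finally show ?thesis .
qed

text \<open>Both determinants are polynomials in \<open>a\<close>, so coefficients may be compared.
  A change of basis acts on the pencil as a whole and mixes the row choices; this is how it still
  passes to each mixed coefficient.\<close>

lemma mixed_coeff_eqI:
  assumes "\<And>a. ldet n (\<lambda>i j. a * M i j + N i j) = c * ldet n (\<lambda>i j. a * M' i j + N' i j)" and "k \<le> n"
  shows "mixed_coeff n k M N = c * mixed_coeff n k M' N'"
proof -
  have "(\<Sum>k\<le>n. mixed_coeff n k M N * a ^ k) = (\<Sum>k\<le>n. (c * mixed_coeff n k M' N') * a ^ k)" for a
  proof -
    have "(\<Sum>k\<le>n. mixed_coeff n k M N * a ^ k) = ldet n (\<lambda>i j. a * M i j + N i j)"
      using ldet_pencil[of n a M 1 N] by (simp add: mult_ac)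
    also have "\<dots> = c * ldet n (\<lambda>i j. a * M' i j + N' i j)" by (rule assms)
    also have "\<dots> = (\<Sum>k\<le>n. (c * mixed_coeff n k M' N') * a ^ k)"
      using ldet_pencil[of n a M' 1 N'] by (simp add: mult_ac sum_distrib_left)
    finally show ?thesis .
  qed
  thus ?thesis
    using polyfun_eq_coeffs[where c = "\<lambda>k. mixed_coeff n k M N" and d = "\<lambda>k. c * mixed_coeff n k M' N'" and n = n] assms(2) by auto
qed

subsection \<open>Moment functionals and change of basis\<close>

definition moment_fun :: "(nat \<Rightarrow> complex) \<Rightarrow> complex poly \<Rightarrow> complex" where
  "moment_fun \<mu> p = (\<Sum>k\<le>degree p. coeff p k * \<mu> k)"

lemma moment_fun_eq: "degree p \<le> N \<Longrightarrow> moment_fun \<mu> p = (\<Sum>k\<le>N. coeff p k * \<mu> k)"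
  unfolding moment_fun_def by (rule sum.mono_neutral_left) (auto simp: coeff_eq_0)

lemma moment_fun_add: "moment_fun \<mu> (p + q) = moment_fun \<mu> p + moment_fun \<mu> q"
proof -
  define N where "N = max (degree p) (degree q)"
  have "degree p \<le> N" "degree q \<le> N" "degree (p + q) \<le> N"
    by (auto simp: N_def degree_add_le)
  thus ?thesis by (simp add: moment_fun_eq[of _ N] sum.distrib algebra_simps)
qed

lemma moment_fun_smult: "moment_fun \<mu> (Polynomial.smult c p) = c * moment_fun \<mu> p"
  using moment_fun_eq[of "Polynomial.smult c p" "degree p" \<mu>] moment_fun_eq[of p "degree p" \<mu>]
  by (simp add: sum_distrib_left mult_ac degree_smult_le)

lemma moment_fun_pCons: "moment_fun \<mu> (pCons 0 p) = moment_fun (\<lambda>k. \<mu> (Suc k)) p"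
proof -
  have "moment_fun \<mu> (pCons 0 p) = (\<Sum>k\<le>Suc (degree p). coeff (pCons 0 p) k * \<mu> k)"
    by (rule moment_fun_eq) (rule degree_pCons_le)
  thus ?thesis by (simp add: moment_fun_def sum.atMost_Suc_shift del: sum.atMost_Suc)
qed

lemma moment_fun_monom_mult: "moment_fun \<mu> (monom 1 k * p) = moment_fun (\<lambda>l. \<mu> (k + l)) p"
proof (induction k arbitrary: \<mu>)
  case (Suc k)
  have "monom 1 (Suc k) * p = pCons 0 (monom 1 k * p)" by (simp add: monom_Suc)
  thus ?case using Suc by (simp add: moment_fun_pCons)
qed (simp add: monom_0 one_pCons)

lemma poly_eq_sum_monom:
  fixes p :: "complex poly"
  assumes "degree p < n"
  shows "p = (\<Sum>k<n. Polynomial.smult (coeff p k) (monom 1 k))"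
proof -
  have "p = (\<Sum>k\<le>n - 1. monom (coeff p k) k)"
    using poly_as_sum_of_monoms'[of p "n - 1"] assms by simp
  moreover have "{..n - 1} = {..<n}" using assms by auto
  moreover have "Polynomial.smult (coeff p k) (monom 1 k) = monom (coeff p k) k" for k
    by (simp add: smult_monom)
  ultimately show ?thesis by (simp only:)
qed

text \<open>The matrix of the bilinear form \<open>\<Lambda> (p * q)\<close> changes from H to A H
  A^T, and in the monomial basis H is the Hankel matrix.\<close>

lemma gram_ldet:
  fixes \<Lambda> :: "complex poly \<Rightarrow> complex"
  assumes add: "\<And>p q. \<Lambda> (p + q) = \<Lambda> p + \<Lambda> q" and smult: "\<And>c p. \<Lambda> (Polynomial.smult c p) = c * \<Lambda> p"
    and deg: "\<And>i. i < n \<Longrightarrow> degree (P i) < n"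
  shows "ldet n (\<lambda>i j. \<Lambda> (P i * P j)) = (ldet n (\<lambda>i j. coeff (P i) j))\<^sup>2 * ldet n (\<lambda>i j. \<Lambda> (monom 1 (i + j)))"
proof -
  have zero: "\<Lambda> 0 = 0" using smult[of 0 0] by simp
  have sum: "\<Lambda> (\<Sum>k\<in>A. f k) = (\<Sum>k\<in>A. \<Lambda> (f k))" for A and f :: "nat \<Rightarrow> complex poly"
    by (induction A rule: infinite_finite_induct) (auto simp: zero add)
  have "\<Lambda> (P i * P j) = (\<Sum>k<n. coeff (P i) k * (\<Sum>l<n. \<Lambda> (monom 1 (k + l)) * coeff (P j) l))"
    if "i < n" "j < n" for i j
  proof -
    have "P i * P j = (\<Sum>k<n. Polynomial.smult (coeff (P i) k) (monom 1 k)) * (\<Sum>l<n. Polynomial.smult (coeff (P j) l) (monom 1 l))"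
      by (intro arg_cong2[where f = "(*)"] poly_eq_sum_monom deg that)
    also have "\<dots> = (\<Sum>k<n. \<Sum>l<n. Polynomial.smult (coeff (P i) k * coeff (P j) l) (monom 1 (k + l)))"
      unfolding sum_product by (intro sum.cong refl) (simp add: mult_monom mult.commute)
    finally have "P i * P j = (\<Sum>k<n. \<Sum>l<n. Polynomial.smult (coeff (P i) k * coeff (P j) l) (monom 1 (k + l)))" .
    thus ?thesis by (simp add: sum smult sum_distrib_left mult_ac)
  qed
  hence "ldet n (\<lambda>i j. \<Lambda> (P i * P j)) =
      ldet n (\<lambda>i j. \<Sum>k<n. coeff (P i) k * (\<Sum>l<n. \<Lambda> (monom 1 (k + l)) * coeff (P j) l))"
    by (intro ldet_cong)
  also have "\<dots> = ldet n (\<lambda>i k. coeff (P i) k) * (ldet n (\<lambda>i j. \<Lambda> (monom 1 (i + j))) * ldet n (\<lambda>l j. coeff (P j) l))"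
    unfolding ldet_mult ..
  also have "ldet n (\<lambda>l j. coeff (P j) l) = ldet n (\<lambda>i j. coeff (P i) j)" by (rule ldet_transpose)
  finally show ?thesis by (simp add: power2_eq_square mult_ac)
qed

lemma degree_linear_power': "degree ([:c, 1:] ^ k :: complex poly) = k"
  by (simp add: degree_power_eq)

lemma lead_linear_power: "coeff ([:c, 1:] ^ k :: complex poly) k = 1"
  using lead_coeff_power[of "[:c, 1 :: complex:]" k] by (simp add: degree_linear_power')

lemma coeff_0_linear_power: "coeff ([:c, 1:] ^ k :: complex poly) 0 = c ^ k"
  by (simp add: coeff_0_power)

text \<open>The basis adapted to the nodes \<open>0\<close> and \<open>-d\<close>: the first \<open>p\<close> polynomials vanish at \<open>-d\<close> to order \<open>r\<close>,
  the others at \<open>0\<close> to order \<open>p\<close>.\<close>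

definition two_node_basis :: "complex \<Rightarrow> nat \<Rightarrow> nat \<Rightarrow> nat \<Rightarrow> complex poly" where
  "two_node_basis d p r i = (if i < p then monom 1 i * [:d, 1:] ^ r else monom 1 p * [:d, 1:] ^ (i - p))"

lemma degree_two_node_basis: "i < p + r \<Longrightarrow> degree (two_node_basis d p r i) < p + r"
  by (auto simp: two_node_basis_def degree_mult_eq degree_linear_power' degree_monom_eq monom_eq_0_iff)

text \<open>The last \<open>r\<close> polynomials are divisible by X^p, which makes the matrix block
  triangular, with an upper triangular block of diagonal \<open>d ^ r\<close> and a unit lower
  triangular one. Up to sign it is the resultant of X^p and (X + d)^r.\<close>

lemma ldet_two_node_basis:
  "ldet (p + r) (\<lambda>i j. coeff (two_node_basis d p r i) j) = d ^ (p * r)"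
proof -
  have "ldet (p + r) (\<lambda>i j. coeff (two_node_basis d p r i) j) =
      ldet p (\<lambda>i j. coeff (two_node_basis d p r i) j) *
      ldet r (\<lambda>i j. coeff (two_node_basis d p r (p + i)) (p + j))"
    by (rule ldet_block) (auto simp: two_node_basis_def coeff_monom_mult)
  also have "ldet p (\<lambda>i j. coeff (two_node_basis d p r i) j) = (\<Prod>i<p. coeff (two_node_basis d p r i) i)"
    by (rule ldet_upper) (auto simp: two_node_basis_def coeff_monom_mult)
  also have "\<dots> = d ^ (p * r)"
    by (simp add: two_node_basis_def coeff_monom_mult coeff_0_linear_power mult.commute flip: power_mult)
  also have "ldet r (\<lambda>i j. coeff (two_node_basis d p r (p + i)) (p + j)) =
      (\<Prod>i<r. coeff (two_node_basis d p r (p + i)) (p + i))"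
    by (rule ldet_lower) (auto simp: two_node_basis_def coeff_monom_mult coeff_eq_0 degree_linear_power')
  also have "\<dots> = 1"
    by (simp add: two_node_basis_def coeff_monom_mult lead_linear_power)
  finally show ?thesis by simp
qed

lemma ldet_shift_basis: "ldet n (\<lambda>i j. coeff ([:c, 1:] ^ i :: complex poly) j) = 1"
  by (subst ldet_lower) (auto simp: coeff_eq_0 degree_linear_power' lead_linear_power)

subsection \<open>Hankel determinants of Gaussian moments\<close>

fun gmom :: "complex \<Rightarrow> nat \<Rightarrow> complex" where
  "gmom v 0 = 1"
| "gmom v (Suc 0) = 0"
| "gmom v (Suc (Suc m)) = of_nat (Suc m) * v * gmom v m"

text \<open>The coefficients of \<open>x\<^sup>i\<close> in the basis of Hermite polynomials of variance \<open>v\<close>.\<close>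

definition hermite_coeff :: "complex \<Rightarrow> nat \<Rightarrow> nat \<Rightarrow> complex" where
  "hermite_coeff v i k = of_nat (i choose k) * gmom v (i - k)"

text \<open>The three-term recurrence read on coefficients: multiplication by x raises a Hermite
  polynomial with coefficient 1 and lowers it with coefficient degree times
  \<open>v\<close>.\<close>

lemma hermite_coeff_Suc:
  "hermite_coeff v (Suc i) k = (if k = 0 then 0 else hermite_coeff v i (k - 1)) +
    of_nat (Suc k) * v * hermite_coeff v i (Suc k)"
proof -
  have step: "of_nat (i choose k) * gmom v (Suc i - k) = of_nat (Suc k) * v * hermite_coeff v i (Suc k)"
  proof (cases "k < i")
    case True
    then obtain m where m: "i = k + Suc m" by (metis add_Suc_right less_iff_Suc_add)
    have "Suc k * (i choose Suc k) = (i choose k) * (i - k)"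
      using binomial_absorb_comp[of i k] binomial_absorption[of k i] by (simp only: mult.commute)
    hence *: "complex_of_nat (Suc k) * of_nat (i choose Suc k) = of_nat (i choose k) * of_nat (i - k)"
      by (simp only: flip: of_nat_mult)
    have "gmom v (Suc i - k) = of_nat (i - k) * v * gmom v (i - Suc k)" using m by simp
    hence "of_nat (i choose k) * gmom v (Suc i - k) = (of_nat (i choose k) * of_nat (i - k)) * v * gmom v (i - Suc k)"
      by simp
    thus ?thesis unfolding hermite_coeff_def *[symmetric] by (simp only: mult_ac)
  next
    case False
    thus ?thesis by (cases "k = i") (auto simp: hermite_coeff_def binomial_eq_0)
  qed
  show ?thesis
  proof (cases k)
    case 0
    thus ?thesis using step by (simp add: hermite_coeff_def)
  next
    case (Suc l)
    have "hermite_coeff v (Suc i) k = hermite_coeff v i l + of_nat (i choose k) * gmom v (Suc i - k)"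
      by (simp add: Suc hermite_coeff_def algebra_simps)
    thus ?thesis using step Suc by simp
  qed
qed

lemma hermite_coeff_0: "i < k \<Longrightarrow> hermite_coeff v i k = 0"
  by (simp add: hermite_coeff_def binomial_eq_0)

text \<open>Parseval's identity for Hermite polynomials, whose squared norms are k! v^k. The
  induction moves one factor x from the left argument to the right, since multiplication by x is
  symmetric for the form.\<close>

lemma gmom_add:
  assumes "i + j \<le> N"
  shows "(\<Sum>k\<le>N. hermite_coeff v i k * hermite_coeff v j k * (fact k * v ^ k)) = gmom v (i + j)"
  using assms
proof (induction i arbitrary: j)
  case 0
  have "(\<Sum>k\<le>N. hermite_coeff v 0 k * hermite_coeff v j k * (fact k * v ^ k)) =
     (\<Sum>k\<in>{0}. hermite_coeff v 0 k * hermite_coeff v j k * (fact k * v ^ k))"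
    by (rule sum.mono_neutral_right) (auto simp: hermite_coeff_0)
  thus ?case by (simp add: hermite_coeff_def)
next
  case (Suc i)
  define w where "w = (\<lambda>k. fact k * v ^ k)"
  have w: "w (Suc k) = of_nat (Suc k) * v * w k" for k by (simp add: w_def mult_ac)
  \<comment> \<open>Raising on one side equals lowering on the other, by w(k + 1) = (k + 1) v w(k).
    The bound on a + b ensures that the shifted sum loses no term at its upper end.\<close>
  have shift: "(\<Sum>k\<le>N. (if k = 0 then 0 else hermite_coeff v a (k - 1)) * hermite_coeff v b k * w k) =
      (\<Sum>k\<le>N. hermite_coeff v a k * (of_nat (Suc k) * v * hermite_coeff v b (Suc k)) * w k)"
    if "a + b \<le> N" for a b
  proof -
    have "(\<Sum>k\<le>N. (if k = 0 then 0 else hermite_coeff v a (k - 1)) * hermite_coeff v b k * w k) =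
        (\<Sum>k\<le>Suc N. (if k = 0 then 0 else hermite_coeff v a (k - 1)) * hermite_coeff v b k * w k)"
      using that by (simp add: hermite_coeff_0)
    also have "\<dots> = (\<Sum>k\<le>N. hermite_coeff v a k * hermite_coeff v b (Suc k) * w (Suc k))"
      by (subst sum.atMost_Suc_shift) simp
    finally show ?thesis by (simp add: w mult_ac)
  qed
  have "(\<Sum>k\<le>N. hermite_coeff v (Suc i) k * hermite_coeff v j k * w k) =
      (\<Sum>k\<le>N. (if k = 0 then 0 else hermite_coeff v i (k - 1)) * hermite_coeff v j k * w k) +
      (\<Sum>k\<le>N. hermite_coeff v j k * (of_nat (Suc k) * v * hermite_coeff v i (Suc k)) * w k)"
    unfolding hermite_coeff_Suc[of v i] by (simp add: distrib_left distrib_right sum.distrib mult_ac del: of_nat_Suc)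
  also have "\<dots> = (\<Sum>k\<le>N. hermite_coeff v i k * (of_nat (Suc k) * v * hermite_coeff v j (Suc k)) * w k) +
      (\<Sum>k\<le>N. (if k = 0 then 0 else hermite_coeff v j (k - 1)) * hermite_coeff v i k * w k)"
    using Suc.prems by (simp add: shift[of i j] shift[of j i])
  also have "\<dots> = (\<Sum>k\<le>N. hermite_coeff v i k * hermite_coeff v (Suc j) k * w k)"
    unfolding hermite_coeff_Suc[of v j] by (simp add: distrib_left distrib_right sum.distrib mult_ac del: of_nat_Suc)
  also have "\<dots> = gmom v (Suc i + j)" using Suc.IH[of "Suc j"] Suc.prems by (simp add: w_def)
  finally show ?case by (simp add: w_def)
qed

definition hankel_gauss :: "complex \<Rightarrow> nat \<Rightarrow> complex" where
  "hankel_gauss v n = (\<Prod>k<n. fact k * v ^ k)"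

text \<open>A factorisation L D L^T in which L is the unit triangular matrix of Hermite coefficients
  and D holds the squared norms.\<close>

lemma ldet_gmom: "ldet n (\<lambda>i j. gmom v (i + j)) = hankel_gauss v n"
proof -
  have "gmom v (i + j) = (\<Sum>k<n. hermite_coeff v i k * (fact k * v ^ k * 1 * hermite_coeff v j k))"
    if "i < n" "j < n" for i j
  proof -
    have "gmom v (i + j) = (\<Sum>k\<le>i + j + n. hermite_coeff v i k * hermite_coeff v j k * (fact k * v ^ k))"
      by (rule gmom_add[symmetric]) simp
    also have "\<dots> = (\<Sum>k<n. hermite_coeff v i k * hermite_coeff v j k * (fact k * v ^ k))"
      using that by (intro sum.mono_neutral_right) (auto simp: hermite_coeff_0)
    finally show ?thesis by (simp add: mult_ac)
  qed
  hence "ldet n (\<lambda>i j. gmom v (i + j)) = ldet n (\<lambda>i j. \<Sum>k<n. hermite_coeff v i k * (fact k * v ^ k * 1 * hermite_coeff v j k))"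
    by (intro ldet_cong)
  also have "\<dots> = ldet n (hermite_coeff v) * (hankel_gauss v n * ldet n (\<lambda>k j. hermite_coeff v j k))"
    unfolding ldet_mult ldet_scale hankel_gauss_def by (simp add: atLeast0LessThan)
  also have "ldet n (\<lambda>k j. hermite_coeff v j k) = ldet n (hermite_coeff v)"
    by (rule ldet_transpose)
  also have "ldet n (hermite_coeff v) = 1"
    by (subst ldet_lower) (auto simp: hermite_coeff_0 hermite_coeff_def)
  finally show ?thesis by simp
qed

subsection \<open>Asymptotics of the coefficients of the tau function\<close>

lemma gmom_even: "gmom v (2 * m) = gauss_moment v m"
  by (induction m) auto

lemma gmom_odd: "odd k \<Longrightarrow> gmom v k = 0"
  by (induction v k rule: gmom.induct) auto

definition moment_var :: "real \<Rightarrow> complex" where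
  "moment_var \<sigma> = \<sigma> * \<i> / of_real (sqrt 2)"

text \<open>With X centred at the node of \<sigma>, X^k vanishes at that node and
  \<open>[:c, 1:] ^ m\<close> at -c, where the other node lies.\<close>

definition entry :: "real \<Rightarrow> complex \<Rightarrow> nat \<Rightarrow> nat \<Rightarrow> complex \<Rightarrow> complex" where
  "entry \<sigma> c k m z = moment_fun (\<lambda>l. mom \<sigma> l z) (monom 1 k * [:c, 1:] ^ m)"

lemma entry_eq: "entry \<sigma> c k m z = (\<Sum>l\<le>m. coeff ([:c, 1:] ^ m) l * mom \<sigma> (k + l) z)"
  unfolding entry_def moment_fun_monom_mult by (rule moment_fun_eq) (simp add: degree_linear_power')

lemma entry_symb:
  assumes "\<sigma> \<in> {1, -1}"
  shows "symb (- 3 / 2 * real ((k + 1) div 2)) (entry \<sigma> c k m)"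
proof -
  have "symb (- 3 / 2 * real ((k + 1) div 2)) (mom \<sigma> (k + l))" for l
    by (rule symb_le[OF mom_asy(2)[OF assms]]) (simp add: div_le_mono)
  thus ?thesis unfolding entry_eq[abs_def] by (intro symb_sum symb_cmult)
qed

text \<open>Only the constant term \<open>c ^ m\<close> survives: for even \<open>k\<close> any
  further factor X raises the rounded order by at least one and so gains z^(-3/2). For odd
  \<open>k\<close> the first such factor would be free.\<close>

lemma entry_asy:
  assumes s: "\<sigma> \<in> {1, -1}" and k: "even k"
  shows "asy (- 3 / 2 * real ((k + 1) div 2)) (c ^ m * gmom (moment_var \<sigma>) k) (entry \<sigma> c k m)"
proof -
  obtain a where a: "k = 2 * a" using k by blast
  have "asy (- 3 / 2 * real a) (if l = 0 then c ^ m * gmom (moment_var \<sigma>) k else 0)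
      (\<lambda>z. coeff ([:c, 1:] ^ m) l * mom \<sigma> (k + l) z)" for l
  proof (cases "l = 0")
    case True
    thus ?thesis using asy_cmult[OF mom_asy(1)[OF s, of a], of "c ^ m"]
      by (simp add: a gmom_even moment_var_def coeff_0_linear_power)
  next
    case False
    hence "a + 1 \<le> (k + l + 1) div 2" by (simp add: a)
    hence "real (a + 1) \<le> real ((k + l + 1) div 2)" by (simp only: of_nat_le_iff)
    hence "symb (- 3 / 2 * real a - 3 / 2) (mom \<sigma> (k + l))"
      by (intro symb_le[OF mom_asy(2)[OF s]]) simp
    thus ?thesis using False by (auto intro!: asy_0 symb_cmult)
  qed
  hence "asy (- 3 / 2 * real a) (\<Sum>l\<le>m. if l = 0 then c ^ m * gmom (moment_var \<sigma>) k else 0) (entry \<sigma> c k m)"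
    unfolding entry_eq[abs_def] by (intro asy_sum)
  thus ?thesis by (simp add: a)
qed

text \<open>The \<open>i\<close>-th polynomial of the two-node basis vanishes to order \<open>ord_pos p i\<close> at \<open>0\<close> and to order
  \<open>ord_neg p r i\<close> at \<open>-d\<close>; a moment of order \<open>k\<close> at its own node has size \<open>z\<^sup>-\<^sup>3\<^sup>k\<^sup>/\<^sup>4\<close>.\<close>

definition ord_pos :: "nat \<Rightarrow> nat \<Rightarrow> nat" where
  "ord_pos p i = (if i < p then i else p)"

definition ord_neg :: "nat \<Rightarrow> nat \<Rightarrow> nat \<Rightarrow> nat" where
  "ord_neg p r i = (if i < p then r else i - p)"

definition gram_weight :: "nat \<Rightarrow> nat \<Rightarrow> nat" where
  "gram_weight p r = (\<Sum>i<p. i) + (\<Sum>i<r. i)"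

definition choice_weight :: "nat \<Rightarrow> nat \<Rightarrow> nat set \<Rightarrow> nat" where
  "choice_weight p r S = (\<Sum>i=0..<p + r. if i \<in> S then ord_pos p i else ord_neg p r i)"

lemma choice_weight_eq: "choice_weight p r {0..<p} = gram_weight p r"
proof -
  have "choice_weight p r {0..<p} = (\<Sum>i=0..<p. if i < p then ord_pos p i else ord_neg p r i) +
      (\<Sum>i=p..<p + r. if i < p then ord_pos p i else ord_neg p r i)"
    unfolding choice_weight_def by (subst sum.atLeastLessThan_concat) auto
  also have "(\<Sum>i=p..<p + r. if i < p then ord_pos p i else ord_neg p r i) = (\<Sum>i=0..<r. i)"
    using sum.shift_bounds_nat_ivl[of "\<lambda>i. if i < p then ord_pos p i else ord_neg p r i" 0 p r]
    by (simp add: ord_neg_def add.commute)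
  finally show ?thesis by (simp add: gram_weight_def ord_pos_def atLeast0LessThan)
qed

text \<open>Exchanging an index \<open>i < p\<close> against an index \<open>p + j\<close> costs \<open>(r - i) + (p - j) \<ge> 2\<close>.\<close>

lemma choice_weight_ge:
  assumes S: "S \<subseteq> {0..<p + r}" "card S = p" "S \<noteq> {0..<p}"
  shows "choice_weight p r S \<ge> gram_weight p r + 2"
proof -
  define U where "U = {0..<p}"
  define N where "N = {0..<p + r}"
  have fin: "finite S" using S(1) by (rule finite_subset) simp
  define t where "t = card (U - S)"
  have t': "card (S - U) = t"
  proof -
    have "card (U - S) + card (U \<inter> S) = p" "card (S - U) + card (U \<inter> S) = p"
      using card_Int_Diff[of U S] card_Int_Diff[of S U] S fin by (auto simp: U_def Int_commute)
    thus ?thesis by (simp add: t_def)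
  qed
  have t: "t \<ge> 1"
  proof (rule ccontr)
    assume "\<not> t \<ge> 1"
    hence "card (U - S) = 0" "card (S - U) = 0" using t' by (auto simp: t_def)
    moreover have "finite (U - S)" "finite (S - U)" using fin by (auto simp: U_def)
    ultimately have "U - S = {}" "S - U = {}" by (simp_all only: card_0_eq)
    thus False using S(3) by (auto simp: U_def)
  qed
  have "int (choice_weight p r S) - int (choice_weight p r U) =
     (\<Sum>i\<in>N. (if i \<in> S then int (ord_pos p i) else int (ord_neg p r i)) - (if i \<in> U then int (ord_pos p i) else int (ord_neg p r i)))"
  proof -
    have "int (choice_weight p r T) = (\<Sum>i\<in>N. if i \<in> T then int (ord_pos p i) else int (ord_neg p r i))" for T
      unfolding choice_weight_def N_def of_nat_sum by (intro sum.cong) auto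
    thus ?thesis by (simp only: sum_subtractf)
  qed
  \<comment> \<open>Each cost is replaced by a bound independent of the index, so the exchanged
    indices need not be paired: with \<open>t\<close> of them on each side the terms in r - p cancel
    and 2 t remains.\<close>
  also have "\<dots> \<ge> (\<Sum>i\<in>N. (if i \<in> U - S then int r - int p + 1 else 0) + (if i \<in> S - U then int p - int r + 1 else 0))"
    by (rule sum_mono) (auto simp: ord_pos_def ord_neg_def U_def N_def)
  also have "(\<Sum>i\<in>N. (if i \<in> U - S then int r - int p + 1 else 0) + (if i \<in> S - U then int p - int r + 1 else 0)) =
      int t * (int r - int p + 1) + int t * (int p - int r + 1)"
  proof -
    have "N \<inter> (U - S) = U - S" "N \<inter> (S - U) = S - U" using S(1) by (auto simp: N_def U_def)
    moreover have "finite N" by (simp add: N_def)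
    ultimately show ?thesis
      using sum.inter_restrict[of N "\<lambda>_. int r - int p + 1" "U - S"]
        sum.inter_restrict[of N "\<lambda>_. int p - int r + 1" "S - U"]
      by (simp add: sum.distrib t' t_def[symmetric])
  qed
  also have "\<dots> = 2 * int t" by (simp add: algebra_simps)
  finally show ?thesis using t choice_weight_eq[of p r] by (simp add: U_def)
qed

definition entry_order :: "nat \<Rightarrow> nat \<Rightarrow> nat set \<Rightarrow> (nat \<Rightarrow> nat) \<Rightarrow> nat \<Rightarrow> nat" where
  "entry_order p r S \<pi> i = (if i \<in> S then ord_pos p i + ord_pos p (\<pi> i) else ord_neg p r i + ord_neg p r (\<pi> i))"

text \<open>The row orders add up to the weight of \<open>S\<close>, the column orders, reindexed by
  \<open>\<pi>\<close>, to that of its image.\<close>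

lemma sum_entry_order:
  assumes "\<pi> permutes {0..<p + r}"
  shows "(\<Sum>i=0..<p + r. entry_order p r S \<pi> i) = choice_weight p r S + choice_weight p r (\<pi> ` S)"
proof -
  have inj: "\<pi> i \<in> \<pi> ` S \<longleftrightarrow> i \<in> S" for i
    using permutes_inj[OF assms] by (auto dest: injD)
  have "choice_weight p r (\<pi> ` S) = (\<Sum>i=0..<p + r. if \<pi> i \<in> \<pi> ` S then ord_pos p (\<pi> i) else ord_neg p r (\<pi> i))"
    unfolding choice_weight_def
    using sum.permute[OF assms, of "\<lambda>i. if i \<in> \<pi> ` S then ord_pos p i else ord_neg p r i"] by (simp add: o_def)
  thus ?thesis unfolding inj choice_weight_def entry_order_def
    by (simp add: sum.distrib[symmetric] if_distrib cong: if_cong)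
qed

text \<open>There are two ways to exceed the minimum. If \<open>S\<close> or its image is not the
  set of the first \<open>p\<close> indices, the sum of orders grows by 2, hence the halved sum by
  1; an odd order costs more through rounding up.\<close>

lemma entry_cost_ge:
  assumes \<pi>: "\<pi> permutes {0..<p + r}" and S: "S \<subseteq> {0..<p + r}" "card S = p"
    and ne: "\<not> (S = {0..<p} \<and> \<pi> ` S = S \<and> (\<forall>i<p + r. even (entry_order p r S \<pi> i)))"
  shows "(\<Sum>i=0..<p + r. (entry_order p r S \<pi> i + 1) div 2) \<ge> gram_weight p r + 1"
proof -
  define c where "c = (\<Sum>i=0..<p + r. (entry_order p r S \<pi> i + 1) div 2)"
  have S': "\<pi> ` S \<subseteq> {0..<p + r}" "card (\<pi> ` S) = p"
    using S permutes_in_image[OF \<pi>] card_image[OF inj_on_subset[OF permutes_inj[OF \<pi>]], of S] by auto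
  have ge: "choice_weight p r T \<ge> gram_weight p r" if "T \<subseteq> {0..<p + r}" "card T = p" for T
    using choice_weight_ge[OF that] choice_weight_eq[of p r] by (cases "T = {0..<p}") auto
  have le: "(\<Sum>i=0..<p + r. entry_order p r S \<pi> i) \<le> 2 * c"
    unfolding c_def sum_distrib_left by (rule sum_mono) auto
  show ?thesis
  proof (cases "S = {0..<p} \<and> \<pi> ` S = S")
    case True
    then obtain i where i: "i < p + r" "odd (entry_order p r S \<pi> i)" using ne by auto
    have "(\<Sum>i=0..<p + r. entry_order p r S \<pi> i) < (\<Sum>i=0..<p + r. 2 * ((entry_order p r S \<pi> i + 1) div 2))"
    proof (rule sum_strict_mono_ex1)
      show "\<exists>i\<in>{0..<p + r}. entry_order p r S \<pi> i < 2 * ((entry_order p r S \<pi> i + 1) div 2)"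
        using i by (intro bexI[of _ i]) (auto elim!: oddE)
    qed auto
    moreover have "choice_weight p r S = gram_weight p r" "choice_weight p r (\<pi> ` S) = gram_weight p r"
      using True choice_weight_eq[of p r] by metis+
    ultimately have "2 * gram_weight p r < 2 * c"
      unfolding sum_entry_order[OF \<pi>] c_def sum_distrib_left by linarith
    thus ?thesis by (simp add: c_def)
  next
    case False
    hence "choice_weight p r S + choice_weight p r (\<pi> ` S) \<ge> 2 * gram_weight p r + 2"
      using choice_weight_ge[OF S] choice_weight_ge[OF S'] ge[OF S] ge[OF S'] choice_weight_eq[of p r] by (cases "S = {0..<p}") auto
    thus ?thesis using le unfolding sum_entry_order[OF \<pi>] by (simp add: c_def)
  qed
qed

definition gram_pos :: "nat \<Rightarrow> nat \<Rightarrow> complex \<Rightarrow> nat \<Rightarrow> nat \<Rightarrow> complex" where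
  "gram_pos p r z i j = entry 1 (2 * \<i>) (ord_pos p i + ord_pos p j) (ord_neg p r i + ord_neg p r j) z"

definition gram_neg :: "nat \<Rightarrow> nat \<Rightarrow> complex \<Rightarrow> nat \<Rightarrow> nat \<Rightarrow> complex" where
  "gram_neg p r z i j = entry (-1) (- 2 * \<i>) (ord_neg p r i + ord_neg p r j) (ord_pos p i + ord_pos p j) z"

definition gram_lead :: "nat \<Rightarrow> nat \<Rightarrow> nat \<Rightarrow> nat \<Rightarrow> complex" where
  "gram_lead p r i j =
    (if i < p \<and> j < p then (2 * \<i>) ^ (2 * r) * gmom (moment_var 1) (i + j)
     else if p \<le> i \<and> p \<le> j then (- 2 * \<i>) ^ (2 * p) * gmom (moment_var (-1)) (i - p + (j - p)) else 0)"

text \<open>One formula covers all permutations: in the subleading cases with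
  \<open>S = {0..<p}\<close> the product of \<open>gram_lead\<close> vanishes of itself, through an
  odd Gaussian moment or an entry outside the diagonal blocks.\<close>

lemma gram_term_asy:
  assumes \<pi>: "\<pi> permutes {0..<p + r}" and S: "S \<subseteq> {0..<p + r}" "card S = p"
  shows "asy (- 3 / 2 * real (gram_weight p r))
    (if S = {0..<p} then \<Prod>i=0..<p + r. gram_lead p r i (\<pi> i) else 0)
    (\<lambda>z. \<Prod>i=0..<p + r. if i \<in> S then gram_pos p r z i (\<pi> i) else gram_neg p r z i (\<pi> i))"
proof -
  define f where "f = (\<lambda>i z. if i \<in> S then gram_pos p r z i (\<pi> i) else gram_neg p r z i (\<pi> i))"
  define e where "e = (\<lambda>i. entry_order p r S \<pi> i)"
  have fs: "symb (- 3 / 2 * real ((e i + 1) div 2)) (f i)" for i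
    unfolding f_def e_def entry_order_def gram_pos_def gram_neg_def
    using entry_symb[of 1] entry_symb[of "-1"] by auto
  show ?thesis
  proof (cases "S = {0..<p} \<and> \<pi> ` S = S \<and> (\<forall>i<p + r. even (e i))")
    case True
    hence SU: "S = {0..<p}" and \<pi>S: "\<pi> ` S = S" and ev: "\<And>i. i < p + r \<Longrightarrow> even (e i)" by auto
    have \<pi>i: "\<pi> i < p \<longleftrightarrow> i < p" for i
    proof -
      have "\<pi> i \<in> \<pi> ` S \<longleftrightarrow> i \<in> S" using permutes_inj[OF \<pi>] by (auto dest: injD)
      thus ?thesis unfolding \<pi>S by (simp add: SU)
    qed
    have "asy (- 3 / 2 * real ((e i + 1) div 2)) (gram_lead p r i (\<pi> i)) (f i)" if "i \<in> {0..<p + r}" for i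
    proof (cases "i < p")
      case True
      hence iS: "i \<in> S" and \<pi>i': "\<pi> i < p" using \<pi>i[of i] by (auto simp: SU)
      have o: "ord_pos p i + ord_pos p (\<pi> i) = i + \<pi> i" "ord_neg p r i + ord_neg p r (\<pi> i) = 2 * r"
        using True \<pi>i' by (simp_all add: ord_pos_def ord_neg_def)
      have "e i = i + \<pi> i" "f i = entry 1 (2 * \<i>) (i + \<pi> i) (2 * r)"
        using iS by (simp_all add: e_def f_def entry_order_def gram_pos_def o)
      thus ?thesis using entry_asy[of 1 "i + \<pi> i" "2 * \<i>" "2 * r"] ev[of i] that True \<pi>i[of i]
        by (simp add: gram_lead_def)
    next
      case False
      hence iS: "i \<notin> S" and \<pi>i': "\<not> \<pi> i < p" using \<pi>i[of i] by (auto simp: SU)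
      have o: "ord_neg p r i + ord_neg p r (\<pi> i) = i - p + (\<pi> i - p)" "ord_pos p i + ord_pos p (\<pi> i) = 2 * p"
        using False \<pi>i' by (simp_all add: ord_pos_def ord_neg_def)
      have "e i = i - p + (\<pi> i - p)" "f i = entry (-1) (- 2 * \<i>) (i - p + (\<pi> i - p)) (2 * p)"
        using iS by (simp_all add: e_def f_def entry_order_def gram_neg_def o)
      hence "f i = entry (-1) (- 2 * \<i>) (e i) (2 * p)"
        "gram_lead p r i (\<pi> i) = (- 2 * \<i>) ^ (2 * p) * gmom (moment_var (-1)) (e i)"
        using False \<pi>i' by (simp_all only: gram_lead_def) auto
      moreover have "asy (- 3 / 2 * real ((e i + 1) div 2)) ((- 2 * \<i>) ^ (2 * p) * gmom (moment_var (-1)) (e i))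
          (entry (-1) (- 2 * \<i>) (e i) (2 * p))"
        using ev that by (intro entry_asy) auto
      ultimately show ?thesis by (simp only:)
    qed
    hence "asy (\<Sum>i=0..<p + r. - 3 / 2 * real ((e i + 1) div 2)) (\<Prod>i=0..<p + r. gram_lead p r i (\<pi> i)) (\<lambda>z. \<Prod>i=0..<p + r. f i z)"
      by (intro asy_prod) auto
    moreover have "(\<Sum>i=0..<p + r. - 3 / 2 * real ((e i + 1) div 2)) = - 3 / 2 * real (gram_weight p r)"
    proof -
      have "2 * (\<Sum>i=0..<p + r. (e i + 1) div 2) = (\<Sum>i=0..<p + r. e i)"
        unfolding sum_distrib_left using ev by (intro sum.cong) (auto elim!: evenE)
      also have "\<dots> = 2 * gram_weight p r"
        unfolding e_def sum_entry_order[OF \<pi>] \<pi>S using choice_weight_eq[of p r] by (simp add: SU)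
      finally have "(\<Sum>i=0..<p + r. (e i + 1) div 2) = gram_weight p r" by simp
      moreover have "(\<Sum>i=0..<p + r. - 3 / 2 * real ((e i + 1) div 2)) = - 3 / 2 * real (\<Sum>i=0..<p + r. (e i + 1) div 2)"
        by (simp only: of_nat_sum sum_distrib_left)
      ultimately show ?thesis by (simp only:)
    qed
    ultimately show ?thesis using SU by (simp add: f_def)
  next
    case False
    have "gram_weight p r + 1 \<le> (\<Sum>i=0..<p + r. (e i + 1) div 2)"
      using entry_cost_ge[OF \<pi> S] False unfolding e_def by blast
    hence "real (gram_weight p r + 1) \<le> real (\<Sum>i=0..<p + r. (e i + 1) div 2)" by (simp only: of_nat_le_iff)
    moreover have "symb (\<Sum>i=0..<p + r. - 3 / 2 * real ((e i + 1) div 2)) (\<lambda>z. \<Prod>i=0..<p + r. f i z)"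
      by (intro symb_prod fs) auto
    hence "symb (- 3 / 2 * real (\<Sum>i=0..<p + r. (e i + 1) div 2)) (\<lambda>z. \<Prod>i=0..<p + r. f i z)"
      by (simp only: of_nat_sum sum_distrib_left)
    ultimately have "asy (- 3 / 2 * real (gram_weight p r)) 0 (\<lambda>z. \<Prod>i=0..<p + r. f i z)"
      by (intro asy_0) (erule symb_le, simp)
    moreover have "(if S = {0..<p} then \<Prod>i=0..<p + r. gram_lead p r i (\<pi> i) else 0) = 0"
    proof (cases "S = {0..<p}")
      case SU: True
      have "\<exists>i<p + r. gram_lead p r i (\<pi> i) = 0"
      proof (cases "\<pi> ` S = S")
        case True
        have \<pi>i: "\<pi> i < p \<longleftrightarrow> i < p" for i
        proof -
          have "\<pi> i \<in> \<pi> ` S \<longleftrightarrow> i \<in> S" using permutes_inj[OF \<pi>] by (auto dest: injD)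
          thus ?thesis unfolding True by (simp add: SU)
        qed
        obtain i where i: "i < p + r" "odd (e i)" using SU True False by blast
        have "gram_lead p r i (\<pi> i) = 0"
          using i(2) \<pi>i[of i] by (auto simp: gram_lead_def e_def entry_order_def SU ord_pos_def ord_neg_def gmom_odd)
        thus ?thesis using i(1) by blast
      next
        case False
        have "card (\<pi> ` S) = card S" by (rule card_image[OF inj_on_subset[OF permutes_inj[OF \<pi>]]]) simp
        hence "\<not> \<pi> ` S \<subseteq> S" using False card_subset_eq[of S "\<pi> ` S"] by (auto simp: SU)
        then obtain i where "i \<in> S" "\<pi> i \<notin> S" by blast
        hence "i < p" "\<not> \<pi> i < p" by (simp_all add: SU)
        thus ?thesis by (intro exI[of _ i]) (auto simp: gram_lead_def)
      qed
      thus ?thesis by (auto intro!: prod_zero)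
    qed auto
    ultimately show ?thesis by (simp add: f_def)
  qed
qed

lemma ldet_const_mult: "ldet n (\<lambda>i j. c * f i j) = c ^ n * ldet n f"
  using ldet_scale[of n "\<lambda>_. c" "\<lambda>_. 1" f] by simp

lemma ldet_gram_lead:
  "ldet (p + r) (gram_lead p r) = (2 * \<i>) ^ (2 * (p * r)) * (- 2 * \<i>) ^ (2 * (p * r)) *
     (hankel_gauss (moment_var 1) p * hankel_gauss (moment_var (-1)) r)"
proof -
  have "ldet (p + r) (gram_lead p r) = ldet p (gram_lead p r) * ldet r (\<lambda>i j. gram_lead p r (p + i) (p + j))"
    by (rule ldet_block) (auto simp: gram_lead_def)
  also have "ldet p (gram_lead p r) = ldet p (\<lambda>i j. (2 * \<i>) ^ (2 * r) * gmom (moment_var 1) (i + j))"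
    by (rule ldet_cong) (auto simp: gram_lead_def)
  also have "\<dots> = (2 * \<i>) ^ (2 * (p * r)) * hankel_gauss (moment_var 1) p"
    unfolding ldet_const_mult ldet_gmom by (simp only: mult_ac flip: power_mult)
  also have "ldet r (\<lambda>i j. gram_lead p r (p + i) (p + j)) = ldet r (\<lambda>i j. (- 2 * \<i>) ^ (2 * p) * gmom (moment_var (-1)) (i + j))"
    by (rule ldet_cong) (auto simp: gram_lead_def)
  also have "\<dots> = (- 2 * \<i>) ^ (2 * (p * r)) * hankel_gauss (moment_var (-1)) r"
    unfolding ldet_const_mult ldet_gmom by (simp only: mult_ac flip: power_mult)
  finally show ?thesis by (simp add: mult_ac)
qed

lemma mixed_coeff_gram_asy:
  "asy (- 3 / 2 * real (gram_weight p r)) (ldet (p + r) (gram_lead p r))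
     (\<lambda>z. mixed_coeff (p + r) p (gram_pos p r z) (gram_neg p r z))"
proof -
  define F where "F = {S \<in> Pow {0..<p + r}. card S = p}"
  have fin: "finite F" "{0..<p} \<in> F" by (auto simp: F_def)
  have "asy (- 3 / 2 * real (gram_weight p r))
    (\<Sum>S\<in>F. \<Sum>\<pi>\<in>{\<pi>. \<pi> permutes {0..<p + r}}. signof \<pi> * (if S = {0..<p} then \<Prod>i=0..<p + r. gram_lead p r i (\<pi> i) else 0))
    (\<lambda>z. mixed_coeff (p + r) p (gram_pos p r z) (gram_neg p r z))"
    unfolding mixed_coeff_def ldet_def F_def
    by (intro asy_sum asy_cmult gram_term_asy) auto
  also have "(\<Sum>S\<in>F. \<Sum>\<pi>\<in>{\<pi>. \<pi> permutes {0..<p + r}}. signof \<pi> * (if S = {0..<p} then \<Prod>i=0..<p + r. gram_lead p r i (\<pi> i) else 0))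
     = (\<Sum>S\<in>F. if S = {0..<p} then ldet (p + r) (gram_lead p r) else 0)"
    by (intro sum.cong refl) (auto simp: ldet_def)
  also have "\<dots> = ldet (p + r) (gram_lead p r)" using fin by (simp add: sum.delta')
  finally show ?thesis .
qed

section \<open>Back to the original Hankel pencil\<close>

definition hank :: "real \<Rightarrow> complex \<Rightarrow> nat \<Rightarrow> complex" where
  "hank \<sigma> z k = moment_fun (\<lambda>l. mom \<sigma> l z) ([:\<sigma> * \<i>, 1:] ^ k)"

text \<open>One functional represents the whole pencil in the coordinate centred at i. In the
  two-node basis its Gram matrix is the adapted pencil; in powers of X + i, the uncentred variable,
  it is the Hankel pencil.\<close>

lemma mixed_coeff_change_basis:
  "mixed_coeff (p + r) p (gram_pos p r z) (gram_neg p r z) =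
     (2 * \<i>) ^ (2 * (p * r)) * mixed_coeff (p + r) p (\<lambda>i j. hank 1 z (i + j)) (\<lambda>i j. hank (-1) z (i + j))"
proof (rule mixed_coeff_eqI)
  fix a :: complex
  \<comment> \<open>The coordinate centred at i is the one centred at -i minus 2 i, whence the
    composition.\<close>
  define L where "L = (\<lambda>q. a * moment_fun (\<lambda>l. mom 1 l z) q + moment_fun (\<lambda>l. mom (-1) l z) (q \<circ>\<^sub>p [:- 2 * \<i>, 1:]))"
  have L: "L (p + q) = L p + L q" "L (Polynomial.smult c p) = c * L p" for p q c
    by (simp_all add: L_def moment_fun_add moment_fun_smult pcompose_add pcompose_smult algebra_simps)
  define P where "P = two_node_basis (2 * \<i>) p r"
  have PP: "P i * P j = monom 1 (ord_pos p i + ord_pos p j) * [:2 * \<i>, 1:] ^ (ord_neg p r i + ord_neg p r j)" for i j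
  proof -
    have "P i = monom 1 (ord_pos p i) * [:2 * \<i>, 1:] ^ ord_neg p r i" for i
      by (simp add: P_def two_node_basis_def ord_pos_def ord_neg_def)
    hence "P i * P j = (monom 1 (ord_pos p i) * monom 1 (ord_pos p j)) *
        ([:2 * \<i>, 1:] ^ ord_neg p r i * [:2 * \<i>, 1:] ^ ord_neg p r j)"
      by (simp only: mult_ac)
    thus ?thesis by (simp only: mult_monom power_add mult_1)
  qed
  have pw: "q ^ k \<circ>\<^sub>p s = (q \<circ>\<^sub>p s) ^ k" for q s :: "complex poly" and k
    by (induction k) (auto simp: pcompose_mult pcompose_1)
  have mono: "monom 1 k \<circ>\<^sub>p q = q ^ k" for q :: "complex poly" and k
    by (induction k) (auto simp: monom_0 monom_Suc pcompose_pCons pcompose_1 simp flip: one_pCons)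
  have xk: "[:0, 1 :: complex:] ^ k = monom 1 k" for k
    by (simp add: monom_altdef)
  have lin: "[:2 * \<i>, 1:] \<circ>\<^sub>p [:- 2 * \<i>, 1:] = [:0, 1:]"
    by (simp add: pcompose_pCons)
  have "L (P i * P j) = a * gram_pos p r z i j + gram_neg p r z i j" for i j
    unfolding PP L_def gram_pos_def gram_neg_def entry_def pcompose_mult pw mono lin xk
    by (simp only: mult.commute)
  hence "ldet (p + r) (\<lambda>i j. a * gram_pos p r z i j + gram_neg p r z i j) = ldet (p + r) (\<lambda>i j. L (P i * P j))"
    by simp
  also have "\<dots> = ((2 * \<i>) ^ (p * r))\<^sup>2 * ldet (p + r) (\<lambda>i j. L (monom 1 (i + j)))"
    by (subst gram_ldet[OF L]) (auto simp: P_def ldet_two_node_basis degree_two_node_basis)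
  \<comment> \<open>Passing from monomials to powers of X + i has determinant 1.\<close>
  also have "ldet (p + r) (\<lambda>i j. L (monom 1 (i + j))) = ldet (p + r) (\<lambda>i j. L ([:\<i>, 1:] ^ i * [:\<i>, 1:] ^ j))"
    by (subst gram_ldet[OF L]) (auto simp: ldet_shift_basis degree_linear_power')
  also have "(\<lambda>i j. L ([:\<i>, 1:] ^ i * [:\<i>, 1:] ^ j)) = (\<lambda>i j. a * hank 1 z (i + j) + hank (-1) z (i + j))"
    by (simp add: fun_eq_iff L_def hank_def pw pcompose_pCons flip: power_add)
  finally show "ldet (p + r) (\<lambda>i j. a * gram_pos p r z i j + gram_neg p r z i j) =
     (2 * \<i>) ^ (2 * (p * r)) * ldet (p + r) (\<lambda>i j. a * hank 1 z (i + j) + hank (-1) z (i + j))"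
    by (simp only: mult.commute flip: power_mult)
qed simp

definition tau_coeff :: "nat \<Rightarrow> nat \<Rightarrow> complex \<Rightarrow> complex" where
  "tau_coeff p r z = mixed_coeff (p + r) p (\<lambda>i j. hank 1 z (i + j)) (\<lambda>i j. hank (-1) z (i + j))"

text \<open>In \<open>ldet_gram_lead\<close> each pair of rows at different nodes carries the
  squares of 2 i and of -2 i; the change of basis divides by the first and leaves -4.\<close>

definition tau_lead :: "nat \<Rightarrow> nat \<Rightarrow> complex" where
  "tau_lead p r = (- 4) ^ (p * r) * (hankel_gauss (moment_var 1) p * hankel_gauss (moment_var (-1)) r)"

lemma tau_coeff_asy: "asy (- 3 / 2 * real (gram_weight p r)) (tau_lead p r) (tau_coeff p r)"
proof -
  define d where "d = (2 * \<i>) ^ (2 * (p * r))"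
  have d: "d \<noteq> 0" by (simp add: d_def)
  have "asy (- 3 / 2 * real (gram_weight p r)) (1 / d * ldet (p + r) (gram_lead p r))
     (\<lambda>z. 1 / d * mixed_coeff (p + r) p (gram_pos p r z) (gram_neg p r z))"
    by (intro asy_cmult mixed_coeff_gram_asy)
  moreover have "1 / d * ldet (p + r) (gram_lead p r) = tau_lead p r"
    unfolding ldet_gram_lead d_def[symmetric] tau_lead_def using d
    by (simp add: power_mult power_mult_distrib)
  moreover have "(\<lambda>z. 1 / d * mixed_coeff (p + r) p (gram_pos p r z) (gram_neg p r z)) = tau_coeff p r"
    unfolding mixed_coeff_change_basis d_def[symmetric] tau_coeff_def using d by (simp add: fun_eq_iff)
  ultimately show ?thesis by simp
qed

section \<open>Derivatives of the seed function and the expansion of tau\<close>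

lemma airy_amp_deriv_amp:
  assumes s: "\<sigma> \<in> {1, -1}" and z: "Re z > 0"
  shows "(amp \<sigma> k has_field_derivative amp \<sigma> (Suc k) z - \<sigma> * \<i> * of_nat k * om' z * amp \<sigma> (k - 1) z) (at z)"
proof -
  have "\<exists>m. symb m (amp \<sigma> k)"
    using amp_asy[OF s, of "k div 2"] by (cases "even k") (auto elim!: evenE oddE dest: asy_symb)
  then obtain m where "symb m (amp \<sigma> k)" by blast
  hence "amp \<sigma> k holomorphic_on {z. Re z > 0}" by (rule symb_holomorphic)
  hence "(amp \<sigma> k has_field_derivative deriv (amp \<sigma> k) z) (at z)"
    using z by (intro holomorphic_derivI[of _ "{z. Re z > 0}"]) (auto simp: open_halfspace_Re_gt)
  thus ?thesis by simp
qed

text \<open>The functional \<open>t\<^sup>j (t - \<sigma> i \<omega>)\<^sup>k\<close>, where multiplication by \<open>t\<close> stands for the derivative.\<close>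

fun wave :: "real \<Rightarrow> nat \<Rightarrow> nat \<Rightarrow> complex \<Rightarrow> complex" where
  "wave \<sigma> 0 k = (\<lambda>z. exp (\<sigma> * \<i> * airy_chi z) * amp \<sigma> k z)"
| "wave \<sigma> (Suc j) k = (\<lambda>z. \<sigma> * \<i> * om z * wave \<sigma> j k z + wave \<sigma> j (Suc k) z)"

text \<open>Differentiation multiplies by t and also moves the node. When \<open>j\<close>
  increases, the \<open>om'\<close> coming from the explicit factor \<open>om\<close> makes up the
  difference between the counts k + 1 and k. At \<open>k = 0\<close> the moving term is absent, so
  the functions \<open>wave \<sigma> j 0\<close> are successive derivatives.\<close>

lemma wave_deriv:
  assumes s: "\<sigma> \<in> {1, -1}" and z: "Re z > 0"
  shows "(wave \<sigma> j k has_field_derivative wave \<sigma> (Suc j) k z - \<sigma> * \<i> * of_nat k * om' z * wave \<sigma> j (k - 1) z) (at z)"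
proof (induction j arbitrary: k)
  case 0
  have "((\<lambda>z. exp (\<sigma> * \<i> * airy_chi z)) has_field_derivative exp (\<sigma> * \<i> * airy_chi z) * (\<sigma> * \<i> * om z)) (at z)"
    by (auto intro!: derivative_eq_intros airy_chi_deriv z)
  from DERIV_mult[OF this airy_amp_deriv_amp[OF s z, of k]]
  have "(wave \<sigma> 0 k has_field_derivative exp (\<sigma> * \<i> * airy_chi z) * (\<sigma> * \<i> * om z) * amp \<sigma> k z +
      (amp \<sigma> (Suc k) z - \<sigma> * \<i> * of_nat k * om' z * amp \<sigma> (k - 1) z) * exp (\<sigma> * \<i> * airy_chi z)) (at z)"
    by (simp only: wave.simps)
  also have "exp (\<sigma> * \<i> * airy_chi z) * (\<sigma> * \<i> * om z) * amp \<sigma> k z +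
      (amp \<sigma> (Suc k) z - \<sigma> * \<i> * of_nat k * om' z * amp \<sigma> (k - 1) z) * exp (\<sigma> * \<i> * airy_chi z) =
      wave \<sigma> (Suc 0) k z - \<sigma> * \<i> * of_nat k * om' z * wave \<sigma> 0 (k - 1) z"
    by (simp only: wave.simps) (simp only: algebra_simps)
  finally show ?case .
next
  case (Suc j)
  have "((\<lambda>z. \<sigma> * \<i> * om z * wave \<sigma> j k z + wave \<sigma> j (Suc k) z) has_field_derivative
     (\<sigma> * \<i> * om' z * wave \<sigma> j k z + (wave \<sigma> (Suc j) k z - \<sigma> * \<i> * of_nat k * om' z * wave \<sigma> j (k - 1) z) * (\<sigma> * \<i> * om z)) +
     (wave \<sigma> (Suc j) (Suc k) z - \<sigma> * \<i> * of_nat (Suc k) * om' z * wave \<sigma> j k z)) (at z)"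
    using Suc[of k] Suc[of "Suc k"] by (intro DERIV_add DERIV_mult DERIV_cmult om_deriv z) simp_all
  also have "(\<sigma> * \<i> * om' z * wave \<sigma> j k z + (wave \<sigma> (Suc j) k z - \<sigma> * \<i> * of_nat k * om' z * wave \<sigma> j (k - 1) z) * (\<sigma> * \<i> * om z)) +
     (wave \<sigma> (Suc j) (Suc k) z - \<sigma> * \<i> * of_nat (Suc k) * om' z * wave \<sigma> j k z) =
     wave \<sigma> (Suc (Suc j)) k z - \<sigma> * \<i> * of_nat k * om' z * wave \<sigma> (Suc j) (k - 1) z"
  proof (cases k)
    case (Suc l)
    have "wave \<sigma> (Suc j) (k - 1) z = \<sigma> * \<i> * om z * wave \<sigma> j (k - 1) z + wave \<sigma> j k z"
      by (simp add: Suc)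
    moreover have "wave \<sigma> (Suc (Suc j)) k z = \<sigma> * \<i> * om z * wave \<sigma> (Suc j) k z + wave \<sigma> (Suc j) (Suc k) z"
      by simp
    ultimately show ?thesis by (simp only: of_nat_Suc) (simp only: algebra_simps mult_1_left mult_1_right)
  qed simp
  finally show ?case by (simp only: wave.simps)
qed

lemma wave_eq:
  assumes z: "Re z > 0"
  shows "wave \<sigma> j k z = exp (\<sigma> * \<i> * airy_chi z) * z powr of_real (- 1 / 4) * om z ^ (j + k) *
    moment_fun (\<lambda>l. mom \<sigma> l z) ([:\<sigma> * \<i>, 1:] ^ j * monom 1 k)"
proof (induction j arbitrary: k)
  case 0
  have "moment_fun (\<lambda>l. mom \<sigma> l z) (monom 1 k * 1) = mom \<sigma> k z"
    unfolding moment_fun_monom_mult by (simp add: moment_fun_def)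
  moreover have "om z \<noteq> 0" by (rule om_nz[OF z])
  moreover have "z powr of_real (- 1 / 4) * z powr of_real (1 / 4) = 1"
    using z by (auto simp flip: powr_add)
  ultimately show ?case by (simp add: mom_def)
next
  case (Suc j)
  have "[:\<sigma> * \<i>, 1:] ^ Suc j * monom 1 k =
      Polynomial.smult (\<sigma> * \<i>) ([:\<sigma> * \<i>, 1:] ^ j * monom 1 k) + [:\<sigma> * \<i>, 1:] ^ j * monom 1 (Suc k)"
    by (simp add: monom_Suc algebra_simps)
  thus ?case by (simp only: wave.simps Suc moment_fun_add moment_fun_smult) (simp add: algebra_simps)
qed

lemma higher_deriv_airy_phi:
  obtains K where "K \<noteq> 0" "\<And>C1 C2 j z. Re z > 0 \<Longrightarrow> (deriv ^^ j) (airy_phi C1 C2) z =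
    K * ((C2 - \<i> * C1) * wave 1 j 0 z + (C2 + \<i> * C1) * wave (-1) j 0 z)"
proof -
  obtain K where K: "K \<noteq> 0" "\<And>C1 C2 z. Re z > 0 \<Longrightarrow> airy_phi C1 C2 z =
    K * ((C2 - \<i> * C1) * exp (\<i> * airy_chi z) * airy_amp 1 z + (C2 + \<i> * C1) * exp (- \<i> * airy_chi z) * airy_amp (-1) z)"
    by (rule airy_phi_decomposition) blast
  have "(deriv ^^ j) (airy_phi C1 C2) z = K * ((C2 - \<i> * C1) * wave 1 j 0 z + (C2 + \<i> * C1) * wave (-1) j 0 z)"
    if "Re z > 0" for C1 C2 j z
    using that
  proof (induction j arbitrary: z)
    case 0
    thus ?case using K(2)[OF 0] by (simp add: mult.assoc)
  next
    case (Suc j)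
    have "((\<lambda>z. K * ((C2 - \<i> * C1) * wave 1 j 0 z + (C2 + \<i> * C1) * wave (-1) j 0 z)) has_field_derivative
      K * ((C2 - \<i> * C1) * wave 1 (Suc j) 0 z + (C2 + \<i> * C1) * wave (-1) (Suc j) 0 z)) (at z)"
      using wave_deriv[of 1 z j 0] wave_deriv[of "-1" z j 0] Suc.prems
      by (intro DERIV_cmult DERIV_add) simp_all
    hence "((deriv ^^ j) (airy_phi C1 C2) has_field_derivative
      K * ((C2 - \<i> * C1) * wave 1 (Suc j) 0 z + (C2 + \<i> * C1) * wave (-1) (Suc j) 0 z)) (at z)"
      by (rule has_field_derivative_transform_within_open[of _ _ _ "{z. Re z > 0}"])
        (use Suc in \<open>auto simp: open_halfspace_Re_gt\<close>)
    thus ?case by (simp add: DERIV_imp_deriv)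
  qed
  with K(1) show ?thesis using that by blast
qed

text \<open>\<open>k\<close> counts the rows taken from the solution with phase \<open>exp (\<i> \<chi>)\<close>.\<close>

lemma tau_expansion:
  obtains K where "K \<noteq> 0" "\<And>C1 C2 n z. Re z > 0 \<Longrightarrow> tau C1 C2 n z =
    K ^ n * z powr of_real (- real n / 4) * om z ^ (n * (n - 1)) *
    (\<Sum>k\<le>n. (C2 - \<i> * C1) ^ k * (C2 + \<i> * C1) ^ (n - k) * exp (\<i> * of_real (2 * real k - real n) * airy_chi z) * tau_coeff k (n - k) z)"
proof -
  obtain K where K: "K \<noteq> 0" "\<And>C1 C2 j z. Re z > 0 \<Longrightarrow> (deriv ^^ j) (airy_phi C1 C2) z =
    K * ((C2 - \<i> * C1) * wave 1 j 0 z + (C2 + \<i> * C1) * wave (-1) j 0 z)"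
    by (rule higher_deriv_airy_phi) blast
  have "tau C1 C2 n z =
    K ^ n * z powr of_real (- real n / 4) * om z ^ (n * (n - 1)) *
    (\<Sum>k\<le>n. (C2 - \<i> * C1) ^ k * (C2 + \<i> * C1) ^ (n - k) * exp (\<i> * of_real (2 * real k - real n) * airy_chi z) * tau_coeff k (n - k) z)"
    if z: "Re z > 0" for C1 C2 n z
  proof -
    define a where "a = (C2 - \<i> * C1) * exp (\<i> * airy_chi z)"
    define b where "b = (C2 + \<i> * C1) * exp (- \<i> * airy_chi z)"
    have "tau C1 C2 n z = ldet n (\<lambda>i j. (deriv ^^ (i + j)) (airy_phi C1 C2) z)"
      unfolding tau_def ldet_eq_det ..
    \<comment> \<open>The power of \<open>om\<close> with exponent i + j splits into a row and a
      column factor; the constants and z^(-1/4) go into the rows.\<close>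
    also have "\<dots> = ldet n (\<lambda>i j. (K * z powr of_real (- 1 / 4) * om z ^ i) * om z ^ j * (a * hank 1 z (i + j) + b * hank (-1) z (i + j)))"
    proof (rule ldet_cong)
      fix i j
      have "wave \<sigma> (i + j) 0 z = exp (\<sigma> * \<i> * airy_chi z) * z powr of_real (- 1 / 4) * om z ^ (i + j) * hank \<sigma> z (i + j)" for \<sigma>
        unfolding wave_eq[OF z] hank_def by (simp add: monom_0 one_pCons[symmetric])
      thus "(deriv ^^ (i + j)) (airy_phi C1 C2) z =
          (K * z powr of_real (- 1 / 4) * om z ^ i) * om z ^ j * (a * hank 1 z (i + j) + b * hank (-1) z (i + j))"
        unfolding K(2)[OF z] by (simp add: a_def b_def power_add algebra_simps)
    qed
    also have "\<dots> = (\<Prod>i=0..<n. K * z powr of_real (- 1 / 4) * om z ^ i) * (\<Prod>i=0..<n. om z ^ i) *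
        (\<Sum>k\<le>n. a ^ k * b ^ (n - k) * mixed_coeff n k (\<lambda>i j. hank 1 z (i + j)) (\<lambda>i j. hank (-1) z (i + j)))"
      unfolding ldet_scale ldet_pencil ..
    also have "(\<Prod>i=0..<n. K * z powr of_real (- 1 / 4) * om z ^ i) * (\<Prod>i=0..<n. om z ^ i) =
        K ^ n * (z powr of_real (- 1 / 4)) ^ n * (\<Prod>i=0..<n. om z ^ i) ^ 2"
      by (simp add: prod.distrib power2_eq_square power_mult_distrib)
    also have "(\<Prod>i=0..<n. om z ^ i) ^ 2 = om z ^ (n * (n - 1))"
    proof -
      have "(\<Prod>i=0..<n. om z ^ i) = om z ^ (\<Sum>i=0..<n. i)" by (simp add: power_sum)
      moreover have "(\<Sum>i=0..<n. i) * 2 = n * (n - 1)" 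
      proof (induction n)
        case (Suc n)
        thus ?case by (cases n) (auto simp: algebra_simps)
      qed simp
      ultimately show ?thesis by (simp flip: power_mult)
    qed
    also have "(z powr of_real (- 1 / 4)) ^ n = z powr of_real (- real n / 4)"
      using z by (auto simp: powr_def mult_ac simp flip: exp_of_nat_mult)
    also have "(\<Sum>k\<le>n. a ^ k * b ^ (n - k) * mixed_coeff n k (\<lambda>i j. hank 1 z (i + j)) (\<lambda>i j. hank (-1) z (i + j))) =
       (\<Sum>k\<le>n. (C2 - \<i> * C1) ^ k * (C2 + \<i> * C1) ^ (n - k) * exp (\<i> * of_real (2 * real k - real n) * airy_chi z) * tau_coeff k (n - k) z)"
    proof (rule sum.cong)
      fix k assume "k \<in> {..n}"
      hence k: "k \<le> n" by simp
      have "exp (\<i> * airy_chi z) ^ k * exp (- \<i> * airy_chi z) ^ (n - k) =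
          exp (of_nat k * (\<i> * airy_chi z) + of_nat (n - k) * (- \<i> * airy_chi z))"
        by (simp only: exp_add exp_of_nat_mult)
      also have "of_nat k * (\<i> * airy_chi z) + of_nat (n - k) * (- \<i> * airy_chi z) = \<i> * of_real (2 * real k - real n) * airy_chi z"
        using k by (simp add: of_nat_diff algebra_simps)
      finally have e: "exp (\<i> * airy_chi z) ^ k * exp (- \<i> * airy_chi z) ^ (n - k) = exp (\<i> * of_real (2 * real k - real n) * airy_chi z)" .
      show "a ^ k * b ^ (n - k) * mixed_coeff n k (\<lambda>i j. hank 1 z (i + j)) (\<lambda>i j. hank (-1) z (i + j)) =
        (C2 - \<i> * C1) ^ k * (C2 + \<i> * C1) ^ (n - k) * exp (\<i> * of_real (2 * real k - real n) * airy_chi z) * tau_coeff k (n - k) z"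
        unfolding e[symmetric] tau_coeff_def a_def b_def power_mult_distrib using k by (simp add: mult_ac)
    qed simp
    finally show ?thesis .
  qed
  with K(1) show ?thesis using that by blast
qed

subsection \<open>The oscillatory leading terms\<close>

text \<open>The link between the given sums and the expansion of tau: \<open>b_coeff\<close> is its
  part even in \<open>C1\<close>, and \<open>d_coeff\<close> is i times its odd part.\<close>

definition phase_coeff :: "complex \<Rightarrow> complex \<Rightarrow> nat \<Rightarrow> nat \<Rightarrow> complex" where
  "phase_coeff C1 C2 n r = (C2 - \<i> * C1) ^ (n - r) * (C2 + \<i> * C1) ^ r"

text \<open>Krawtchouk numbers: the coefficient of x^m in (1 - x)^(n - r) (1 + x)^r.\<close>

definition conv_coeff :: "nat \<Rightarrow> nat \<Rightarrow> nat \<Rightarrow> complex" where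
  "conv_coeff n r m = (\<Sum>q = m - r..min m (n - r). (- 1) ^ q * of_nat (r choose (m - q)) * of_nat ((n - r) choose q))"

lemma coeff_linear_power: "coeff ([:a, b:] ^ n) i = of_nat (n choose i) * b ^ i * a ^ (n - i)"
  for a b :: complex
proof (cases "i \<le> n")
  case False
  have "degree ([:a, b:] ^ n) \<le> degree [:a, b:] * n" by (rule degree_power_le)
  also have "\<dots> \<le> 1 * n" by (intro mult_right_mono) auto
  finally show ?thesis using False by (simp add: coeff_eq_0 binomial_eq_0)
qed (rule coeff_linear_poly_power)

text \<open>The polynomial \<open>P\<close> attaches a marker to \<open>C1\<close>: its coefficients
  separate the powers of \<open>C1\<close>, and its value at 1 is the product.\<close>

lemma phase_coeff_expand:
  assumes "r \<le> n"
  shows "phase_coeff C1 C2 n r = (\<Sum>m\<le>n. \<i> ^ m * C1 ^ m * C2 ^ (n - m) * conv_coeff n r m)"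
proof -
  define P where "P = [:C2, - \<i> * C1:] ^ (n - r) * [:C2, \<i> * C1:] ^ r"
  have "degree P \<le> degree ([:C2, - \<i> * C1:] ^ (n - r)) + degree ([:C2, \<i> * C1:] ^ r)"
    unfolding P_def by (rule degree_mult_le)
  also have "\<dots> \<le> (n - r) + r"
    by (intro add_mono order_trans[OF degree_power_le]) auto
  finally have deg: "degree P \<le> n" using assms by simp
  have "phase_coeff C1 C2 n r = poly P 1"
    by (simp add: P_def phase_coeff_def)
  also have "\<dots> = (\<Sum>m\<le>n. coeff P m)"
    unfolding poly_altdef using deg by (intro sum.mono_neutral_cong_left) (auto simp: coeff_eq_0)
  also have "\<dots> = (\<Sum>m\<le>n. \<i> ^ m * C1 ^ m * C2 ^ (n - m) * conv_coeff n r m)"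
  proof (rule sum.cong)
    fix m assume "m \<in> {..n}"
    hence m: "m \<le> n" by simp
    define f where "f = (\<lambda>q. of_nat ((n - r) choose q) * (- \<i> * C1) ^ q * C2 ^ (n - r - q) *
        (of_nat (r choose (m - q)) * (\<i> * C1) ^ (m - q) * C2 ^ (r - (m - q))))"
    have "coeff P m = (\<Sum>q\<le>m. f q)"
      unfolding P_def coeff_mult f_def coeff_linear_power by simp
    also have "\<dots> = (\<Sum>q = m - r..min m (n - r). f q)"
      by (rule sum.mono_neutral_right) (auto simp: f_def binomial_eq_0)
    also have "\<dots> = (\<Sum>q = m - r..min m (n - r). \<i> ^ m * C1 ^ m * C2 ^ (n - m) *
        ((- 1) ^ q * of_nat (r choose (m - q)) * of_nat ((n - r) choose q)))"
    proof (rule sum.cong)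
      fix q assume "q \<in> {m - r..min m (n - r)}"
      hence q: "q \<le> m" "q \<le> n - r" "m - q \<le> r" by auto
      have 1: "C2 ^ (n - r - q) * C2 ^ (r - (m - q)) = C2 ^ (n - m)"
        using q m assms by (simp flip: power_add)
      have "(- \<i> * C1) ^ q = (- 1) ^ q * (\<i> * C1) ^ q"
        by (metis mult_minus_left power_minus)
      moreover have "(\<i> * C1) ^ q * (\<i> * C1) ^ (m - q) = \<i> ^ m * C1 ^ m"
        using q by (simp flip: power_add power_mult_distrib)
      ultimately have 2: "(- \<i> * C1) ^ q * (\<i> * C1) ^ (m - q) = (- 1) ^ q * (\<i> ^ m * C1 ^ m)"
        by (simp only: mult.assoc)
      have "f q = of_nat ((n - r) choose q) * of_nat (r choose (m - q)) *
          ((- \<i> * C1) ^ q * (\<i> * C1) ^ (m - q)) * (C2 ^ (n - r - q) * C2 ^ (r - (m - q)))"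
        unfolding f_def by (simp only: mult_ac)
      thus "f q = \<i> ^ m * C1 ^ m * C2 ^ (n - m) * ((- 1) ^ q * of_nat (r choose (m - q)) * of_nat ((n - r) choose q))"
        unfolding 1 2 by (simp only: mult_ac)
    qed simp
    finally show "coeff P m = \<i> ^ m * C1 ^ m * C2 ^ (n - m) * conv_coeff n r m"
      by (simp add: conv_coeff_def sum_distrib_left)
  qed simp
  finally show ?thesis .
qed

lemma sum_even: "(\<Sum>m\<le>n. if even m then g m else 0) = (\<Sum>p = 0..n div 2. g (2 * p :: nat))"
  for g :: "nat \<Rightarrow> 'a::comm_monoid_add"
proof -
  have "(\<Sum>m\<le>n. if even m then g m else 0) = (\<Sum>m\<in>{m \<in> {..n}. even m}. g m)"
    by (rule sum.inter_filter[symmetric]) simp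
  also have "\<dots> = (\<Sum>p = 0..n div 2. g (2 * p))"
    by (rule sum.reindex_bij_witness[of _ "\<lambda>p. 2 * p" "\<lambda>m. m div 2"]) auto
  finally show ?thesis .
qed

lemma sum_odd: "n \<ge> 1 \<Longrightarrow> (\<Sum>m\<le>n. if odd m then g m else 0) = (\<Sum>p = 0..(n - 1) div 2. g (2 * p + 1 :: nat))"
  for g :: "nat \<Rightarrow> 'a::comm_monoid_add"
proof -
  assume n: "n \<ge> 1"
  have "(\<Sum>m\<le>n. if odd m then g m else 0) = (\<Sum>m\<in>{m \<in> {..n}. odd m}. g m)"
    by (rule sum.inter_filter[symmetric]) simp
  also have "\<dots> = (\<Sum>p = 0..(n - 1) div 2. g (2 * p + 1))"
  proof (rule sum.reindex_bij_witness[of _ "\<lambda>p. 2 * p + 1" "\<lambda>m. m div 2"])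
    fix m assume "m \<in> {m \<in> {..n}. odd m}"
    thus "m div 2 \<in> {0..(n - 1) div 2}" by (auto elim!: oddE)
  qed (use n in auto)
  finally show ?thesis .
qed

lemma phase_coeff_minus:
  "r \<le> n \<Longrightarrow> phase_coeff (- C1) C2 n r = phase_coeff C1 C2 n (n - r)"
  by (simp add: phase_coeff_def mult.commute)

lemma b_coeff_eq:
  assumes "r \<le> n"
  shows "b_coeff C1 C2 n r = (phase_coeff C1 C2 n r + phase_coeff C1 C2 n (n - r)) / 2"
proof -
  have "(phase_coeff C1 C2 n r + phase_coeff (- C1) C2 n r) / 2 =
      (\<Sum>m\<le>n. if even m then \<i> ^ m * C1 ^ m * C2 ^ (n - m) * conv_coeff n r m else 0)"
    unfolding phase_coeff_expand[OF assms] sum.distrib[symmetric] sum_divide_distrib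
    by (intro sum.cong refl) (auto simp: power_minus_odd)
  also have "\<dots> = (\<Sum>p = 0..n div 2. \<i> ^ (2 * p) * C1 ^ (2 * p) * C2 ^ (n - 2 * p) * conv_coeff n r (2 * p))"
    by (rule sum_even)
  also have "\<dots> = b_coeff C1 C2 n r"
  proof -
    have "nat \<lfloor>real n / 2\<rfloor> = n div 2" by linarith
    thus ?thesis unfolding b_coeff_def conv_coeff_def by (simp add: power_mult)
  qed
  finally show ?thesis using phase_coeff_minus[OF assms] by simp
qed

lemma d_coeff_eq:
  assumes "r \<le> n" "n \<ge> 1"
  shows "d_coeff C1 C2 n r = \<i> * (phase_coeff C1 C2 n r - phase_coeff C1 C2 n (n - r)) / 2"
proof -
  have "\<i> * (phase_coeff C1 C2 n r - phase_coeff (- C1) C2 n r) / 2 =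
      (\<Sum>m\<le>n. if odd m then \<i> * \<i> ^ m * C1 ^ m * C2 ^ (n - m) * conv_coeff n r m else 0)"
    unfolding phase_coeff_expand[OF assms(1)] sum_subtractf[symmetric] sum_divide_distrib sum_distrib_left
    by (intro sum.cong refl) (auto simp: power_minus_odd)
  also have "\<dots> = (\<Sum>p = 0..(n - 1) div 2. \<i> * \<i> ^ (2 * p + 1) * C1 ^ (2 * p + 1) * C2 ^ (n - (2 * p + 1)) * conv_coeff n r (2 * p + 1))"
    by (rule sum_odd[OF assms(2)])
  also have "\<dots> = d_coeff C1 C2 n r"
  proof -
    have 1: "nat (\<lceil>real n / 2\<rceil> - 1) = (n - 1) div 2" using assms(2) by linarith
    \<comment> \<open>At p = 0 the exponent is -1, hence the integer power; both sides equal (-1)^(p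
      + 1).\<close>
    have 2: "(- 1 :: complex) powi (int p - 1) = \<i> * \<i> ^ (2 * p + 1)" for p
      by (simp add: power_int_diff power_mult)
    show ?thesis unfolding d_coeff_def conv_coeff_def 1 2 by simp
  qed
  finally show ?thesis using phase_coeff_minus[OF assms(1)] by simp
qed

lemma cos_sin_cis: "complex_of_real (cos t) = (cis t + cis (- t)) / 2" "complex_of_real (sin t) = - \<i> * (cis t - cis (- t)) / 2"
  by (auto simp: complex_eq_iff)

lemma osc_cs_eq:
  assumes "r \<le> n" "n \<ge> 1"
  shows "osc_cs C1 C2 n r x = (phase_coeff C1 C2 n r * cis (psi n r x) + phase_coeff C1 C2 n (n - r) * cis (- psi n r x)) / 2"
proof -
  define X Y where "X = phase_coeff C1 C2 n r" and "Y = phase_coeff C1 C2 n (n - r)"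
  have "(X + Y) / 2 * ((u + v) / 2) + \<i> * (X - Y) / 2 * (- \<i> * (u - v) / 2) = (X * u + Y * v) / 2" for u v
  proof -
    have "\<i> * (X - Y) / 2 * (- \<i> * (u - v) / 2) = - (\<i> * \<i>) * ((X - Y) * (u - v)) / 4"
      by (simp only: mult_ac times_divide_eq_left times_divide_eq_right) simp
    also have "\<dots> = (X - Y) * (u - v) / 4" by simp
    finally have "\<i> * (X - Y) / 2 * (- \<i> * (u - v) / 2) = (X - Y) * (u - v) / 4" .
    thus ?thesis by (simp add: field_simps)
  qed
  thus ?thesis unfolding osc_cs_def b_coeff_eq[OF assms(1)] d_coeff_eq[OF assms] cos_sin_cis X_def Y_def .
qed

lemma osc_sc_eq:
  assumes "r \<le> n" "n \<ge> 1"
  shows "osc_sc C1 C2 n r x = - \<i> * (phase_coeff C1 C2 n r * cis (psi n r x) - phase_coeff C1 C2 n (n - r) * cis (- psi n r x)) / 2"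
proof -
  define X Y where "X = phase_coeff C1 C2 n r" and "Y = phase_coeff C1 C2 n (n - r)"
  have "(X + Y) / 2 * (- \<i> * (u - v) / 2) - \<i> * (X - Y) / 2 * ((u + v) / 2) = - \<i> * (X * u - Y * v) / 2" for u v
    by (simp add: field_simps)
  thus ?thesis unfolding osc_sc_def b_coeff_eq[OF assms(1)] d_coeff_eq[OF assms] cos_sin_cis X_def Y_def .
qed

lemma phase_coeff_nz:
  assumes "C1\<^sup>2 + C2\<^sup>2 \<noteq> 0"
  shows "C2 - \<i> * C1 \<noteq> 0" "C2 + \<i> * C1 \<noteq> 0" "phase_coeff C1 C2 n r \<noteq> 0"
proof -
  have "(C2 - \<i> * C1) * (C2 + \<i> * C1) = C1\<^sup>2 + C2\<^sup>2"
    by (simp add: algebra_simps power2_eq_square)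
  with assms show 1: "C2 - \<i> * C1 \<noteq> 0" "C2 + \<i> * C1 \<noteq> 0" by auto
  thus "phase_coeff C1 C2 n r \<noteq> 0" by (simp add: phase_coeff_def)
qed

section \<open>Lower bounds away from the poles\<close>

text \<open>By compactness, since the modulus of the function is \<open>\<pi>\<close>-periodic.\<close>

lemma wave_lower_bound:
  fixes X Y :: complex
  assumes "\<delta> > 0"
  obtains c where "c > 0" "\<And>t. (\<And>t'. X * cis t' + Y * cis (- t') = 0 \<Longrightarrow> \<delta> \<le> \<bar>t - t'\<bar>) \<Longrightarrow> c \<le> norm (X * cis t + Y * cis (- t))"
proof -
  define f where "f = (\<lambda>t. X * cis t + Y * cis (- t))"
  have per: "norm (f (t + of_int m * pi)) = norm (f t)" for t m
  proof -
    have "sin (of_int m * pi) = 0" by (subst sin_zero_iff_int2) auto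
    hence "cis (of_int m * pi) = cis (- (of_int m * pi))"
      by (auto simp: complex_eq_iff)
    hence "f (t + of_int m * pi) = f t * cis (of_int m * pi)"
      unfolding f_def minus_add_distrib cis_mult[symmetric] by (simp add: algebra_simps)
    thus ?thesis by (simp add: norm_mult)
  qed
  have cont: "continuous_on UNIV f" unfolding f_def by (intro continuous_intros)
  \<comment> \<open>Phases in one period that keep distance \<delta> from every zero, including
    zeros outside the period. The set may be empty, for example if both coefficients vanish; then
    any c will do.\<close>
  define K where "K = {0..pi} \<inter> (\<Inter>t'\<in>{t'. f t' = 0}. {t. \<delta> \<le> \<bar>t - t'\<bar>})"
  have "compact K"
    unfolding K_def by (intro compact_Int_closed closed_INT ballI closed_Collect_le continuous_intros) auto
  have "\<exists>c>0. \<forall>t\<in>K. c \<le> norm (f t)"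
  proof (cases "K = {}")
    case False
    have "continuous_on K (\<lambda>t. norm (f t))"
      by (intro continuous_on_norm continuous_on_subset[OF cont]) auto
    from continuous_attains_inf[OF \<open>compact K\<close> False this]
    obtain t where t: "t \<in> K" "\<And>u. u \<in> K \<Longrightarrow> norm (f t) \<le> norm (f u)" by blast
    have "f t \<noteq> 0" using t(1) assms by (auto simp: K_def)
    thus ?thesis using t by (intro exI[of _ "norm (f t)"]) auto
  qed (auto intro: exI[of _ 1])
  then obtain c where c: "c > 0" "\<And>t. t \<in> K \<Longrightarrow> c \<le> norm (f t)" by blast
  have "c \<le> norm (f t)" if far: "\<And>t'. f t' = 0 \<Longrightarrow> \<delta> \<le> \<bar>t - t'\<bar>" for t
  proof -
    define m where "m = \<lfloor>t / pi\<rfloor>"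
    define u where "u = t + of_int (- m) * pi"
    have "of_int m \<le> t / pi" "t / pi < of_int m + 1" unfolding m_def by linarith+
    hence "of_int m * pi \<le> t" "t < (of_int m + 1) * pi" by (simp_all add: field_simps)
    hence "u \<in> {0..pi}" by (simp add: u_def algebra_simps)
    moreover have "\<delta> \<le> \<bar>u - t'\<bar>" if "f t' = 0" for t'
    proof -
      have "f (t' + of_int m * pi) = 0" using per[of t' m] that by simp
      from far[OF this] show ?thesis by (simp add: u_def algebra_simps)
    qed
    ultimately have "u \<in> K" by (auto simp: K_def)
    from c(2)[OF this] show ?thesis using per[of t "- m"] by (simp add: u_def)
  qed
  with c(1) show ?thesis using that unfolding f_def by blast
qed

lemma psi_surj:
  assumes "n - 2 * r = 1" "2 * r < n" "t > real n * pi / 4"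
  obtains w where "w > 0" "psi n r w = t"
proof -
  have r: "real n - 2 * real r = 1" using assms by linarith
  define u where "u = (t - real n * pi / 4) * 3 / sqrt 2"
  have u: "u > 0" using assms(3) unfolding u_def by (intro divide_pos_pos mult_pos_pos) auto
  have "(u powr (2 / 3)) powr (3 / 2) = u" using u by (simp add: powr_powr)
  hence "psi n r (u powr (2 / 3)) = sqrt 2 * u / 3 + real n * pi / 4" by (simp add: psi_def r)
  also have "sqrt 2 * u / 3 = t - real n * pi / 4" by (simp add: u_def)
  finally show ?thesis using that[of "u powr (2 / 3)"] u by simp
qed

lemma psi_at_top:
  assumes "2 * r < n"
  shows "filterlim (psi n r) at_top at_top"
proof -
  have c: "real n - 2 * real r > 0" using assms by linarith
  have "filterlim (\<lambda>z::real. z powr (3 / 2)) at_top at_top" by real_asymp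
  hence "filterlim (\<lambda>z::real. (sqrt 2 / 3) * z powr (3 / 2)) at_top at_top"
    by (intro filterlim_tendsto_pos_mult_at_top[OF tendsto_const]) auto
  hence "filterlim (\<lambda>z::real. real n * pi / 4 + (sqrt 2 / 3) * z powr (3 / 2)) at_top at_top"
    by (intro filterlim_tendsto_add_at_top[OF tendsto_const])
  hence "filterlim (\<lambda>z::real. (real n - 2 * real r) * (real n * pi / 4 + (sqrt 2 / 3) * z powr (3 / 2))) at_top at_top"
    using c by (intro filterlim_tendsto_pos_mult_at_top[OF tendsto_const]) auto
  also have "(\<lambda>z::real. (real n - 2 * real r) * (real n * pi / 4 + (sqrt 2 / 3) * z powr (3 / 2))) = psi n r"
    by (simp add: psi_def fun_eq_iff algebra_simps)
  finally show ?thesis .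
qed

lemma at_top_away_le: "at_top_away \<delta> \<psi> P \<le> at_top"
  by (simp add: at_top_away_def)

text \<open>The filter controls only poles w > 0, whose phases exceed n pi / 4. Zeros at smaller
  phases correspond to no such w, but are left behind once the phase exceeds n pi / 4 +
  \<delta>.\<close>

lemma osc_cs_lower_bound:
  assumes "n = 2 * r + 1" "\<delta> > 0"
  obtains c where "c > 0"
    "eventually (\<lambda>x. c \<le> norm (osc_cs C1 C2 n r x)) (at_top_away \<delta> (psi n r) (osc_poles C1 C2 n r))"
proof -
  define X Y where "X = phase_coeff C1 C2 n r" and "Y = phase_coeff C1 C2 n (n - r)"
  have osc: "osc_cs C1 C2 n r x = (X * cis (psi n r x) + Y * cis (- psi n r x)) / 2" for x
    using osc_cs_eq[of r n C1 C2 x] assms(1) by (simp add: X_def Y_def)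
  obtain c where c: "c > 0" "\<And>t. (\<And>t'. X * cis t' + Y * cis (- t') = 0 \<Longrightarrow> \<delta> \<le> \<bar>t - t'\<bar>) \<Longrightarrow> c \<le> norm (X * cis t + Y * cis (- t))"
    by (rule wave_lower_bound[OF assms(2), of X Y]) blast
  have "eventually (\<lambda>x. psi n r x \<ge> real n * pi / 4 + \<delta>) at_top"
    using psi_at_top[of r n] assms(1) by (auto simp: filterlim_at_top)
  hence 1: "eventually (\<lambda>x. psi n r x \<ge> real n * pi / 4 + \<delta>) (at_top_away \<delta> (psi n r) (osc_poles C1 C2 n r))"
    using at_top_away_le by (rule filter_leD[rotated])
  have 2: "eventually (\<lambda>x. \<forall>w\<in>osc_poles C1 C2 n r. \<delta> \<le> \<bar>psi n r x - psi n r w\<bar>) (at_top_away \<delta> (psi n r) (osc_poles C1 C2 n r))"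
    unfolding at_top_away_def eventually_inf_principal by simp
  have "eventually (\<lambda>x. c / 2 \<le> norm (osc_cs C1 C2 n r x)) (at_top_away \<delta> (psi n r) (osc_poles C1 C2 n r))"
    using 1 2
  proof eventually_elim
    case (elim x)
    have "c \<le> norm (X * cis (psi n r x) + Y * cis (- psi n r x))"
    proof (rule c(2))
      fix t' assume t': "X * cis t' + Y * cis (- t') = 0"
      show "\<delta> \<le> \<bar>psi n r x - t'\<bar>"
      proof (cases "t' > real n * pi / 4")
        case True
        then obtain w where w: "w > 0" "psi n r w = t'"
          using psi_surj[of n r t'] assms(1) by auto
        hence "w \<in> osc_poles C1 C2 n r" using t' by (simp add: osc_poles_def osc)
        with elim(2) w show ?thesis by auto
      qed (use elim(1) in auto)
    qed
    thus ?case by (simp add: osc norm_divide)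
  qed
  with c(1) show ?thesis using that[of "c / 2"] by simp
qed

subsection \<open>Oscillating symbols\<close>

text \<open>The exponentials grow off the real axis, so their products with symbols are not symbols.
  In these finite sums with real frequencies each exponential is differentiated exactly, and only
  the amplitudes need Cauchy's inequality.\<close>

inductive osym :: "real \<Rightarrow> (complex \<Rightarrow> complex) \<Rightarrow> bool" for m where
  mode: "symb m v \<Longrightarrow> (\<And>z. Re z > 0 \<Longrightarrow> f z = exp (\<i> * of_real \<mu> * airy_chi z) * v z) \<Longrightarrow> osym m f"
| add: "osym m f \<Longrightarrow> osym m g \<Longrightarrow> (\<And>z. Re z > 0 \<Longrightarrow> h z = f z + g z) \<Longrightarrow> osym m h"

lemma osym_symb: "symb m f \<Longrightarrow> osym m f"
  by (rule osym.mode[of m f f 0]) auto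

lemma osym_le: "osym m f \<Longrightarrow> m \<le> m' \<Longrightarrow> osym m' f"
  by (induction rule: osym.induct) (auto intro: osym.intros symb_le)

lemma osym_add: "osym m f \<Longrightarrow> osym m g \<Longrightarrow> osym m (\<lambda>z. f z + g z)"
  by (rule osym.add) auto

lemma osym_cmult: "osym m f \<Longrightarrow> osym m (\<lambda>z. c * f z)"
proof (induction rule: osym.induct)
  case (mode v f \<mu>)
  show ?case by (rule osym.mode[OF symb_cmult[OF mode(1), of c], of _ \<mu>]) (simp add: mode)
next
  case (add f g h)
  show ?case by (rule osym.add[OF add.IH]) (simp add: add algebra_simps)
qed

lemma osym_sum: "(\<And>i. i \<in> I \<Longrightarrow> osym m (f i)) \<Longrightarrow> osym m (\<lambda>z. \<Sum>i\<in>I. f i z)"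
  by (induction I rule: infinite_finite_induct) (auto intro: osym_symb symb_0 osym_add)

lemma airy_chi_holomorphic: "airy_chi holomorphic_on {z. Re z > 0}"
  using airy_chi_deriv by (intro holomorphic_onI) (auto simp: field_differentiable_def intro: has_field_derivative_at_within)

lemma osym_holomorphic: "osym m f \<Longrightarrow> f holomorphic_on {z. Re z > 0}"
proof (induction rule: osym.induct)
  case (mode v f \<mu>)
  have "(\<lambda>z. exp (\<i> * of_real \<mu> * airy_chi z) * v z) holomorphic_on {z. Re z > 0}"
    using mode(1) by (intro holomorphic_intros airy_chi_holomorphic symb_holomorphic)
  thus ?case by (rule holomorphic_transform) (simp add: mode)
next
  case (add f g h)
  have "(\<lambda>z. f z + g z) holomorphic_on {z. Re z > 0}" by (intro holomorphic_intros add)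
  thus ?case by (rule holomorphic_transform) (simp add: add)
qed

lemma holomorphic_right_deriv:
  "f holomorphic_on {z. Re z > 0} \<Longrightarrow> Re z > 0 \<Longrightarrow> (f has_field_derivative deriv f z) (at z)"
  by (intro holomorphic_derivI[of _ "{z. Re z > 0}"]) (auto simp: open_halfspace_Re_gt)

lemma deriv_cong_right:
  assumes "\<And>z. Re z > 0 \<Longrightarrow> f z = g z" "Re z > 0" "(g has_field_derivative D) (at z)"
  shows "(f has_field_derivative D) (at z)"
  by (rule has_field_derivative_transform_within_open[OF assms(3), of "{z. Re z > 0}"])
    (use assms in \<open>auto simp: open_halfspace_Re_gt\<close>)

lemma om_symb: "symb (1 / 2) om"
  unfolding om_def by (intro symb_cmult symb_powr)

text \<open>The loss of 1/2 comes from \<open>om\<close>; the derivative of the amplitude is smaller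
  by 3/2.\<close>

lemma osym_deriv: "osym m f \<Longrightarrow> osym (m + 1 / 2) (deriv f)"
proof (induction rule: osym.induct)
  case (mode v f \<mu>)
  have "symb (m + 1 / 2) (\<lambda>z. \<i> * of_real \<mu> * (om z * v z) + deriv v z)"
  proof (intro symb_add symb_cmult)
    show "symb (m + 1 / 2) (\<lambda>z. om z * v z)"
      using symb_mult[OF om_symb mode(1)] by (simp add: add.commute)
    show "symb (m + 1 / 2) (deriv v)" by (rule symb_le[OF symb_deriv[OF mode(1)]]) simp
  qed
  moreover have "deriv f z = exp (\<i> * of_real \<mu> * airy_chi z) * (\<i> * of_real \<mu> * (om z * v z) + deriv v z)"
    if z: "Re z > 0" for z
  proof -
    have "(v has_field_derivative deriv v z) (at z)"
      using symb_holomorphic[OF mode(1)] z by (rule holomorphic_right_deriv)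
    hence "((\<lambda>z. exp (\<i> * of_real \<mu> * airy_chi z) * v z) has_field_derivative
        exp (\<i> * of_real \<mu> * airy_chi z) * (\<i> * of_real \<mu> * (om z * v z) + deriv v z)) (at z)"
      by (auto intro!: derivative_eq_intros airy_chi_deriv z simp: algebra_simps)
    from deriv_cong_right[OF mode(2) z this] show ?thesis by (rule DERIV_imp_deriv)
  qed
  ultimately show ?case by (rule osym.mode)
next
  case (add f g h)
  show ?case
  proof (rule osym.add[OF add.IH])
    fix z :: complex assume z: "Re z > 0"
    have "((\<lambda>z. f z + g z) has_field_derivative deriv f z + deriv g z) (at z)"
      by (intro DERIV_add holomorphic_right_deriv osym_holomorphic[OF add.hyps(1)] osym_holomorphic[OF add.hyps(2)] z)
    from deriv_cong_right[OF add(3) z this]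
    show "deriv h z = deriv f z + deriv g z" by (rule DERIV_imp_deriv)
  qed
qed

section \<open>Pure modes and bounds on the real axis\<close>

definition chi_real :: "real \<Rightarrow> real" where
  "chi_real x = sqrt 2 * x powr (3 / 2) / 3 + pi / 4"

lemma airy_chi_of_real: "x > 0 \<Longrightarrow> airy_chi (of_real x) = of_real (chi_real x)"
proof -
  assume x: "x > 0"
  have "sqrt x ^ 3 = x powr (3 / 2)"
    using x by (simp add: powr_half_sqrt[symmetric] powr_power)
  hence "complex_of_real (sqrt x) ^ 3 = of_real (x powr (3 / 2))" by (simp only: flip: of_real_power)
  thus ?thesis using x by (simp add: airy_chi_def chi_real_def csqrt_of_real_nonneg)
qed

definition mode :: "real \<Rightarrow> real \<Rightarrow> complex \<Rightarrow> complex" where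
  "mode \<mu> a z = exp (\<i> * of_real \<mu> * airy_chi z) * z powr of_real a"

lemma mode_osym: "osym a (mode \<mu> a)"
  unfolding mode_def by (rule osym.mode[where \<mu> = \<mu>, OF symb_powr]) simp

lemma mode_of_real: "x > 0 \<Longrightarrow> mode \<mu> a (of_real x) = cis (\<mu> * chi_real x) * of_real (x powr a)"
  by (simp add: mode_def airy_chi_of_real cis_conv_exp powr_of_real mult.assoc)

lemma mode_deriv:
  assumes z: "Re z > 0"
  shows "(mode \<mu> a has_field_derivative \<i> * of_real (\<mu> / sqrt 2) * mode \<mu> (a + 1 / 2) z + of_real a * mode \<mu> (a - 1) z) (at z)"
proof -
  have nr: "z \<notin> \<real>\<^sub>\<le>\<^sub>0" using z by (auto simp: complex_nonpos_Reals_iff)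
  have p: "((\<lambda>z. z powr of_real a) has_field_derivative of_real a * z powr (of_real a - 1)) (at z)"
    using has_field_derivative_powr[OF nr, of "of_real a"] by simp
  have e: "((\<lambda>z. exp (\<i> * of_real \<mu> * airy_chi z)) has_field_derivative exp (\<i> * of_real \<mu> * airy_chi z) * (\<i> * of_real \<mu> * om z)) (at z)"
    by (auto intro!: derivative_eq_intros airy_chi_deriv z)
  have "om z * z powr of_real a = of_real (1 / sqrt 2) * z powr of_real (a + 1 / 2)"
    by (simp add: om_def powr_add mult_ac)
  moreover have "exp (\<i> * of_real \<mu> * airy_chi z) * (\<i> * of_real \<mu> * om z) * z powr of_real a +
      of_real a * z powr (of_real a - 1) * exp (\<i> * of_real \<mu> * airy_chi z) =
      \<i> * of_real \<mu> * exp (\<i> * of_real \<mu> * airy_chi z) * (om z * z powr of_real a) +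
      of_real a * (exp (\<i> * of_real \<mu> * airy_chi z) * z powr (of_real a - 1))"
    by (simp only: mult_ac)
  ultimately have "exp (\<i> * of_real \<mu> * airy_chi z) * (\<i> * of_real \<mu> * om z) * z powr of_real a +
      of_real a * z powr (of_real a - 1) * exp (\<i> * of_real \<mu> * airy_chi z) =
      \<i> * of_real (\<mu> / sqrt 2) * mode \<mu> (a + 1 / 2) z + of_real a * mode \<mu> (a - 1) z"
    by (simp add: mode_def)
  with DERIV_mult[OF e p] show ?thesis unfolding mode_def[abs_def] by simp
qed

lemma mode_deriv_osym:
  "osym (a - 1) (\<lambda>z. deriv (mode \<mu> a) z - \<i> * of_real (\<mu> / sqrt 2) * mode \<mu> (a + 1 / 2) z)"
proof -
  have "osym (a - 1) (\<lambda>z. of_real a * mode \<mu> (a - 1) z)" by (intro osym_cmult mode_osym)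
  thus ?thesis
    by (rule osym.add[OF _ osym_symb[OF symb_0[of "a - 1"]]]) (simp add: DERIV_imp_deriv[OF mode_deriv])
qed

lemma osym_bigo:
  assumes "osym m f" "F \<le> at_top"
  shows "(\<lambda>x. f (of_real x)) \<in> O[F](\<lambda>x. complex_of_real (x powr m))"
proof -
  have "(\<lambda>x. f (of_real x)) \<in> O[at_top](\<lambda>x. complex_of_real (x powr m))"
    using assms(1)
  proof (induction rule: osym.induct)
    case (mode v f \<mu>)
    have "eventually (\<lambda>x. norm (f (of_real x)) = norm (v (of_real x))) at_top"
      using eventually_gt_at_top[of 0]
      by eventually_elim (simp add: mode(2) airy_chi_of_real norm_mult)
    moreover obtain c where "eventually (\<lambda>x. norm (v (of_real x)) \<le> c * norm (complex_of_real (x powr m))) at_top"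
      using symb_bigo[OF mode(1)] by (auto elim: landau_o.bigE)
    ultimately have "eventually (\<lambda>x. norm (f (of_real x)) \<le> c * norm (complex_of_real (x powr m))) at_top"
      by eventually_elim simp
    thus ?case by (rule bigoI)
  next
    case (add f g h)
    have "(\<lambda>x. f (of_real x) + g (of_real x)) \<in> O[at_top](\<lambda>x. complex_of_real (x powr m))"
      by (intro sum_in_bigo add.IH)
    moreover have "eventually (\<lambda>x. h (of_real x) = f (of_real x) + g (of_real x)) at_top"
      using eventually_gt_at_top[of 0] by eventually_elim (simp add: add)
    ultimately show ?case by (subst landau_o.big.in_cong)
  qed
  thus ?thesis using assms(2) by (rule landau_o.big.filter_mono[rotated])
qed

subsection \<open>Quotients\<close>

lemma powr_bigo_mult:
  assumes "f \<in> O[F](\<lambda>x. complex_of_real (x powr a))" "g \<in> O[F](\<lambda>x. complex_of_real (x powr b))"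
  shows "(\<lambda>x. f x * g x) \<in> O[F](\<lambda>x. complex_of_real (x powr (a + b)))"
  using landau_o.big.mult[OF assms] by (simp add: powr_add)

lemma powr_bigo_le:
  assumes "f \<in> O[F](\<lambda>x. complex_of_real (x powr a))" "a \<le> b" "F \<le> at_top"
  shows "f \<in> O[F](\<lambda>x. complex_of_real (x powr b))"
proof -
  have "(\<lambda>x. complex_of_real (x powr a)) \<in> O[at_top](\<lambda>x. complex_of_real (x powr b))"
  proof (rule bigoI[of _ 1])
    show "eventually (\<lambda>x. norm (complex_of_real (x powr a)) \<le> 1 * norm (complex_of_real (x powr b))) at_top"
      using eventually_ge_at_top[of 1] by eventually_elim (use assms(2) in \<open>auto intro: powr_mono\<close>)
  qed
  hence "(\<lambda>x. complex_of_real (x powr a)) \<in> O[F](\<lambda>x. complex_of_real (x powr b))"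
    using assms(3) by (rule landau_o.big.filter_mono[rotated])
  thus ?thesis using assms(1) by (rule landau_o.big_trans[rotated])
qed

text \<open>The difference of quotients is (N - N0)/T - N0 (T - T0)/(T T0), and both reciprocals are
  bounded once \<open>T0\<close> stays away from zero. Any filter below \<open>at_top\<close> is
  allowed, so the estimate serves with and without excluded neighbourhoods.\<close>

lemma quotient_asymp:
  fixes T T0 :: "real \<Rightarrow> complex"
  assumes F: "F \<le> at_top" and T: "(\<lambda>x. T x - T0 x) \<in> O[F](\<lambda>x. complex_of_real (x powr (- 3 / 2)))"
    and c: "c > 0" "eventually (\<lambda>x. c \<le> norm (T0 x)) F"
  shows "eventually (\<lambda>x. T x \<noteq> 0) F"
    and "N0 \<in> O[F](\<lambda>x. complex_of_real (x powr a)) \<Longrightarrow>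
      (\<lambda>x. N x - N0 x) \<in> O[F](\<lambda>x. complex_of_real (x powr (a - 3 / 2))) \<Longrightarrow>
      (\<lambda>x. N x / T x - N0 x / T0 x) \<in> O[F](\<lambda>x. complex_of_real (x powr (a - 3 / 2))) \<and>
      (\<lambda>x. N0 x / T0 x) \<in> O[F](\<lambda>x. complex_of_real (x powr a))"
proof -
  have "((\<lambda>x::real. x powr (- 3 / 2)) \<longlongrightarrow> 0) at_top" by real_asymp
  hence "((\<lambda>x::real. x powr (- 3 / 2)) \<longlongrightarrow> 0) F" using F by (rule tendsto_mono[rotated])
  hence lim: "((\<lambda>x. complex_of_real (x powr (- 3 / 2))) \<longlongrightarrow> 0) F" by (auto intro: tendsto_eq_intros)
  obtain K where K: "K > 0" "eventually (\<lambda>x. norm (T x - T0 x) \<le> K * norm (complex_of_real (x powr (- 3 / 2)))) F"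
    using T by (auto elim: landau_o.bigE)
  have "((\<lambda>x. K * norm (complex_of_real (x powr (- 3 / 2)))) \<longlongrightarrow> K * norm (0::complex)) F"
    by (intro tendsto_intros lim)
  hence "eventually (\<lambda>x. K * norm (complex_of_real (x powr (- 3 / 2))) < c / 2) F"
    using c(1) by (auto dest: order_tendstoD(2)[where a = "c / 2"])
  with K(2) c(2) have low: "eventually (\<lambda>x. c / 2 \<le> norm (T x)) F"
  proof eventually_elim
    case (elim x)
    thus ?case using norm_triangle_sub[of "T0 x" "T x"] by (simp add: norm_minus_commute)
  qed
  thus nz: "eventually (\<lambda>x. T x \<noteq> 0) F" by eventually_elim (use c(1) in auto)
  have pos: "eventually (\<lambda>x::real. x > 0) F" using eventually_gt_at_top F by (rule filter_leD[rotated])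
  have inv: "(\<lambda>x. 1 / S x) \<in> O[F](\<lambda>x. complex_of_real (x powr 0))"
    if "eventually (\<lambda>x. d \<le> norm (S x)) F" "d > 0" for S :: "real \<Rightarrow> complex" and d
  proof (rule bigoI[of _ "1 / d"])
    show "eventually (\<lambda>x. norm (1 / S x) \<le> 1 / d * norm (complex_of_real (x powr 0))) F"
      using that(1) pos by eventually_elim (use that(2) in \<open>auto simp: norm_divide intro!: divide_left_mono mult_pos_pos\<close>)
  qed
  have iT: "(\<lambda>x. 1 / T x) \<in> O[F](\<lambda>x. complex_of_real (x powr 0))" using inv[OF low] c(1) by simp
  have iT0: "(\<lambda>x. 1 / T0 x) \<in> O[F](\<lambda>x. complex_of_real (x powr 0))" using inv[OF c(2) c(1)] .
  assume N0: "N0 \<in> O[F](\<lambda>x. complex_of_real (x powr a))"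
    and N: "(\<lambda>x. N x - N0 x) \<in> O[F](\<lambda>x. complex_of_real (x powr (a - 3 / 2)))"
  have 1: "(\<lambda>x. (N x - N0 x) * (1 / T x)) \<in> O[F](\<lambda>x. complex_of_real (x powr (a - 3 / 2)))"
    using powr_bigo_mult[OF N iT] by simp
  have 2: "(\<lambda>x. N0 x * (T x - T0 x) * (1 / T x) * (1 / T0 x)) \<in> O[F](\<lambda>x. complex_of_real (x powr (a - 3 / 2)))"
    using powr_bigo_mult[OF powr_bigo_mult[OF powr_bigo_mult[OF N0 T] iT] iT0] by simp
  have "(\<lambda>x. (N x - N0 x) * (1 / T x) - N0 x * (T x - T0 x) * (1 / T x) * (1 / T0 x)) \<in> O[F](\<lambda>x. complex_of_real (x powr (a - 3 / 2)))"
    using 1 2 by (rule sum_in_bigo)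
  moreover have "eventually (\<lambda>x. N x / T x - N0 x / T0 x = (N x - N0 x) * (1 / T x) - N0 x * (T x - T0 x) * (1 / T x) * (1 / T0 x)) F"
    using nz c(2)
  proof eventually_elim
    case (elim x)
    hence "T x \<noteq> 0" "T0 x \<noteq> 0" using c(1) by auto
    thus ?case by (simp add: divide_simps) (simp add: algebra_simps)
  qed
  ultimately have "(\<lambda>x. N x / T x - N0 x / T0 x) \<in> O[F](\<lambda>x. complex_of_real (x powr (a - 3 / 2)))"
    by (subst landau_o.big.in_cong)
  moreover have "(\<lambda>x. N0 x / T0 x) \<in> O[F](\<lambda>x. complex_of_real (x powr a))"
    using powr_bigo_mult[OF N0 iT0] by simp
  ultimately show "(\<lambda>x. N x / T x - N0 x / T0 x) \<in> O[F](\<lambda>x. complex_of_real (x powr (a - 3 / 2))) \<and>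
      (\<lambda>x. N0 x / T0 x) \<in> O[F](\<lambda>x. complex_of_real (x powr a))" by blast
qed

subsection \<open>The normalized tau function\<close>

text \<open>Here \<open>b\<close> will be the least weight that occurs, so that the dominant terms
  have size 1; the power of z split off from tau contributes a multiple of 1/z to the logarithmic
  derivative.\<close>

definition tau_norm :: "complex \<Rightarrow> complex \<Rightarrow> nat \<Rightarrow> nat \<Rightarrow> complex \<Rightarrow> complex" where
  "tau_norm C1 C2 n b z = (\<Sum>k\<le>n. (C2 - \<i> * C1) ^ k * (C2 + \<i> * C1) ^ (n - k) *
     exp (\<i> * of_real (2 * real k - real n) * airy_chi z) * (z powr of_real (3 / 2 * real b) * tau_coeff k (n - k) z))"

lemma tau_eq_tau_norm:
  obtains c where "c \<noteq> 0" "\<And>z. Re z > 0 \<Longrightarrow> tau C1 C2 n z =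
    c * z powr of_real (real n * (real n - 1) / 2 - real n / 4 - 3 / 2 * real b) * tau_norm C1 C2 n b z"
proof -
  obtain K where K: "K \<noteq> 0" "\<And>C1 C2 n z. Re z > 0 \<Longrightarrow> tau C1 C2 n z =
    K ^ n * z powr of_real (- real n / 4) * om z ^ (n * (n - 1)) *
    (\<Sum>k\<le>n. (C2 - \<i> * C1) ^ k * (C2 + \<i> * C1) ^ (n - k) * exp (\<i> * of_real (2 * real k - real n) * airy_chi z) * tau_coeff k (n - k) z)"
    by (rule tau_expansion) blast
  define c where "c = K ^ n * of_real (1 / sqrt 2) ^ (n * (n - 1))"
  have "tau C1 C2 n z = c * z powr of_real (real n * (real n - 1) / 2 - real n / 4 - 3 / 2 * real b) * tau_norm C1 C2 n b z"
    if z: "Re z > 0" for z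
  proof -
    define S where "S = (\<Sum>k\<le>n. (C2 - \<i> * C1) ^ k * (C2 + \<i> * C1) ^ (n - k) * exp (\<i> * of_real (2 * real k - real n) * airy_chi z) * tau_coeff k (n - k) z)"
    have N: "tau_norm C1 C2 n b z = z powr of_real (3 / 2 * real b) * S"
      unfolding tau_norm_def S_def sum_distrib_left by (intro sum.cong refl) (simp only: mult_ac)
    have z0: "z \<noteq> 0" using z by auto
    have "om z ^ (n * (n - 1)) = of_real (1 / sqrt 2) ^ (n * (n - 1)) * z powr of_real (real (n * (n - 1)) / 2)"
    proof -
      have "(z powr of_real (1 / 2)) ^ (n * (n - 1)) = z powr of_real (real (n * (n - 1)) / 2)"
        using z0 by (auto simp: powr_def simp flip: exp_of_nat_mult)
      thus ?thesis unfolding om_def power_mult_distrib by (simp only:)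
    qed
    moreover have "real (n * (n - 1)) = real n * (real n - 1)" by (cases n) (auto simp: algebra_simps)
    ultimately have "tau C1 C2 n z = c * (z powr of_real (- real n / 4) * z powr of_real (real n * (real n - 1) / 2)) * S"
      unfolding K(2)[OF z] c_def S_def by (simp only: mult_ac)
    also have "z powr of_real (- real n / 4) * z powr of_real (real n * (real n - 1) / 2) =
        z powr of_real (real n * (real n - 1) / 2 - real n / 4 - 3 / 2 * real b) * z powr of_real (3 / 2 * real b)"
      by (simp flip: powr_add of_real_add)
    finally show ?thesis unfolding N by (simp only: mult_ac)
  qed
  moreover have "c \<noteq> 0" using K(1) by (simp add: c_def)
  ultimately show ?thesis using that by blast
qed

lemma gram_weight_eq: "2 * int (gram_weight p r) = int p * (int p - 1) + int r * (int r - 1)"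
proof -
  have *: "2 * int (\<Sum>i<n. i) = int n * (int n - 1)" for n
    by (induction n) (auto simp: algebra_simps)
  have "2 * int (gram_weight p r) = 2 * int (\<Sum>i<p. i) + 2 * int (\<Sum>i<r. i)"
    by (simp only: gram_weight_def of_nat_add distrib_left)
  thus ?thesis unfolding * .
qed

text \<open>\<open>j\<close> is the excess over the weight \<open>b\<close>. The third version, for
  the middle term without oscillation, records the remainder as a plain symbol, whose derivative
  gains z^(-1) instead of losing z^(1/2).\<close>

lemma tau_norm_term:
  fixes C1 C2 :: complex and n k b :: nat
  defines "f \<equiv> \<lambda>z. (C2 - \<i> * C1) ^ k * (C2 + \<i> * C1) ^ (n - k) *
     exp (\<i> * of_real (2 * real k - real n) * airy_chi z) * (z powr of_real (3 / 2 * real b) * tau_coeff k (n - k) z)"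
  assumes j: "gram_weight k (n - k) = b + j"
  shows "osym (- 3 / 2 * real j - 3 / 2) (\<lambda>z. f z - (C2 - \<i> * C1) ^ k * (C2 + \<i> * C1) ^ (n - k) * tau_lead k (n - k) *
      mode (2 * real k - real n) (- 3 / 2 * real j) z)"
    and "osym (- 3 / 2 * real j) f"
    and "2 * k = n \<Longrightarrow> symb (- 3 / 2 * real j - 3 / 2) (\<lambda>z. f z - (C2 - \<i> * C1) ^ k * (C2 + \<i> * C1) ^ (n - k) * tau_lead k (n - k) * z powr of_real (- 3 / 2 * real j))"
proof -
  define D where "D = (C2 - \<i> * C1) ^ k * (C2 + \<i> * C1) ^ (n - k)"
  define w where "w = (\<lambda>z. z powr of_real (3 / 2 * real b) * tau_coeff k (n - k) z)"
  have "asy (3 / 2 * real b + - 3 / 2 * real (gram_weight k (n - k))) (tau_lead k (n - k)) w"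
    unfolding w_def by (intro asy_powr_mult tau_coeff_asy)
  hence a: "asy (- 3 / 2 * real j) (tau_lead k (n - k)) w"
    by (rule asy_exp_eq) (simp_all add: j algebra_simps)
  have D: "asy (- 3 / 2 * real j) (D * tau_lead k (n - k)) (\<lambda>z. D * w z)"
    by (rule asy_cmult[OF a])
  hence s: "symb (- 3 / 2 * real j - 3 / 2) (\<lambda>z. D * w z - D * tau_lead k (n - k) * z powr of_real (- 3 / 2 * real j))"
    unfolding asy_def .
  have f: "f z = exp (\<i> * of_real (2 * real k - real n) * airy_chi z) * (D * w z)" for z
    unfolding f_def D_def w_def by (simp only: mult_ac)
  show "osym (- 3 / 2 * real j - 3 / 2) (\<lambda>z. f z - (C2 - \<i> * C1) ^ k * (C2 + \<i> * C1) ^ (n - k) * tau_lead k (n - k) *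
      mode (2 * real k - real n) (- 3 / 2 * real j) z)"
    by (rule osym.mode[OF s, of _ "2 * real k - real n"]) (simp add: f mode_def D_def algebra_simps)
  show "osym (- 3 / 2 * real j) f"
    by (rule osym.mode[OF asy_symb[OF D], of _ "2 * real k - real n"]) (rule f)
  assume "2 * k = n"
  hence "2 * real k - real n = 0" by linarith
  hence "f z = D * w z" for z unfolding f by simp
  thus "symb (- 3 / 2 * real j - 3 / 2) (\<lambda>z. f z - (C2 - \<i> * C1) ^ k * (C2 + \<i> * C1) ^ (n - k) * tau_lead k (n - k) * z powr of_real (- 3 / 2 * real j))"
    using s by (simp add: D_def)
qed

lemma tau_norm_holomorphic: "tau_norm C1 C2 n b holomorphic_on {z. Re z > 0}"
proof -
  have "tau_coeff k (n - k) holomorphic_on {z. Re z > 0}" for k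
    using asy_symb[OF tau_coeff_asy] by (rule symb_holomorphic)
  thus ?thesis unfolding tau_norm_def
    by (intro holomorphic_intros airy_chi_holomorphic) (auto simp: complex_nonpos_Reals_iff)
qed

lemma log_deriv_tau:
  fixes C1 C2 :: complex and n b :: nat
  defines "e \<equiv> real n * (real n - 1) / 2 - real n / 4 - 3 / 2 * real b" and "T \<equiv> tau_norm C1 C2 n b"
  assumes z: "Re z > 0" and T: "T z \<noteq> 0"
  shows "tau C1 C2 n z \<noteq> 0"
    and "\<exists>D. (tau C1 C2 n has_field_derivative D) (at z)"
    and "sigma_fun C1 C2 n z = of_real e / z + deriv T z / T z"
    and "p_fun C1 C2 n z = 2 * of_real e / z ^ 2 - 2 * (deriv (deriv T) z / T z - (deriv T z / T z) ^ 2)"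
proof -
  obtain c where c: "c \<noteq> 0" "\<And>z. Re z > 0 \<Longrightarrow> tau C1 C2 n z = c * z powr of_real e * T z"
    using tau_eq_tau_norm[of C1 C2 n b] unfolding e_def T_def by blast
  have holT: "T holomorphic_on {z. Re z > 0}" unfolding T_def by (rule tau_norm_holomorphic)
  have holT': "deriv T holomorphic_on {z. Re z > 0}"
    using holT by (intro holomorphic_deriv) (auto simp: open_halfspace_Re_gt)
  have dtau: "(tau C1 C2 n has_field_derivative c * z powr of_real e * (of_real e / z * T z + deriv T z)) (at z)" if z: "Re z > 0" for z
  proof -
    have z0: "z \<noteq> 0" and nr: "z \<notin> \<real>\<^sub>\<le>\<^sub>0" using z by (auto simp: complex_nonpos_Reals_iff)
    have p: "((\<lambda>z. z powr of_real e) has_field_derivative of_real e * z powr (of_real e - 1)) (at z)"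
      using has_field_derivative_powr[OF nr, of "of_real e"] by simp
    have "((\<lambda>z. c * z powr of_real e * T z) has_field_derivative
       (c * (of_real e * z powr (of_real e - 1))) * T z + deriv T z * (c * z powr of_real e)) (at z)"
      by (intro DERIV_mult DERIV_cmult p holomorphic_right_deriv holT z)
    from deriv_cong_right[OF c(2) z this] show ?thesis
      using z0 by (simp add: powr_diff algebra_simps)
  qed
  have nz: "tau C1 C2 n z \<noteq> 0" if "Re z > 0" "T z \<noteq> 0" for z
    using that c by auto
  show "tau C1 C2 n z \<noteq> 0" by (rule nz[OF z T])
  show "\<exists>D. (tau C1 C2 n has_field_derivative D) (at z)" using dtau[OF z] by blast
  have ld: "log_deriv (tau C1 C2 n) z = of_real e / z + deriv T z / T z" if "Re z > 0" "T z \<noteq> 0" for z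
  proof -
    have "z \<noteq> 0" using that by auto
    moreover have "log_deriv (tau C1 C2 n) z = (c * z powr of_real e * (of_real e / z * T z + deriv T z)) / (c * z powr of_real e * T z)"
      unfolding log_deriv_def DERIV_imp_deriv[OF dtau[OF that(1)]] c(2)[OF that(1)] ..
    ultimately show ?thesis using that(2) c(1) by (simp add: add_divide_distrib)
  qed
  thus "sigma_fun C1 C2 n z = of_real e / z + deriv T z / T z" using z T by (simp add: sigma_fun_def)
  \<comment> \<open>The formula for the logarithmic derivative must hold on an open set before it
    can be differentiated again.\<close>
  define S where "S = {z. Re z > 0} \<inter> T -` (- {0})"
  have "open S" unfolding S_def
    by (intro continuous_open_preimage holomorphic_on_imp_continuous_on holT) (auto simp: open_halfspace_Re_gt)
  have z0: "z \<noteq> 0" using z by auto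
  have "((\<lambda>z. of_real e / z + deriv T z / T z) has_field_derivative
     - of_real e / z ^ 2 + (deriv (deriv T) z * T z - deriv T z * deriv T z) / (T z * T z)) (at z)"
    using z0 by (intro DERIV_add DERIV_divide holomorphic_right_deriv holT holT' z T)
      (auto intro!: derivative_eq_intros simp: power2_eq_square)
  hence "(log_deriv (tau C1 C2 n) has_field_derivative
     - of_real e / z ^ 2 + (deriv (deriv T) z * T z - deriv T z * deriv T z) / (T z * T z)) (at z)"
    by (rule has_field_derivative_transform_within_open[OF _ \<open>open S\<close>]) (use z T ld in \<open>auto simp: S_def\<close>)
  hence "p_fun C1 C2 n z = - 2 * (- of_real e / z ^ 2 + (deriv (deriv T) z * T z - deriv T z * deriv T z) / (T z * T z))"
    unfolding p_fun_def by (simp add: DERIV_imp_deriv)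
  also have "(deriv (deriv T) z * T z - deriv T z * deriv T z) / (T z * T z) = deriv (deriv T) z / T z - (deriv T z / T z) ^ 2"
    using T by (simp add: diff_divide_distrib power2_eq_square)
  finally show "p_fun C1 C2 n z = 2 * of_real e / z ^ 2 - 2 * (deriv (deriv T) z / T z - (deriv T z / T z) ^ 2)"
    by (simp add: algebra_simps)
qed

subsection \<open>The leading coefficients\<close>

lemma hankel_gauss_Suc: "hankel_gauss v (Suc n) = hankel_gauss v n * (fact n * v ^ n)"
  by (simp add: hankel_gauss_def)

lemma moment_var_minus: "moment_var (-1) = - moment_var 1"
  by (simp add: moment_var_def)

lemma tau_lead_nz: "tau_lead p r \<noteq> 0"
  by (simp add: tau_lead_def hankel_gauss_def moment_var_def)

text \<open>With v = i / sqrt 2, moving one row to the other node removes one factor -4 and replaces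
  (s-1)! (-v)^(s-1) by s! v^s; the ratio is (-1)^s s v / 4. In the opposite direction v changes
  sign.\<close>

lemma tau_lead_even:
  assumes "s \<ge> 1"
  shows "tau_lead (s + 1) (s - 1) = ((- 1) ^ s * \<i> * of_real (real s / (4 * sqrt 2))) * tau_lead s s"
    and "tau_lead (s - 1) (s + 1) = - ((- 1) ^ s * \<i> * of_real (real s / (4 * sqrt 2))) * tau_lead s s"
proof -
  obtain m where m: "s = Suc m" using assms by (cases s) auto
  define v where "v = moment_var 1"
  define h where "h = hankel_gauss v m"
  define h' where "h' = hankel_gauss (- v) m"
  define P where "P = (- 4 :: complex) ^ (m * (m + 2))"
  define q where "q = (- 1 :: complex) ^ m"
  have q: "q * q = 1" by (simp add: q_def flip: power_add)
  have mv: "(- v) ^ m = q * v ^ m" unfolding q_def by (rule power_minus)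
  have e: "(m + 1) * (m + 1) = Suc (m * (m + 2))" by simp
  have k: "(- 1) ^ s * \<i> * of_real (real s / (4 * sqrt 2)) = - q * of_nat (Suc m) * v / 4"
    by (simp add: m v_def moment_var_def q_def mult_ac)
  have f: "fact (Suc m) = of_nat (Suc m) * (fact m :: complex)" by simp
  have ss: "tau_lead s s = - 4 * P * (h * (fact m * v ^ m) * (h' * (fact m * (q * v ^ m))))"
    unfolding tau_lead_def moment_var_minus v_def[symmetric] m Suc_eq_plus1[symmetric] hankel_gauss_Suc h_def[symmetric] h'_def[symmetric] mv
    using e by (simp add: P_def)
  have 1: "tau_lead (s + 1) (s - 1) = P * (h * (fact m * v ^ m) * (of_nat (Suc m) * fact m * (v * v ^ m)) * h')"
  proof -
    have "tau_lead (s + 1) (s - 1) = (- 4) ^ ((m + 2) * m) * (hankel_gauss v (Suc (Suc m)) * hankel_gauss (- v) m)"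
      by (simp add: tau_lead_def moment_var_minus v_def m)
    thus ?thesis unfolding hankel_gauss_Suc h_def[symmetric] h'_def[symmetric] P_def f power_Suc
      by (simp only: mult.commute[of "m + 2" m])
  qed
  have 2: "tau_lead (s - 1) (s + 1) = P * (h * (h' * (fact m * (q * v ^ m)) * (of_nat (Suc m) * fact m * (- v * (q * v ^ m)))))"
  proof -
    have "tau_lead (s - 1) (s + 1) = (- 4) ^ (m * (m + 2)) * (hankel_gauss v m * hankel_gauss (- v) (Suc (Suc m)))"
      by (simp add: tau_lead_def moment_var_minus v_def m)
    thus ?thesis unfolding hankel_gauss_Suc h_def[symmetric] h'_def[symmetric] P_def f power_Suc mv .
  qed
  have "- q * N * v / 4 * (- 4 * P * (h * (F * w) * (h' * (F * (q * w))))) = (q * q) * (P * (h * (F * w) * (N * F * (v * w)) * h'))" for N F w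
    by (simp add: field_simps)
  thus "tau_lead (s + 1) (s - 1) = ((- 1) ^ s * \<i> * of_real (real s / (4 * sqrt 2))) * tau_lead s s"
    unfolding k ss 1 q by (simp only: mult_1_left)
  have "- (- q * N * v / 4) * (- 4 * P * (h * (F * w) * (h' * (F * (q * w))))) = P * (h * (h' * (F * (q * w)) * (N * F * (- v * (q * w)))))" for N F w
    by (simp add: field_simps)
  thus "tau_lead (s - 1) (s + 1) = - ((- 1) ^ s * \<i> * of_real (real s / (4 * sqrt 2))) * tau_lead s s"
    unfolding k ss 2 by (simp only:)
qed

text \<open>Both sides share the power of -4; the Hankel determinants merely exchange their
  variances, which leaves the quotient of (-v)^(s-1) by v^(s-1).\<close>

lemma tau_lead_odd:
  assumes "s \<ge> 1"
  shows "tau_lead (s - 1) s = (- 1) ^ (s - 1) * tau_lead s (s - 1)"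
proof -
  obtain m where m: "s = Suc m" using assms by (cases s) auto
  have "(- moment_var 1) ^ m = (- 1) ^ m * moment_var 1 ^ m" by (rule power_minus)
  thus ?thesis by (simp add: m tau_lead_def moment_var_minus hankel_gauss_Suc mult_ac)
qed

text \<open>The inequality between \<open>a\<close> and \<open>m\<close> says that differentiating
  the power of z in a mode stays within the error of order m + 1/2.\<close>

lemma two_mode_deriv:
  assumes f: "f holomorphic_on {z. Re z > 0}" and m: "a - 1 \<le> m + 1 / 2"
    and osc: "osym m (\<lambda>z. f z - (c * mode \<mu> a z + d * mode \<nu> a z))"
  shows "osym (m + 1 / 2) (\<lambda>z. deriv f z - (c * (\<i> * of_real (\<mu> / sqrt 2)) * mode \<mu> (a + 1 / 2) z + d * (\<i> * of_real (\<nu> / sqrt 2)) * mode \<nu> (a + 1 / 2) z))"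
proof -
  define g where "g = (\<lambda>z. f z - (c * mode \<mu> a z + d * mode \<nu> a z))"
  have "osym (m + 1 / 2) (deriv g)" unfolding g_def by (rule osym_deriv[OF osc])
  moreover have "osym (m + 1 / 2) (\<lambda>z. c * (deriv (mode \<mu> a) z - \<i> * of_real (\<mu> / sqrt 2) * mode \<mu> (a + 1 / 2) z) +
      d * (deriv (mode \<nu> a) z - \<i> * of_real (\<nu> / sqrt 2) * mode \<nu> (a + 1 / 2) z))"
    by (intro osym_add osym_cmult osym_le[OF mode_deriv_osym m])
  ultimately show ?thesis
  proof (rule osym.add)
    fix z :: complex assume z: "Re z > 0"
    have "(g has_field_derivative deriv f z - (c * deriv (mode \<mu> a) z + d * deriv (mode \<nu> a) z)) (at z)"
      unfolding g_def
      by (intro DERIV_diff DERIV_add DERIV_cmult holomorphic_right_deriv[OF f z])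
        (auto intro!: holomorphic_right_deriv z osym_holomorphic[OF mode_osym])
    thus "deriv f z - (c * (\<i> * of_real (\<mu> / sqrt 2)) * mode \<mu> (a + 1 / 2) z + d * (\<i> * of_real (\<nu> / sqrt 2)) * mode \<nu> (a + 1 / 2) z) =
      deriv g z + (c * (deriv (mode \<mu> a) z - \<i> * of_real (\<mu> / sqrt 2) * mode \<mu> (a + 1 / 2) z) +
      d * (deriv (mode \<nu> a) z - \<i> * of_real (\<nu> / sqrt 2) * mode \<nu> (a + 1 / 2) z))"
      by (simp add: DERIV_imp_deriv algebra_simps)
  qed
qed

lemma gram_weight_diff:
  "2 * (int (gram_weight k l) - int (gram_weight p r)) = int k * (int k - 1) + int l * (int l - 1) - int p * (int p - 1) - int r * (int r - 1)"
  using gram_weight_eq[of k l] gram_weight_eq[of p r] by (simp add: right_diff_distrib)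

text \<open>This orders the terms of \<open>tau_norm\<close>: excess 1, a factor z^(-3/2), for the
  two neighbours of the middle index, and at least 4 beyond them.\<close>

lemma gram_weight_even:
  assumes "k \<le> 2 * s"
  shows "int (gram_weight k (2 * s - k)) = int (gram_weight s s) + (int k - int s)\<^sup>2"
proof -
  have "int (2 * s - k) = 2 * int s - int k" using assms by auto
  thus ?thesis using gram_weight_diff[of k "2 * s - k" s s]
    by (simp add: algebra_simps power2_eq_square)
qed

text \<open>A product of consecutive integers vanishes for k = s and k = s - 1 and is at least 2
  elsewhere, so two terms of opposite frequency share the lead.\<close>

lemma gram_weight_odd:
  assumes "k \<le> 2 * s - 1" "s \<ge> 1"
  shows "int (gram_weight k (2 * s - 1 - k)) = int (gram_weight s (s - 1)) + (int k - int s) * (int k - int s + 1)"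
proof -
  have "int (2 * s - 1 - k) = 2 * int s - 1 - int k" "int (s - 1) = int s - 1" using assms by auto
  thus ?thesis using gram_weight_diff[of k "2 * s - 1 - k" s "s - 1"]
    by (simp add: algebra_simps)
qed

lemma real_gram_weight: "real (gram_weight p r) = (real p * (real p - 1) + real r * (real r - 1)) / 2"
proof -
  have "real_of_int (2 * int (gram_weight p r)) = real_of_int (int p * (int p - 1) + int r * (int r - 1))"
    unfolding gram_weight_eq ..
  thus ?thesis by simp
qed

lemma real_bigo_powr: "F \<le> at_top \<Longrightarrow> (\<lambda>x. c / complex_of_real x) \<in> O[F](\<lambda>x. complex_of_real (x powr (- 1)))"
  "F \<le> at_top \<Longrightarrow> (\<lambda>x. c / complex_of_real x ^ 2) \<in> O[F](\<lambda>x. complex_of_real (x powr (- 2)))"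
proof -
  assume F: "F \<le> at_top"
  have pos: "eventually (\<lambda>x::real. x > 0) F" using eventually_gt_at_top F by (rule filter_leD[rotated])
  show "(\<lambda>x. c / complex_of_real x) \<in> O[F](\<lambda>x. complex_of_real (x powr (- 1)))"
    by (rule bigoI[of _ "norm c"], use pos in eventually_elim) (simp add: powr_minus norm_mult divide_inverse)
  show "(\<lambda>x. c / complex_of_real x ^ 2) \<in> O[F](\<lambda>x. complex_of_real (x powr (- 2)))"
    by (rule bigoI[of _ "norm c"], use pos in eventually_elim) (simp add: powr_minus norm_mult divide_inverse norm_power norm_inverse)
qed

subsection \<open>Even index\<close>

text \<open>An oscillating remainder of order z^(-3/2) would lose z^(1/2) on differentiation and
  reach the size z^(-1) of the main term of sigma. The correction to the middle term does not
  oscillate, so it is kept apart as the symbol \<open>\<rho>\<close>, whose derivative is of order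
  z^(-5/2).\<close>

lemma even_decomposition:
  fixes C1 C2 :: complex and s :: nat
  assumes s: "s \<ge> 1"
  defines "T \<equiv> tau_norm C1 C2 (2 * s) (gram_weight s s)"
    and "A \<equiv> C2 - \<i> * C1" and "B \<equiv> C2 + \<i> * C1"
  defines "V \<equiv> A ^ s * B ^ s * tau_lead s s"
    and "c \<equiv> A ^ (s + 1) * B ^ (s - 1) * tau_lead (s + 1) (s - 1)"
    and "d \<equiv> A ^ (s - 1) * B ^ (s + 1) * tau_lead (s - 1) (s + 1)"
  obtains \<rho> where "symb (- 3 / 2) \<rho>"
    "osym (- 3) (\<lambda>z. (T z - V - \<rho> z) - (c * mode 2 (- 3 / 2) z + d * mode (- 2) (- 3 / 2) z))"
proof -
  define f where "f = (\<lambda>k z. A ^ k * B ^ (2 * s - k) *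
     exp (\<i> * of_real (2 * real k - real (2 * s)) * airy_chi z) * (z powr of_real (3 / 2 * real (gram_weight s s)) * tau_coeff k (2 * s - k) z))"
  have T: "T z = (\<Sum>k\<le>2 * s. f k z)" for z
    unfolding T_def tau_norm_def f_def A_def B_def ..
  define \<rho> where "\<rho> = (\<lambda>z. f s z - V * z powr of_real (- 3 / 2 * real 0))"
  have gs: "gram_weight s (2 * s - s) = gram_weight s s + 0" by simp
  have "symb (- 3 / 2 * real 0 - 3 / 2) \<rho>"
    using tau_norm_term(3)[OF gs, of C2 C1] unfolding \<rho>_def f_def V_def A_def B_def by simp
  hence 1: "symb (- 3 / 2) \<rho>" by simp
  have g1: "gram_weight (s + 1) (2 * s - (s + 1)) = gram_weight s s + 1"
    using gram_weight_even[of "s + 1" s] s by simp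
  have "osym (- 3 / 2 * real 1 - 3 / 2) (\<lambda>z. f (s + 1) z - A ^ (s + 1) * B ^ (2 * s - (s + 1)) * tau_lead (s + 1) (2 * s - (s + 1)) *
      mode (2 * real (s + 1) - real (2 * s)) (- 3 / 2 * real 1) z)"
    unfolding f_def A_def B_def by (rule tau_norm_term(1)[OF g1])
  moreover have "2 * s - (s + 1) = s - 1" "2 * real (s + 1) - real (2 * s) = 2" using s by auto
  ultimately have 2: "osym (- 3) (\<lambda>z. f (s + 1) z - c * mode 2 (- 3 / 2) z)"
    by (simp add: c_def)
  have g2: "gram_weight (s - 1) (2 * s - (s - 1)) = gram_weight s s + 1"
  proof -
    have "s - 1 \<le> 2 * s" "int (s - 1) - int s = - 1" "2 * s - (s - 1) = s + 1" using s by auto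
    thus ?thesis using gram_weight_even[of "s - 1" s] by simp
  qed
  have "osym (- 3 / 2 * real 1 - 3 / 2) (\<lambda>z. f (s - 1) z - A ^ (s - 1) * B ^ (2 * s - (s - 1)) * tau_lead (s - 1) (2 * s - (s - 1)) *
      mode (2 * real (s - 1) - real (2 * s)) (- 3 / 2 * real 1) z)"
    unfolding f_def A_def B_def by (rule tau_norm_term(1)[OF g2])
  moreover have "2 * s - (s - 1) = s + 1" "2 * real (s - 1) - real (2 * s) = - 2" using s by auto
  ultimately have 3: "osym (- 3) (\<lambda>z. f (s - 1) z - d * mode (- 2) (- 3 / 2) z)"
    by (simp add: d_def)
  define I where "I = {..2 * s} - {s - 1, s, s + 1}"
  have 4: "osym (- 3) (\<lambda>z. \<Sum>k\<in>I. f k z)"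
  proof (rule osym_sum)
    fix k assume k: "k \<in> I"
    hence k2: "k \<le> 2 * s" by (simp add: I_def)
    define j where "j = nat ((int k - int s)\<^sup>2)"
    have "2 \<le> \<bar>int k - int s\<bar>" using k s by (auto simp: I_def)
    hence "2 ^ 2 \<le> \<bar>int k - int s\<bar> ^ 2" by (intro power_mono) auto
    hence j: "2 \<le> j" by (simp add: j_def)
    have "int (gram_weight k (2 * s - k)) = int (gram_weight s s + j)"
      unfolding gram_weight_even[OF k2] j_def by simp
    hence "gram_weight k (2 * s - k) = gram_weight s s + j" by (simp only: of_nat_eq_iff)
    from tau_norm_term(2)[OF this, of C2 C1] have "osym (- 3 / 2 * real j) (f k)"
      unfolding f_def A_def B_def .
    thus "osym (- 3) (f k)" by (rule osym_le) (use j in simp)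
  qed
  have "osym (- 3) (\<lambda>z. (f (s + 1) z - c * mode 2 (- 3 / 2) z) + (f (s - 1) z - d * mode (- 2) (- 3 / 2) z) + (\<Sum>k\<in>I. f k z))"
    by (intro osym_add 2 3 4)
  from osym.add[OF this osym_symb[OF symb_0[of "- 3"]]]
  have "osym (- 3) (\<lambda>z. (T z - V - \<rho> z) - (c * mode 2 (- 3 / 2) z + d * mode (- 2) (- 3 / 2) z))"
  proof this
    fix z :: complex assume z: "Re z > 0"
    have sub: "{..2 * s} = I \<union> {s - 1, s, s + 1}" "I \<inter> {s - 1, s, s + 1} = {}" using s by (auto simp: I_def)
    have "T z = (\<Sum>k\<in>I. f k z) + (\<Sum>k\<in>{s - 1, s, s + 1}. f k z)"
      unfolding T sub(1) by (rule sum.union_disjoint) (use sub(2) in \<open>auto simp: I_def\<close>)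
    also have "(\<Sum>k\<in>{s - 1, s, s + 1}. f k z) = f (s - 1) z + f s z + f (s + 1) z"
      using s by (cases s) auto
    finally have "T z = (\<Sum>k\<in>I. f k z) + (f (s - 1) z + f s z + f (s + 1) z)" .
    moreover have "f s z = \<rho> z + V" using z by (auto simp: \<rho>_def)
    ultimately show "(T z - V - \<rho> z) - (c * mode 2 (- 3 / 2) z + d * mode (- 2) (- 3 / 2) z) =
      (f (s + 1) z - c * mode 2 (- 3 / 2) z) + (f (s - 1) z - d * mode (- 2) (- 3 / 2) z) + (\<Sum>k\<in>I. f k z) + 0"
      by simp
  qed
  with 1 show ?thesis using that by blast
qed

text \<open>The leading term \<open>V\<close> is a nonzero constant, so no neighbourhoods have to be
  excluded; as its derivatives vanish, the oscillation of sigma and p comes from the two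
  neighbouring modes.\<close>

lemma even_asymptotics:
  fixes C1 C2 :: complex and s :: nat
  assumes nd: "C1\<^sup>2 + C2\<^sup>2 \<noteq> 0" and s: "s \<ge> 1"
  defines "X \<equiv> phase_coeff C1 C2 (2 * s) (s - 1) / (C1\<^sup>2 + C2\<^sup>2) ^ s"
    and "Y \<equiv> phase_coeff C1 C2 (2 * s) (s + 1) / (C1\<^sup>2 + C2\<^sup>2) ^ s"
  defines "\<kappa> \<equiv> (- 1) ^ s * \<i> * of_real (real s / (4 * sqrt 2))"
  shows "eventually (\<lambda>x. tau C1 C2 (2 * s) (of_real x) \<noteq> 0 \<and> (\<exists>D. (tau C1 C2 (2 * s) has_field_derivative D) (at (of_real x)))) at_top"
    and "(\<lambda>x. sigma_fun C1 C2 (2 * s) (of_real x) - (of_real (real s ^ 2 / (2 * x)) +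
       \<i> * of_real (sqrt 2) * \<kappa> * (X * mode 2 (- 1) (of_real x) + Y * mode (- 2) (- 1) (of_real x))))
       \<in> O[at_top](\<lambda>x. complex_of_real (x powr (- 5 / 2)))"
    and "(\<lambda>x. sigma_fun C1 C2 (2 * s) (of_real x)) \<in> O[at_top](\<lambda>x. complex_of_real (x powr (- 1)))"
    and "(\<lambda>x. p_fun C1 C2 (2 * s) (of_real x) - 4 * \<kappa> * (X * mode 2 (- 1 / 2) (of_real x) - Y * mode (- 2) (- 1 / 2) (of_real x)))
       \<in> O[at_top](\<lambda>x. complex_of_real (x powr (- 2)))"
proof -
  define T where "T = tau_norm C1 C2 (2 * s) (gram_weight s s)"
  define A where "A = C2 - \<i> * C1"
  define B where "B = C2 + \<i> * C1"
  define V where "V = A ^ s * B ^ s * tau_lead s s"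
  define c where "c = A ^ (s + 1) * B ^ (s - 1) * tau_lead (s + 1) (s - 1)"
  define d where "d = A ^ (s - 1) * B ^ (s + 1) * tau_lead (s - 1) (s + 1)"
  obtain \<rho> where \<rho>: "symb (- 3 / 2) \<rho>"
    and R: "osym (- 3) (\<lambda>z. (T z - V - \<rho> z) - (c * mode 2 (- 3 / 2) z + d * mode (- 2) (- 3 / 2) z))"
    using even_decomposition[OF s, of C1 C2] unfolding T_def V_def A_def B_def c_def d_def by blast
  have AB: "A * B = C1\<^sup>2 + C2\<^sup>2" by (simp add: A_def B_def algebra_simps power2_eq_square)
  have Vnz: "V \<noteq> 0" using phase_coeff_nz[OF nd] tau_lead_nz by (simp add: V_def A_def B_def)
  have ABs: "A ^ s * B ^ s = (C1\<^sup>2 + C2\<^sup>2) ^ s" by (simp add: AB flip: power_mult_distrib)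
  have e2: "2 * s - (s - 1) = s + 1" "2 * s - (s + 1) = s - 1" using s by auto
  have X: "X = A ^ (s + 1) * B ^ (s - 1) / (C1\<^sup>2 + C2\<^sup>2) ^ s" and Y: "Y = A ^ (s - 1) * B ^ (s + 1) / (C1\<^sup>2 + C2\<^sup>2) ^ s"
    unfolding X_def Y_def phase_coeff_def A_def B_def e2 by simp_all
  have "P * (K * L) = K * (P / D) * (D * L)" if "D \<noteq> 0" for P K L D :: complex
    using that by simp
  moreover have "(C1\<^sup>2 + C2\<^sup>2) ^ s \<noteq> 0" using nd by simp
  ultimately have cX: "c = \<kappa> * X * V" and dY: "d = - \<kappa> * Y * V"
    unfolding c_def d_def V_def ABs X Y tau_lead_even[OF s] \<kappa>_def[symmetric] by blast+
  have holT: "T holomorphic_on {z. Re z > 0}" unfolding T_def by (rule tau_norm_holomorphic)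
  have hol\<rho>: "\<rho> holomorphic_on {z. Re z > 0}" using \<rho> by (rule symb_holomorphic)
  define c1 where "c1 = c * (\<i> * of_real (2 / sqrt 2))"
  define d1 where "d1 = d * (\<i> * of_real (- 2 / sqrt 2))"
  have T1: "osym (- 5 / 2) (\<lambda>z. deriv T z - (c1 * mode 2 (- 1) z + d1 * mode (- 2) (- 1) z))"
  proof -
    have "(\<lambda>z. T z - V - \<rho> z) holomorphic_on {z. Re z > 0}" by (intro holomorphic_intros holT hol\<rho>)
    from two_mode_deriv[OF this _ R]
    have "osym (- 5 / 2) (\<lambda>z. deriv (\<lambda>z. T z - V - \<rho> z) z - (c1 * mode 2 (- 1) z + d1 * mode (- 2) (- 1) z))"
      by (simp add: c1_def d1_def)
    moreover have "osym (- 5 / 2) (deriv \<rho>)" using symb_deriv[OF \<rho>] by (intro osym_symb) simp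
    ultimately show ?thesis
    proof (rule osym.add)
      fix z :: complex assume z: "Re z > 0"
      have "((\<lambda>z. T z - V - \<rho> z) has_field_derivative deriv T z - 0 - deriv \<rho> z) (at z)"
        by (intro DERIV_diff DERIV_const holomorphic_right_deriv holT hol\<rho> z)
      thus "deriv T z - (c1 * mode 2 (- 1) z + d1 * mode (- 2) (- 1) z) =
        deriv (\<lambda>z. T z - V - \<rho> z) z - (c1 * mode 2 (- 1) z + d1 * mode (- 2) (- 1) z) + deriv \<rho> z"
        by (simp add: DERIV_imp_deriv)
    qed
  qed
  have holT': "deriv T holomorphic_on {z. Re z > 0}"
    using holT by (intro holomorphic_deriv) (auto simp: open_halfspace_Re_gt)
  have T2: "osym (- 2) (\<lambda>z. deriv (deriv T) z - (- 2 * c * mode 2 (- 1 / 2) z + - 2 * d * mode (- 2) (- 1 / 2) z))"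
  proof -
    have q: "complex_of_real (2 / sqrt 2) * of_real (2 / sqrt 2) = 2"
      by (simp flip: of_real_mult)
    have "c1 * (\<i> * of_real (2 / sqrt 2)) = c * (\<i> * \<i>) * (of_real (2 / sqrt 2) * of_real (2 / sqrt 2))"
      "d1 * (\<i> * of_real (- 2 / sqrt 2)) = d * (\<i> * \<i>) * (of_real (2 / sqrt 2) * of_real (2 / sqrt 2))"
      by (simp_all add: c1_def d1_def)
    hence cd: "c1 * (\<i> * of_real (2 / sqrt 2)) = - 2 * c" "d1 * (\<i> * of_real (- 2 / sqrt 2)) = - 2 * d"
      unfolding q by simp_all
    have "osym (- 5 / 2 + 1 / 2) (\<lambda>z. deriv (deriv T) z - (c1 * (\<i> * of_real (2 / sqrt 2)) * mode 2 (- 1 + 1 / 2) z +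
        d1 * (\<i> * of_real (- 2 / sqrt 2)) * mode (- 2) (- 1 + 1 / 2) z))"
      by (rule two_mode_deriv[OF holT' _ T1]) simp
    thus ?thesis unfolding cd by simp
  qed
  define T0 where "T0 = (\<lambda>x::real. V)"
  have TO: "(\<lambda>x. T (of_real x) - T0 x) \<in> O[at_top](\<lambda>x. complex_of_real (x powr (- 3 / 2)))"
  proof -
    have a: "osym (- 3 / 2) (\<lambda>z. (T z - V - \<rho> z) - (c * mode 2 (- 3 / 2) z + d * mode (- 2) (- 3 / 2) z))"
      by (rule osym_le[OF R]) simp
    have b: "osym (- 3 / 2) \<rho>" by (rule osym_symb) (rule \<rho>)
    have "osym (- 3 / 2) (\<lambda>z. ((T z - V - \<rho> z) - (c * mode 2 (- 3 / 2) z + d * mode (- 2) (- 3 / 2) z)) + (\<rho> z + (c * mode 2 (- 3 / 2) z + d * mode (- 2) (- 3 / 2) z)))"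
      by (intro osym_add a b osym_cmult mode_osym)
    from osym_bigo[OF this order.refl] show ?thesis by (simp add: T0_def)
  qed
  have low: "norm V > 0" "eventually (\<lambda>x. norm V \<le> norm (T0 x)) at_top" using Vnz by (auto simp: T0_def)
  note Q = quotient_asymp[OF order.refl TO low]
  have pos: "eventually (\<lambda>x::real. x > 0) at_top" by (rule eventually_gt_at_top)
  show "eventually (\<lambda>x. tau C1 C2 (2 * s) (of_real x) \<noteq> 0 \<and> (\<exists>D. (tau C1 C2 (2 * s) has_field_derivative D) (at (of_real x)))) at_top"
    using Q(1) pos
  proof eventually_elim
    case (elim x)
    have "Re (of_real x) > 0" "tau_norm C1 C2 (2 * s) (gram_weight s s) (of_real x) \<noteq> 0" using elim by (simp_all add: T_def)
    from log_deriv_tau(1,2)[OF this] show ?case by blast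
  qed
  \<comment> \<open>The power of z split off from tau gives exactly s^2 / (2 z) in sigma.\<close>
  have e: "real (2 * s) * (real (2 * s) - 1) / 2 - real (2 * s) / 4 - 3 / 2 * real (gram_weight s s) = real s ^ 2 / 2"
    unfolding real_gram_weight by (simp add: field_simps power2_eq_square)
  have sp: "eventually (\<lambda>x. sigma_fun C1 C2 (2 * s) (of_real x) = of_real (real s ^ 2 / 2) / of_real x + deriv T (of_real x) / T (of_real x) \<and>
      p_fun C1 C2 (2 * s) (of_real x) = 2 * of_real (real s ^ 2 / 2) / of_real x ^ 2 -
        2 * (deriv (deriv T) (of_real x) / T (of_real x) - (deriv T (of_real x) / T (of_real x)) ^ 2)) at_top"
    using Q(1) pos
  proof eventually_elim
    case (elim x)
    have "Re (of_real x) > 0" "tau_norm C1 C2 (2 * s) (gram_weight s s) (of_real x) \<noteq> 0" using elim by (simp_all add: T_def)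
    from log_deriv_tau(3,4)[OF this] show ?case unfolding T_def e by blast
  qed
  define N0 where "N0 = (\<lambda>x. c1 * mode 2 (- 1) (complex_of_real x) + d1 * mode (- 2) (- 1) (of_real x))"
  define M0 where "M0 = (\<lambda>x. - 2 * c * mode 2 (- 1 / 2) (complex_of_real x) + - 2 * d * mode (- 2) (- 1 / 2) (of_real x))"
  have N0: "N0 \<in> O[at_top](\<lambda>x. complex_of_real (x powr (- 1)))"
    unfolding N0_def by (intro osym_bigo[of "- 1" "\<lambda>z. c1 * mode 2 (- 1) z + d1 * mode (- 2) (- 1) z"] osym_add osym_cmult mode_osym order.refl)
  have M0: "M0 \<in> O[at_top](\<lambda>x. complex_of_real (x powr (- 1 / 2)))"
    unfolding M0_def by (intro osym_bigo[of "- 1 / 2" "\<lambda>z. - 2 * c * mode 2 (- 1 / 2) z + - 2 * d * mode (- 2) (- 1 / 2) z"] osym_add osym_cmult mode_osym order.refl)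
  have N: "(\<lambda>x. deriv T (of_real x) - N0 x) \<in> O[at_top](\<lambda>x. complex_of_real (x powr (- 1 - 3 / 2)))"
    using osym_bigo[OF T1 order.refl] by (simp add: N0_def)
  have M: "(\<lambda>x. deriv (deriv T) (of_real x) - M0 x) \<in> O[at_top](\<lambda>x. complex_of_real (x powr (- 1 / 2 - 3 / 2)))"
    using osym_bigo[OF T2 order.refl] by (simp add: M0_def)
  note QN = Q(2)[OF N0 N]
  note QM = Q(2)[OF M0 M]
  have QN1: "(\<lambda>x. deriv T (of_real x) / T (of_real x)) \<in> O[at_top](\<lambda>x. complex_of_real (x powr (- 1)))"
  proof -
    have "(\<lambda>x. (deriv T (of_real x) / T (of_real x) - N0 x / T0 x) + N0 x / T0 x) \<in> O[at_top](\<lambda>x. complex_of_real (x powr (- 1)))"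
      by (rule sum_in_bigo(1)[OF powr_bigo_le[OF conjunct1[OF QN] _ order.refl] conjunct2[OF QN]]) simp
    thus ?thesis by simp
  qed
  have N0V: "N0 x / T0 x = \<i> * of_real (sqrt 2) * \<kappa> * (X * mode 2 (- 1) (of_real x) + Y * mode (- 2) (- 1) (of_real x))" for x
  proof -
    have "2 / sqrt 2 = sqrt (2::real)" "- 2 / sqrt 2 = - sqrt (2::real)" by (simp_all add: real_div_sqrt)
    hence "c1 = \<i> * of_real (sqrt 2) * \<kappa> * X * V" "d1 = \<i> * of_real (sqrt 2) * \<kappa> * Y * V"
      unfolding c1_def d1_def cX dY by (simp_all only: of_real_minus) simp_all
    thus ?thesis using Vnz by (simp add: N0_def T0_def field_simps)
  qed
  have M0V: "- 2 * (M0 x / T0 x) = 4 * \<kappa> * (X * mode 2 (- 1 / 2) (of_real x) - Y * mode (- 2) (- 1 / 2) (of_real x))" for x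
    using Vnz by (simp add: M0_def T0_def cX dY field_simps)
  have "(\<lambda>x. deriv T (of_real x) / T (of_real x) - N0 x / T0 x) \<in> O[at_top](\<lambda>x. complex_of_real (x powr (- 5 / 2)))"
    using QN by simp
  moreover have "eventually (\<lambda>x. sigma_fun C1 C2 (2 * s) (of_real x) - (of_real (real s ^ 2 / (2 * x)) +
       \<i> * of_real (sqrt 2) * \<kappa> * (X * mode 2 (- 1) (of_real x) + Y * mode (- 2) (- 1) (of_real x))) =
       deriv T (of_real x) / T (of_real x) - N0 x / T0 x) at_top"
    using sp by eventually_elim (simp add: N0V)
  ultimately show "(\<lambda>x. sigma_fun C1 C2 (2 * s) (of_real x) - (of_real (real s ^ 2 / (2 * x)) +
       \<i> * of_real (sqrt 2) * \<kappa> * (X * mode 2 (- 1) (of_real x) + Y * mode (- 2) (- 1) (of_real x))))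
       \<in> O[at_top](\<lambda>x. complex_of_real (x powr (- 5 / 2)))"
    by (subst landau_o.big.in_cong)
  have "(\<lambda>x. of_real (real s ^ 2 / 2) / of_real x + deriv T (of_real x) / T (of_real x)) \<in> O[at_top](\<lambda>x. complex_of_real (x powr (- 1)))"
    by (intro sum_in_bigo QN1 real_bigo_powr order.refl)
  thus "(\<lambda>x. sigma_fun C1 C2 (2 * s) (of_real x)) \<in> O[at_top](\<lambda>x. complex_of_real (x powr (- 1)))"
    by (subst landau_o.big.in_cong) (use sp in \<open>auto elim: eventually_mono\<close>)
  \<comment> \<open>The term in z^(-2) and the square of T'/T both disappear in the error, so only
    T''/T contributes to p.\<close>
  have "(\<lambda>x. 2 * of_real (real s ^ 2 / 2) / of_real x ^ 2 - 2 * (deriv (deriv T) (of_real x) / T (of_real x) - M0 x / T0 x) +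
      2 * (deriv T (of_real x) / T (of_real x) * (deriv T (of_real x) / T (of_real x)))) \<in> O[at_top](\<lambda>x. complex_of_real (x powr (- 2)))"
  proof (rule sum_in_bigo(1)[OF sum_in_bigo(2)])
    show "(\<lambda>x. 2 * of_real (real s ^ 2 / 2) / of_real x ^ 2) \<in> O[at_top](\<lambda>x. complex_of_real (x powr (- 2)))"
      by (rule real_bigo_powr(2)[OF order.refl])
    have "(\<lambda>x. deriv (deriv T) (of_real x) / T (of_real x) - M0 x / T0 x) \<in> O[at_top](\<lambda>x. complex_of_real (x powr (- 2)))"
      using QM by simp
    thus "(\<lambda>x. 2 * (deriv (deriv T) (of_real x) / T (of_real x) - M0 x / T0 x)) \<in> O[at_top](\<lambda>x. complex_of_real (x powr (- 2)))"
      by (subst landau_o.big.cmult_in_iff) auto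
    have "(\<lambda>x. deriv T (of_real x) / T (of_real x) * (deriv T (of_real x) / T (of_real x))) \<in> O[at_top](\<lambda>x. complex_of_real (x powr (- 2)))"
      using powr_bigo_mult[OF QN1 QN1] by simp
    thus "(\<lambda>x. 2 * (deriv T (of_real x) / T (of_real x) * (deriv T (of_real x) / T (of_real x)))) \<in> O[at_top](\<lambda>x. complex_of_real (x powr (- 2)))"
      by (subst landau_o.big.cmult_in_iff) auto
  qed
  moreover have "eventually (\<lambda>x. p_fun C1 C2 (2 * s) (of_real x) - 4 * \<kappa> * (X * mode 2 (- 1 / 2) (of_real x) - Y * mode (- 2) (- 1 / 2) (of_real x)) =
      2 * of_real (real s ^ 2 / 2) / of_real x ^ 2 - 2 * (deriv (deriv T) (of_real x) / T (of_real x) - M0 x / T0 x) +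
      2 * (deriv T (of_real x) / T (of_real x) * (deriv T (of_real x) / T (of_real x)))) at_top"
    using sp by eventually_elim (simp only: M0V[symmetric], simp add: algebra_simps power2_eq_square)
  ultimately show "(\<lambda>x. p_fun C1 C2 (2 * s) (of_real x) - 4 * \<kappa> * (X * mode 2 (- 1 / 2) (of_real x) - Y * mode (- 2) (- 1 / 2) (of_real x)))
       \<in> O[at_top](\<lambda>x. complex_of_real (x powr (- 2)))"
    by (subst landau_o.big.in_cong)
qed

subsection \<open>Odd index\<close>

lemma odd_decomposition:
  fixes C1 C2 :: complex and s :: nat
  assumes s: "s \<ge> 1"
  defines "T \<equiv> tau_norm C1 C2 (2 * s - 1) (gram_weight s (s - 1))"
    and "A \<equiv> C2 - \<i> * C1" and "B \<equiv> C2 + \<i> * C1"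
  defines "c \<equiv> A ^ s * B ^ (s - 1) * tau_lead s (s - 1)"
    and "d \<equiv> A ^ (s - 1) * B ^ s * tau_lead (s - 1) s"
  shows "osym (- 3 / 2) (\<lambda>z. T z - (c * mode 1 0 z + d * mode (- 1) 0 z))"
proof -
  define n where "n = 2 * s - 1"
  define b where "b = gram_weight s (s - 1)"
  define f where "f = (\<lambda>k z. A ^ k * B ^ (n - k) *
     exp (\<i> * of_real (2 * real k - real n) * airy_chi z) * (z powr of_real (3 / 2 * real b) * tau_coeff k (n - k) z))"
  have T: "T z = (\<Sum>k\<le>n. f k z)" for z
    unfolding T_def tau_norm_def f_def A_def B_def n_def b_def ..
  have n: "n - s = s - 1" "n - (s - 1) = s" "2 * real s - real n = 1" "2 * real (s - 1) - real n = - 1" "s \<le> n" "s - 1 \<le> n"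
    using s by (auto simp: n_def)
  have "gram_weight s (n - s) = b + 0" by (simp add: n b_def)
  from tau_norm_term(1)[OF this, of C2 C1]
  have 1: "osym (- 3 / 2) (\<lambda>z. f s z - c * mode 1 0 z)"
    unfolding n c_def f_def A_def B_def by simp
  have "gram_weight (s - 1) (n - (s - 1)) = b + 0" unfolding n(2) by (simp add: b_def gram_weight_def add.commute)
  from tau_norm_term(1)[OF this, of C2 C1]
  have 2: "osym (- 3 / 2) (\<lambda>z. f (s - 1) z - d * mode (- 1) 0 z)"
    unfolding n d_def f_def A_def B_def by simp
  define I where "I = {..n} - {s - 1, s}"
  have 3: "osym (- 3 / 2) (\<lambda>z. \<Sum>k\<in>I. f k z)"
  proof (rule osym_sum)
    fix k assume k: "k \<in> I"
    hence k2: "k \<le> 2 * s - 1" by (simp add: I_def n_def)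
    define x where "x = int k - int s"
    define j where "j = nat (x * (x + 1))"
    have "x \<ge> 1 \<or> x \<le> - 2" using k s by (auto simp: I_def x_def)
    hence "x * (x + 1) \<ge> 1"
    proof
      assume "x \<ge> 1"
      hence "1 * 1 \<le> x * (x + 1)" by (intro mult_mono) auto
      thus ?thesis by simp
    next
      assume "x \<le> - 2"
      hence "1 * 1 \<le> (- x) * (- x - 1)" by (intro mult_mono) auto
      thus ?thesis by (simp add: algebra_simps)
    qed
    hence j: "1 \<le> j" "int j = x * (x + 1)" by (simp_all add: j_def)
    have "int (gram_weight k (n - k)) = int (b + j)"
      unfolding n_def gram_weight_odd[OF k2 s] of_nat_add j(2) by (simp add: x_def b_def)
    hence "gram_weight k (n - k) = b + j" by (simp only: of_nat_eq_iff)
    from tau_norm_term(2)[OF this, of C2 C1] have "osym (- 3 / 2 * real j) (f k)"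
      unfolding f_def A_def B_def .
    thus "osym (- 3 / 2) (f k)" by (rule osym_le) (use j(1) in simp)
  qed
  have "osym (- 3 / 2) (\<lambda>z. (f s z - c * mode 1 0 z) + (f (s - 1) z - d * mode (- 1) 0 z) + (\<Sum>k\<in>I. f k z))"
    by (intro osym_add 1 2 3)
  moreover have "(f s z - c * mode 1 0 z) + (f (s - 1) z - d * mode (- 1) 0 z) + (\<Sum>k\<in>I. f k z) =
      T z - (c * mode 1 0 z + d * mode (- 1) 0 z)" for z
  proof -
    have sub: "{..n} = I \<union> {s - 1, s}" "I \<inter> {s - 1, s} = {}" using n by (auto simp: I_def)
    have "T z = (\<Sum>k\<in>I. f k z) + (\<Sum>k\<in>{s - 1, s}. f k z)"
      unfolding T sub(1) by (rule sum.union_disjoint) (use sub(2) in \<open>auto simp: I_def\<close>)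
    also have "(\<Sum>k\<in>{s - 1, s}. f k z) = f (s - 1) z + f s z" using s by (cases s) auto
    finally show ?thesis by simp
  qed
  ultimately show ?thesis by (simp only:)
qed

text \<open>Here the leading term oscillates and may vanish, hence the filter and the lower bound
  among the hypotheses. To leading order its second derivative is -x/2 times itself, which supplies
  the summand 1 in p.\<close>

lemma odd_asymptotics:
  fixes C1 C2 :: complex and s :: nat
  assumes nd: "C1\<^sup>2 + C2\<^sup>2 \<noteq> 0" and s: "s \<ge> 1" and F: "F \<le> at_top"
  defines "X \<equiv> phase_coeff C1 C2 (2 * s - 1) (s - 1)"
    and "Y \<equiv> phase_coeff C1 C2 (2 * s - 1) s"
  defines "L \<equiv> \<lambda>x. X * cis (chi_real x) + (- 1) ^ (s - 1) * Y * cis (- chi_real x)"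
    and "M \<equiv> \<lambda>x. X * cis (chi_real x) - (- 1) ^ (s - 1) * Y * cis (- chi_real x)"
  assumes low: "\<delta> > 0" "eventually (\<lambda>x. \<delta> \<le> norm (L x)) F"
  shows "eventually (\<lambda>x. tau C1 C2 (2 * s - 1) (of_real x) \<noteq> 0 \<and> (\<exists>D. (tau C1 C2 (2 * s - 1) has_field_derivative D) (at (of_real x)))) F"
    and "(\<lambda>x. sigma_fun C1 C2 (2 * s - 1) (of_real x) - of_real (sqrt (x / 2)) * (\<i> * M x / L x))
       \<in> O[F](\<lambda>x. complex_of_real (x powr (- 1)))"
    and "(\<lambda>x. p_fun C1 C2 (2 * s - 1) (of_real x) - of_real x * (1 + (\<i> * M x / L x)\<^sup>2))
       \<in> O[F](\<lambda>x. complex_of_real (x powr (- 1 / 2)))"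
proof -
  define n where "n = 2 * s - 1"
  define b where "b = gram_weight s (s - 1)"
  define T where "T = tau_norm C1 C2 n b"
  define A where "A = C2 - \<i> * C1"
  define B where "B = C2 + \<i> * C1"
  define tl where "tl = tau_lead s (s - 1)"
  define c where "c = A ^ s * B ^ (s - 1) * tau_lead s (s - 1)"
  define d where "d = A ^ (s - 1) * B ^ s * tau_lead (s - 1) s"
  have R: "osym (- 3 / 2) (\<lambda>z. T z - (c * mode 1 0 z + d * mode (- 1) 0 z))"
    using odd_decomposition[OF s, of C1 C2] unfolding T_def n_def b_def A_def B_def c_def d_def .
  have tl: "tl \<noteq> 0" by (simp add: tl_def tau_lead_nz)
  have "2 * s - 1 - (s - 1) = s" "2 * s - 1 - s = s - 1" using s by auto
  hence cX: "c = tl * X" and dY: "d = tl * ((- 1) ^ (s - 1) * Y)"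
    unfolding c_def d_def X_def Y_def phase_coeff_def tau_lead_odd[OF s] tl_def A_def B_def by simp_all
  have holT: "T holomorphic_on {z. Re z > 0}" unfolding T_def by (rule tau_norm_holomorphic)
  have holT': "deriv T holomorphic_on {z. Re z > 0}"
    using holT by (intro holomorphic_deriv) (auto simp: open_halfspace_Re_gt)
  define c1 where "c1 = c * (\<i> * of_real (1 / sqrt 2))"
  define d1 where "d1 = d * (\<i> * of_real (- 1 / sqrt 2))"
  have T1: "osym (- 1) (\<lambda>z. deriv T z - (c1 * mode 1 (1 / 2) z + d1 * mode (- 1) (1 / 2) z))"
  proof -
    have "osym (- 3 / 2 + 1 / 2) (\<lambda>z. deriv T z - (c * (\<i> * of_real (1 / sqrt 2)) * mode 1 (0 + 1 / 2) z +
        d * (\<i> * of_real (- 1 / sqrt 2)) * mode (- 1) (0 + 1 / 2) z))"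
      by (rule two_mode_deriv[OF holT _ R]) simp
    thus ?thesis unfolding c1_def d1_def by simp
  qed
  have T2: "osym (- 1 / 2) (\<lambda>z. deriv (deriv T) z - (- (c / 2) * mode 1 1 z + - (d / 2) * mode (- 1) 1 z))"
  proof -
    have q: "complex_of_real (1 / sqrt 2) * of_real (1 / sqrt 2) = 1 / 2"
      by (simp flip: of_real_mult)
    have neg: "complex_of_real (- 1 / sqrt 2) = - of_real (1 / sqrt 2)" by simp
    have "c1 * (\<i> * of_real (1 / sqrt 2)) = c * (\<i> * \<i>) * (of_real (1 / sqrt 2) * of_real (1 / sqrt 2))"
      "d1 * (\<i> * of_real (- 1 / sqrt 2)) = d * (\<i> * \<i>) * (of_real (1 / sqrt 2) * of_real (1 / sqrt 2))"
      unfolding c1_def d1_def neg by (simp_all only: mult_ac mult_minus_left mult_minus_right minus_minus)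
    hence cd: "c1 * (\<i> * of_real (1 / sqrt 2)) = - (c / 2)" "d1 * (\<i> * of_real (- 1 / sqrt 2)) = - (d / 2)"
      unfolding q by simp_all
    have "osym (- 1 + 1 / 2) (\<lambda>z. deriv (deriv T) z - (c1 * (\<i> * of_real (1 / sqrt 2)) * mode 1 (1 / 2 + 1 / 2) z +
        d1 * (\<i> * of_real (- 1 / sqrt 2)) * mode (- 1) (1 / 2 + 1 / 2) z))"
      by (rule two_mode_deriv[OF holT' _ T1]) simp
    thus ?thesis unfolding cd by simp
  qed
  have pos: "eventually (\<lambda>x::real. x > 0) F" using eventually_gt_at_top F by (rule filter_leD[rotated])
  define T0 where "T0 = (\<lambda>x. c * mode 1 0 (complex_of_real x) + d * mode (- 1) 0 (of_real x))"
  define N0 where "N0 = (\<lambda>x. c1 * mode 1 (1 / 2) (complex_of_real x) + d1 * mode (- 1) (1 / 2) (of_real x))"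
  define M0 where "M0 = (\<lambda>x. - (c / 2) * mode 1 1 (complex_of_real x) + - (d / 2) * mode (- 1) 1 (of_real x))"
  have T0L: "T0 x = tl * L x" if "x > 0" for x
    using that by (simp add: T0_def mode_of_real cX dY L_def algebra_simps)
  have N0M: "N0 x = tl * (of_real (sqrt (x / 2)) * (\<i> * M x))" if "x > 0" for x
    using that by (simp add: N0_def mode_of_real cX dY M_def c1_def d1_def real_sqrt_divide powr_half_sqrt field_simps)
  have M0L: "M0 x = - (tl * (of_real (x / 2) * L x))" if "x > 0" for x
    using that by (simp add: M0_def mode_of_real cX dY L_def field_simps)
  have TO: "(\<lambda>x. T (of_real x) - T0 x) \<in> O[F](\<lambda>x. complex_of_real (x powr (- 3 / 2)))"
    using osym_bigo[OF R F] by (simp add: T0_def)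
  have low': "norm tl * \<delta> > 0" "eventually (\<lambda>x. norm tl * \<delta> \<le> norm (T0 x)) F"
    subgoal using low(1) tl by simp
    subgoal using low(2) pos by eventually_elim (simp add: T0L norm_mult mult_left_mono)
    done
  note Q = quotient_asymp[OF F TO low']
  have nzL: "eventually (\<lambda>x. L x \<noteq> 0) F" using low(2) by eventually_elim (use low(1) in auto)
  show "eventually (\<lambda>x. tau C1 C2 (2 * s - 1) (of_real x) \<noteq> 0 \<and> (\<exists>D. (tau C1 C2 (2 * s - 1) has_field_derivative D) (at (of_real x)))) F"
    using Q(1) pos
  proof eventually_elim
    case (elim x)
    have "Re (of_real x) > 0" "tau_norm C1 C2 n b (of_real x) \<noteq> 0" using elim by (simp_all add: T_def)
    from log_deriv_tau(1,2)[OF this] show ?case unfolding n_def by blast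
  qed
  define e where "e = real n * (real n - 1) / 2 - real n / 4 - 3 / 2 * real b"
  have sp: "eventually (\<lambda>x. sigma_fun C1 C2 (2 * s - 1) (of_real x) = of_real e / of_real x + deriv T (of_real x) / T (of_real x) \<and>
      p_fun C1 C2 (2 * s - 1) (of_real x) = 2 * of_real e / of_real x ^ 2 -
        2 * (deriv (deriv T) (of_real x) / T (of_real x) - (deriv T (of_real x) / T (of_real x)) ^ 2)) F"
    using Q(1) pos
  proof eventually_elim
    case (elim x)
    have "Re (of_real x) > 0" "tau_norm C1 C2 n b (of_real x) \<noteq> 0" using elim by (simp_all add: T_def)
    from log_deriv_tau(3,4)[OF this] show ?case unfolding T_def e_def n_def by blast
  qed
  have N0: "N0 \<in> O[F](\<lambda>x. complex_of_real (x powr (1 / 2)))"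
    unfolding N0_def by (intro osym_bigo[of "1 / 2" "\<lambda>z. c1 * mode 1 (1 / 2) z + d1 * mode (- 1) (1 / 2) z"] osym_add osym_cmult mode_osym F)
  have M0: "M0 \<in> O[F](\<lambda>x. complex_of_real (x powr 1))"
    unfolding M0_def by (intro osym_bigo[of 1 "\<lambda>z. - (c / 2) * mode 1 1 z + - (d / 2) * mode (- 1) 1 z"] osym_add osym_cmult mode_osym F)
  have N: "(\<lambda>x. deriv T (of_real x) - N0 x) \<in> O[F](\<lambda>x. complex_of_real (x powr (1 / 2 - 3 / 2)))"
    using osym_bigo[OF T1 F] by (simp add: N0_def)
  have M: "(\<lambda>x. deriv (deriv T) (of_real x) - M0 x) \<in> O[F](\<lambda>x. complex_of_real (x powr (1 - 3 / 2)))"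
    using osym_bigo[OF T2 F] by (simp add: M0_def)
  have QN: "(\<lambda>x. deriv T (of_real x) / T (of_real x) - N0 x / T0 x) \<in> O[F](\<lambda>x. complex_of_real (x powr (- 1)))"
    "(\<lambda>x. N0 x / T0 x) \<in> O[F](\<lambda>x. complex_of_real (x powr (1 / 2)))"
    using Q(2)[OF N0 N] by simp_all
  have QM: "(\<lambda>x. deriv (deriv T) (of_real x) / T (of_real x) - M0 x / T0 x) \<in> O[F](\<lambda>x. complex_of_real (x powr (- 1 / 2)))"
    using Q(2)[OF M0 M] by simp
  have quot: "eventually (\<lambda>x. N0 x / T0 x = of_real (sqrt (x / 2)) * (\<i> * M x / L x) \<and> M0 x / T0 x = - of_real (x / 2)) F"
    using pos nzL by eventually_elim (use tl in \<open>simp add: T0L N0M M0L\<close>)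
  have "(\<lambda>x. of_real e / of_real x + (deriv T (of_real x) / T (of_real x) - N0 x / T0 x)) \<in> O[F](\<lambda>x. complex_of_real (x powr (- 1)))"
    by (intro sum_in_bigo QN(1) real_bigo_powr F)
  moreover have "eventually (\<lambda>x. sigma_fun C1 C2 (2 * s - 1) (of_real x) - of_real (sqrt (x / 2)) * (\<i> * M x / L x) =
      of_real e / of_real x + (deriv T (of_real x) / T (of_real x) - N0 x / T0 x)) F"
    using sp quot by eventually_elim simp
  ultimately show "(\<lambda>x. sigma_fun C1 C2 (2 * s - 1) (of_real x) - of_real (sqrt (x / 2)) * (\<i> * M x / L x))
       \<in> O[F](\<lambda>x. complex_of_real (x powr (- 1)))"
    by (subst landau_o.big.in_cong)
  have sum: "(\<lambda>x. (deriv T (of_real x) / T (of_real x) - N0 x / T0 x) + 2 * (N0 x / T0 x)) \<in> O[F](\<lambda>x. complex_of_real (x powr (1 / 2)))"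
    by (intro sum_in_bigo powr_bigo_le[OF QN(1) _ F] landau_o.big.cmult_in_iff[THEN iffD2] QN(2)) auto
  \<comment> \<open>With u = T'/T and v = N0/T0, the difference of squares is (u - v) ((u - v) + 2
    v), of order x^(-1) times x^(1/2).\<close>
  have "(\<lambda>x. 2 * of_real e / of_real x ^ 2 - 2 * (deriv (deriv T) (of_real x) / T (of_real x) - M0 x / T0 x) +
      2 * ((deriv T (of_real x) / T (of_real x) - N0 x / T0 x) * ((deriv T (of_real x) / T (of_real x) - N0 x / T0 x) + 2 * (N0 x / T0 x))))
      \<in> O[F](\<lambda>x. complex_of_real (x powr (- 1 / 2)))"
  proof (rule sum_in_bigo(1)[OF sum_in_bigo(2)])
    show "(\<lambda>x. 2 * (deriv (deriv T) (of_real x) / T (of_real x) - M0 x / T0 x)) \<in> O[F](\<lambda>x. complex_of_real (x powr (- 1 / 2)))"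
      using QM by (subst landau_o.big.cmult_in_iff) auto
    show "(\<lambda>x. 2 * of_real e / of_real x ^ 2) \<in> O[F](\<lambda>x. complex_of_real (x powr (- 1 / 2)))"
      by (rule powr_bigo_le[OF real_bigo_powr(2)[OF F] _ F]) simp
    have "(\<lambda>x. (deriv T (of_real x) / T (of_real x) - N0 x / T0 x) * ((deriv T (of_real x) / T (of_real x) - N0 x / T0 x) + 2 * (N0 x / T0 x)))
       \<in> O[F](\<lambda>x. complex_of_real (x powr (- 1 / 2)))"
      using powr_bigo_mult[OF QN(1) sum] by simp
    thus "(\<lambda>x. 2 * ((deriv T (of_real x) / T (of_real x) - N0 x / T0 x) * ((deriv T (of_real x) / T (of_real x) - N0 x / T0 x) + 2 * (N0 x / T0 x))))
       \<in> O[F](\<lambda>x. complex_of_real (x powr (- 1 / 2)))"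
      by (subst landau_o.big.cmult_in_iff) auto
  qed
  moreover have "eventually (\<lambda>x. p_fun C1 C2 (2 * s - 1) (of_real x) - of_real x * (1 + (\<i> * M x / L x)\<^sup>2) =
      2 * of_real e / of_real x ^ 2 - 2 * (deriv (deriv T) (of_real x) / T (of_real x) - M0 x / T0 x) +
      2 * ((deriv T (of_real x) / T (of_real x) - N0 x / T0 x) * ((deriv T (of_real x) / T (of_real x) - N0 x / T0 x) + 2 * (N0 x / T0 x)))) F"
    using sp quot pos
  proof eventually_elim
    case (elim x)
    define w where "w = \<i> * M x / L x"
    define u where "u = deriv T (of_real x) / T (of_real x)"
    define v where "v = N0 x / T0 x"
    have sq: "complex_of_real (sqrt (x / 2)) ^ 2 = of_real (x / 2)"
      using elim(3) by (simp flip: of_real_power)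
    have "v = of_real (sqrt (x / 2)) * w" unfolding v_def w_def using elim(2) by blast
    hence v2: "v ^ 2 = of_real (x / 2) * w ^ 2" by (simp only: power_mult_distrib sq)
    have p: "p_fun C1 C2 (2 * s - 1) (of_real x) = 2 * of_real e / of_real x ^ 2 - 2 * (deriv (deriv T) (of_real x) / T (of_real x) - u ^ 2)"
      using elim(1) by (simp add: u_def)
    have q: "M0 x / T0 x = - of_real (x / 2)" using elim(2) by blast
    have "2 * ((u - v) * ((u - v) + 2 * v)) = 2 * u ^ 2 - 2 * v ^ 2" by (simp add: algebra_simps power2_eq_square)
    thus ?case unfolding p q v_def[symmetric] u_def[symmetric] w_def[symmetric] v2 by (simp add: algebra_simps)
  qed
  ultimately show "(\<lambda>x. p_fun C1 C2 (2 * s - 1) (of_real x) - of_real x * (1 + (\<i> * M x / L x)\<^sup>2))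
       \<in> O[F](\<lambda>x. complex_of_real (x powr (- 1 / 2)))"
    by (subst landau_o.big.in_cong)
qed

section \<open>Translation to the phase functions\<close>

lemma psi_even:
  assumes "s \<ge> 1"
  shows "psi (2 * s) (s - 1) x = 2 * chi_real x + real s * pi - pi / 2"
  using assms by (simp add: psi_def chi_real_def of_nat_diff algebra_simps)

lemma psi_odd:
  assumes "s \<ge> 1"
  shows "psi (2 * s - 1) (s - 1) x = chi_real x + real (s - 1) * (pi / 2)"
  using assms by (simp add: psi_def chi_real_def of_nat_diff field_simps)

text \<open>The phase is shifted by s pi - pi/2: the sign (-1)^s is the one in
  \<open>tau_lead_even\<close>, and the quarter turn exchanges sine and cosine.\<close>

lemma cis_psi_even:
  assumes "s \<ge> 1"
  shows "cis (psi (2 * s) (s - 1) x) = - \<i> * (- 1) ^ s * cis (2 * chi_real x)"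
    and "cis (- psi (2 * s) (s - 1) x) = \<i> * (- 1) ^ s * cis (- 2 * chi_real x)"
proof -
  have a: "cis (real s * pi) = (- 1) ^ s" by (simp only: Complex.DeMoivre[symmetric] cis_pi)
  have b: "cis (- (pi / 2)) = - \<i>" by (simp add: complex_eq_iff)
  have "psi (2 * s) (s - 1) x = - (pi / 2) + real s * pi + 2 * chi_real x"
    unfolding psi_even[OF assms] by simp
  thus 1: "cis (psi (2 * s) (s - 1) x) = - \<i> * (- 1) ^ s * cis (2 * chi_real x)"
    by (simp only: cis_mult[symmetric] a b)
  have "cis (- psi (2 * s) (s - 1) x) = cnj (cis (psi (2 * s) (s - 1) x))" by (simp add: cis_cnj)
  also have "\<dots> = \<i> * (- 1) ^ s * cis (- 2 * chi_real x)" unfolding 1 by (simp add: cis_cnj)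
  finally show "cis (- psi (2 * s) (s - 1) x) = \<i> * (- 1) ^ s * cis (- 2 * chi_real x)" .
qed

text \<open>The common factor i^(s-1) cancels in the quotient of \<open>osc_sc\<close> by
  \<open>osc_cs\<close>; the relative sign (-1)^(s-1) matches \<open>tau_lead_odd\<close>.\<close>

lemma cis_psi_odd:
  assumes "s \<ge> 1"
  shows "cis (psi (2 * s - 1) (s - 1) x) = \<i> ^ (s - 1) * cis (chi_real x)"
    and "cis (- psi (2 * s - 1) (s - 1) x) = \<i> ^ (s - 1) * ((- 1) ^ (s - 1) * cis (- chi_real x))"
proof -
  have "cis (real (s - 1) * (pi / 2)) = \<i> ^ (s - 1)" by (simp only: Complex.DeMoivre[symmetric] cis_pi_half)
  thus 1: "cis (psi (2 * s - 1) (s - 1) x) = \<i> ^ (s - 1) * cis (chi_real x)"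
    unfolding psi_odd[OF assms] cis_mult[symmetric] by simp
  have "cis (- psi (2 * s - 1) (s - 1) x) = cnj (cis (psi (2 * s - 1) (s - 1) x))" by (simp add: cis_cnj)
  also have "\<dots> = (- \<i>) ^ (s - 1) * cis (- chi_real x)" unfolding 1 by (simp add: cis_cnj)
  also have "(- \<i>) ^ (s - 1) = \<i> ^ (s - 1) * (- 1) ^ (s - 1)" by (simp flip: power_mult_distrib)
  finally show "cis (- psi (2 * s - 1) (s - 1) x) = \<i> ^ (s - 1) * ((- 1) ^ (s - 1) * cis (- chi_real x))" by simp
qed

lemma b_coeff_diagonal: "b_coeff C1 C2 (2 * s) s = (C1\<^sup>2 + C2\<^sup>2) ^ s"
proof -
  have "(C2 - \<i> * C1) * (C2 + \<i> * C1) = C1\<^sup>2 + C2\<^sup>2" by (simp add: algebra_simps power2_eq_square)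
  hence "phase_coeff C1 C2 (2 * s) s = (C1\<^sup>2 + C2\<^sup>2) ^ s" by (simp add: phase_coeff_def flip: power_mult_distrib)
  thus ?thesis using b_coeff_eq[of s "2 * s" C1 C2] by simp
qed

lemma even_expansions:
  assumes nd: "C1\<^sup>2 + C2\<^sup>2 \<noteq> 0" and s: "s \<ge> 1"
  shows "(\<lambda>z::real. sigma_fun C1 C2 (2 * s) (of_real z) -
            (of_real (real s ^ 2 / (2 * z)) +
             of_real (real s / (2 * z)) * (osc_sc C1 C2 (2 * s) (s - 1) z / b_coeff C1 C2 (2 * s) s)))
           \<in> O[at_top](\<lambda>z. of_real (z powr (- 5 / 2)))" (is ?sigma)
    and "(\<lambda>z::real. p_fun C1 C2 (2 * s) (of_real z) -
            (- of_real (sqrt 2 * real s / sqrt z) *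
               (osc_cs C1 C2 (2 * s) (s - 1) z / b_coeff C1 C2 (2 * s) s)))
           \<in> O[at_top](\<lambda>z. of_real (z powr (- 2)))" (is ?p)
proof -
  define D where "D = (C1\<^sup>2 + C2\<^sup>2) ^ s"
  define P where "P = phase_coeff C1 C2 (2 * s) (s - 1)"
  define Q where "Q = phase_coeff C1 C2 (2 * s) (s + 1)"
  have D: "D \<noteq> 0" using nd by (simp add: D_def)
  have r: "s - 1 \<le> 2 * s" "1 \<le> 2 * s" "2 * s - (s - 1) = s + 1" using s by auto
  have sc: "osc_sc C1 C2 (2 * s) (s - 1) x = - ((- 1) ^ s * (P * cis (2 * chi_real x) + Q * cis (- 2 * chi_real x)) / 2)" for x
  proof -
    have "- \<i> * (P * (- \<i> * e * u) - Q * (\<i> * e * v)) / 2 = - (e * (P * u + Q * v) / 2)" for e u v :: complex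
      by (simp add: algebra_simps)
    thus ?thesis unfolding osc_sc_eq[OF r(1,2)] cis_psi_even[OF s] r(3) P_def Q_def .
  qed
  have cs: "osc_cs C1 C2 (2 * s) (s - 1) x = - (\<i> * ((- 1) ^ s * (P * cis (2 * chi_real x) - Q * cis (- 2 * chi_real x))) / 2)" for x
  proof -
    have "(P * (- \<i> * e * u) + Q * (\<i> * e * v)) / 2 = - (\<i> * (e * (P * u - Q * v)) / 2)" for e u v :: complex
      by (simp add: field_simps)
    thus ?thesis unfolding osc_cs_eq[OF r(1,2)] cis_psi_even[OF s] r(3) P_def Q_def .
  qed
  define k where "k = (- 1) ^ s * \<i> * complex_of_real (real s / (4 * sqrt 2))"
  have rt: "complex_of_real (sqrt 2) * of_real (sqrt 2) = 2" by (simp flip: of_real_mult)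
  have k: "complex_of_real (sqrt 2) * k = \<i> * ((- 1) ^ s * of_nat s / 4)"
    by (simp add: k_def)
  have k4: "4 * k = (- 1) ^ s * \<i> * of_nat s * of_real (sqrt 2) / 2"
  proof -
    have e: "complex_of_real (real s / (4 * sqrt 2)) = of_nat s * of_real (sqrt 2) / 8"
      using rt by (simp add: field_simps)
    show ?thesis unfolding k_def e by simp
  qed
  have 1: "of_real (real s / (2 * x)) * (osc_sc C1 C2 (2 * s) (s - 1) x / b_coeff C1 C2 (2 * s) s) =
      \<i> * of_real (sqrt 2) * k * (P / D * mode 2 (- 1) (of_real x) + Q / D * mode (- 2) (- 1) (of_real x))" if x: "x > 0" for x
  proof -
    have ik: "\<i> * of_real (sqrt 2) * k = - ((- 1) ^ s * of_nat s / 4)"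
      unfolding mult.assoc[of \<i>] k by simp
    have pw: "complex_of_real (x powr - 1) = 1 / of_real x" using x by (simp add: powr_minus_divide)
    show ?thesis
      unfolding mode_of_real[OF x] sc b_coeff_diagonal D_def[symmetric] ik pw
      using x D by (simp add: field_simps)
  qed
  have 2: "- of_real (sqrt 2 * real s / sqrt x) * (osc_cs C1 C2 (2 * s) (s - 1) x / b_coeff C1 C2 (2 * s) s) =
      4 * k * (P / D * mode 2 (- 1 / 2) (of_real x) - Q / D * mode (- 2) (- 1 / 2) (of_real x))" if x: "x > 0" for x
  proof -
    have "complex_of_real (x powr (- 1 / 2)) = 1 / of_real (sqrt x)" using x by (simp add: powr_minus_divide powr_half_sqrt)
    thus ?thesis
      using x D unfolding mode_of_real[OF x] cs b_coeff_diagonal D_def[symmetric] k4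
      by (simp add: field_simps)
  qed
  have pos: "eventually (\<lambda>x::real. x > 0) at_top" by (rule eventually_gt_at_top)
  note E = even_asymptotics[OF nd s, folded P_def Q_def D_def k_def]
  show ?sigma
    by (rule landau_o.big.in_cong[THEN iffD2, OF eventually_mono[OF pos] E(2)]) (simp only: 1)
  show ?p
    by (rule landau_o.big.in_cong[THEN iffD2, OF eventually_mono[OF pos] E(4)]) (simp only: 2)
qed

section \<open>The function q and the odd-index expansions\<close>

lemma q_fun_eq:
  assumes "tau C1 C2 (n - 1) z \<noteq> 0" "(tau C1 C2 (n - 1) has_field_derivative D) (at z)"
    and "tau C1 C2 n z \<noteq> 0" "(tau C1 C2 n has_field_derivative E) (at z)"
  shows "q_fun C1 C2 n z = sigma_fun C1 C2 (n - 1) z - sigma_fun C1 C2 n z"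
proof -
  have "deriv (\<lambda>w. tau C1 C2 (n - 1) w / tau C1 C2 n w) z =
      (D * tau C1 C2 n z - tau C1 C2 (n - 1) z * E) / (tau C1 C2 n z * tau C1 C2 n z)"
    by (rule DERIV_imp_deriv[OF DERIV_divide[OF assms(2,4,3)]])
  thus ?thesis using assms(1,3) DERIV_imp_deriv[OF assms(2)] DERIV_imp_deriv[OF assms(4)]
    by (simp add: q_fun_def sigma_fun_def log_deriv_def field_simps)
qed

lemma tau_0: "tau C1 C2 0 = (\<lambda>_. 1)"
  by (simp add: tau_def fun_eq_iff)

lemma sigma_fun_0: "sigma_fun C1 C2 0 = (\<lambda>_. 0)"
  by (simp add: sigma_fun_def log_deriv_def tau_0 fun_eq_iff)

text \<open>q is a difference of consecutive sigma functions. The one of even index is O(z^(-1)), so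
  the odd one supplies the leading term, with a sign that depends on which of the two it is.\<close>

lemma odd_expansions:
  assumes nd: "C1\<^sup>2 + C2\<^sup>2 \<noteq> 0" and s: "s \<ge> 1" and \<delta>: "\<delta> > 0"
  defines "F \<equiv> at_top_away \<delta> (psi (2 * s - 1) (s - 1)) (osc_poles C1 C2 (2 * s - 1) (s - 1))"
    and "R \<equiv> \<lambda>z. - osc_sc C1 C2 (2 * s - 1) (s - 1) z / osc_cs C1 C2 (2 * s - 1) (s - 1) z"
  shows "eventually (\<lambda>z. osc_cs C1 C2 (2 * s - 1) (s - 1) z \<noteq> 0) F"
    and "(\<lambda>z. sigma_fun C1 C2 (2 * s - 1) (of_real z) - of_real (sqrt (z / 2)) * R z)
           \<in> O[F](\<lambda>z. complex_of_real (z powr (- 1)))"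
    and "(\<lambda>z. p_fun C1 C2 (2 * s - 1) (of_real z) - of_real z * (1 + (R z)\<^sup>2))
           \<in> O[F](\<lambda>z. complex_of_real (z powr (- 1 / 2)))"
    and "(\<lambda>z. q_fun C1 C2 (2 * s - 1) (of_real z) - (- (of_real (sqrt (z / 2)) * R z)))
           \<in> O[F](\<lambda>z. complex_of_real (z powr (- 1)))"
    and "(\<lambda>z. q_fun C1 C2 (2 * s) (of_real z) - of_real (sqrt (z / 2)) * R z)
           \<in> O[F](\<lambda>z. complex_of_real (z powr (- 1)))"
proof -
  have F: "F \<le> at_top" unfolding F_def by (rule at_top_away_le)
  define n where "n = 2 * s - 1"
  have r: "s - 1 \<le> n" "1 \<le> n" "n - (s - 1) = s" "n = 2 * (s - 1) + 1" using s by (auto simp: n_def)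
  define X where "X = phase_coeff C1 C2 n (s - 1)"
  define Y where "Y = phase_coeff C1 C2 n s"
  define L where "L = (\<lambda>x. X * cis (chi_real x) + (- 1) ^ (s - 1) * Y * cis (- chi_real x))"
  define M where "M = (\<lambda>x. X * cis (chi_real x) - (- 1) ^ (s - 1) * Y * cis (- chi_real x))"
  have cs: "osc_cs C1 C2 n (s - 1) x = \<i> ^ (s - 1) * L x / 2" for x
    unfolding osc_cs_eq[OF r(1,2)] r(3) X_def[symmetric] Y_def[symmetric] L_def
    unfolding n_def cis_psi_odd[OF s] by (simp add: algebra_simps)
  have sc: "osc_sc C1 C2 n (s - 1) x = - \<i> * (\<i> ^ (s - 1) * M x) / 2" for x
    unfolding osc_sc_eq[OF r(1,2)] r(3) X_def[symmetric] Y_def[symmetric] M_def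
    unfolding n_def cis_psi_odd[OF s] by (simp add: algebra_simps)
  have R: "\<i> * M x / L x = R x" for x
    unfolding R_def n_def[symmetric] cs sc by simp
  obtain c where c: "c > 0" "eventually (\<lambda>x. c \<le> norm (osc_cs C1 C2 n (s - 1) x)) F"
    using osc_cs_lower_bound[OF r(4) \<delta>, of C1 C2] unfolding F_def n_def[symmetric] by blast
  show "eventually (\<lambda>z. osc_cs C1 C2 (2 * s - 1) (s - 1) z \<noteq> 0) F"
    using c(2) unfolding n_def[symmetric] by eventually_elim (use c(1) in auto)
  have low: "eventually (\<lambda>x. 2 * c \<le> norm (L x)) F"
    using c(2)
  proof eventually_elim
    case (elim x)
    have "norm (osc_cs C1 C2 n (s - 1) x) = norm (L x) / 2"
      unfolding cs by (simp add: norm_mult norm_power norm_divide)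
    with elim show ?case by simp
  qed
  have c2: "2 * c > 0" using c(1) by simp
  note O = odd_asymptotics[OF nd s F c2 low[unfolded L_def X_def Y_def n_def],
      folded n_def, folded X_def Y_def, unfolded R[unfolded L_def M_def]]
  show sg: "(\<lambda>z. sigma_fun C1 C2 (2 * s - 1) (of_real z) - of_real (sqrt (z / 2)) * R z)
           \<in> O[F](\<lambda>z. complex_of_real (z powr (- 1)))"
    unfolding n_def[symmetric] by (rule O(2))
  show "(\<lambda>z. p_fun C1 C2 (2 * s - 1) (of_real z) - of_real z * (1 + (R z)\<^sup>2))
           \<in> O[F](\<lambda>z. complex_of_real (z powr (- 1 / 2)))"
    unfolding n_def[symmetric] by (rule O(3))
  \<comment> \<open>m = 0 is included since q at index 1 involves tau at index 0, which is
    constant.\<close>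
  have even: "eventually (\<lambda>x. tau C1 C2 (2 * m) (of_real x) \<noteq> 0 \<and> (\<exists>D. (tau C1 C2 (2 * m) has_field_derivative D) (at (of_real x)))) F \<and>
      (\<lambda>x. sigma_fun C1 C2 (2 * m) (of_real x)) \<in> O[F](\<lambda>x. complex_of_real (x powr (- 1)))" for m
  proof (cases "m = 0")
    case True
    have "\<exists>D. ((\<lambda>_::complex. 1 :: complex) has_field_derivative D) (at w)" for w by (rule exI, rule DERIV_const)
    with True show ?thesis by (simp add: tau_0 sigma_fun_0)
  next
    case False
    hence m: "m \<ge> 1" by simp
    show ?thesis
      using filter_leD[OF F even_asymptotics(1)[OF nd m]]
        landau_o.big.filter_mono[OF F even_asymptotics(3)[OF nd m]] by blast
  qed
  have q1: "2 * s - 1 - 1 = 2 * (s - 1)" by simp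
  have sub1: "eventually (\<lambda>x. q_fun C1 C2 (2 * s - 1) (of_real x) = sigma_fun C1 C2 (2 * (s - 1)) (of_real x) - sigma_fun C1 C2 (2 * s - 1) (of_real x)) F"
    using conjunct1[OF even[of "s - 1"]] O(1)
    by eventually_elim (use q_fun_eq[of C1 C2 "2 * s - 1", unfolded q1] in \<open>unfold n_def, blast\<close>)
  have sub2: "eventually (\<lambda>x. q_fun C1 C2 (2 * s) (of_real x) = sigma_fun C1 C2 (2 * s - 1) (of_real x) - sigma_fun C1 C2 (2 * s) (of_real x)) F"
    using conjunct1[OF even[of s]] O(1)
    by eventually_elim (use q_fun_eq[of C1 C2 "2 * s"] in \<open>unfold n_def, blast\<close>)
  show "(\<lambda>z. q_fun C1 C2 (2 * s - 1) (of_real z) - (- (of_real (sqrt (z / 2)) * R z)))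
           \<in> O[F](\<lambda>z. complex_of_real (z powr (- 1)))"
    by (rule landau_o.big.in_cong[THEN iffD2, OF eventually_mono[OF sub1] sum_in_bigo(2)[OF conjunct2[OF even[of "s - 1"]] sg]]) simp
  show "(\<lambda>z. q_fun C1 C2 (2 * s) (of_real z) - of_real (sqrt (z / 2)) * R z)
           \<in> O[F](\<lambda>z. complex_of_real (z powr (- 1)))"
    by (rule landau_o.big.in_cong[THEN iffD2, OF eventually_mono[OF sub2] sum_in_bigo(2)[OF sg conjunct2[OF even[of s]]]]) simp
qed

lemma q_expansion:
  assumes nd: "C1\<^sup>2 + C2\<^sup>2 \<noteq> 0" and n: "n \<ge> 1" "int s = \<lceil>real n / 2\<rceil>" and \<delta>: "\<delta> > 0"
  shows "(\<lambda>z::real. q_fun C1 C2 n (of_real z) -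
            (- 1) ^ n * of_real (sqrt (z / 2)) *
              (- osc_sc C1 C2 (2 * s - 1) (s - 1) z / osc_cs C1 C2 (2 * s - 1) (s - 1) z))
           \<in> O[at_top_away \<delta> (psi (2 * s - 1) (s - 1)) (osc_poles C1 C2 (2 * s - 1) (s - 1))](\<lambda>z. of_real (z powr (- 1)))"
proof -
  have "real s < real n / 2 + 1" "real n / 2 \<le> real s" using n(2) by linarith+
  hence "n = 2 * s \<or> n = 2 * s - 1" and s: "s \<ge> 1" using n(1) by linarith+
  thus ?thesis
  proof (elim disjE)
    assume "n = 2 * s"
    thus ?thesis using odd_expansions(5)[OF nd s \<delta>] by simp
  next
    assume ns: "n = 2 * s - 1"
    hence "odd n" using s by simp
    thus ?thesis using odd_expansions(4)[OF nd s \<delta>] unfolding ns by simp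
  qed
qed

section \<open>The case C2 = 0\<close>

lemma osc_even_Ai:
  assumes s: "s \<ge> 1"
  shows "osc_sc C1 0 (2 * s) (s - 1) z = - ((C1\<^sup>2) ^ s * of_real (sin (psi (2 * s) (s - 1) z)))"
    and "osc_cs C1 0 (2 * s) (s - 1) z = - ((C1\<^sup>2) ^ s * of_real (cos (psi (2 * s) (s - 1) z)))"
proof -
  obtain m where m: "s = Suc m" using s by (cases s) auto
  have r: "s - 1 \<le> 2 * s" "1 \<le> 2 * s" "2 * s - (s - 1) = s + 1" using s by auto
  have h: "(- (\<i> * C1)) ^ m * (\<i> * C1) ^ m = (C1\<^sup>2) ^ m"
    unfolding power_mult_distrib[symmetric] by (simp add: power2_eq_square algebra_simps)
  have P: "phase_coeff C1 0 (2 * s) (s - 1) = - ((C1\<^sup>2) ^ s)"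
  proof -
    have "phase_coeff C1 0 (2 * s) (s - 1) = (\<i> * C1)\<^sup>2 * ((- (\<i> * C1)) ^ m * (\<i> * C1) ^ m)"
      by (simp add: phase_coeff_def m power2_eq_square)
    thus ?thesis unfolding h by (simp add: m power_mult_distrib)
  qed
  have Q: "phase_coeff C1 0 (2 * s) (s + 1) = - ((C1\<^sup>2) ^ s)"
  proof -
    have "phase_coeff C1 0 (2 * s) (s + 1) = (\<i> * C1)\<^sup>2 * ((- (\<i> * C1)) ^ m * (\<i> * C1) ^ m)"
      by (simp add: phase_coeff_def m power2_eq_square)
    thus ?thesis unfolding h by (simp add: m power_mult_distrib)
  qed
  show "osc_sc C1 0 (2 * s) (s - 1) z = - ((C1\<^sup>2) ^ s * of_real (sin (psi (2 * s) (s - 1) z)))"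
    "osc_cs C1 0 (2 * s) (s - 1) z = - ((C1\<^sup>2) ^ s * of_real (cos (psi (2 * s) (s - 1) z)))"
    unfolding osc_sc_eq[OF r(1,2)] osc_cs_eq[OF r(1,2)] r(3) P Q cos_sin_cis by (simp_all add: field_simps)
qed

text \<open>At odd index the two phase coefficients are opposite rather than equal, so the
  denominator becomes a sine and the quotient a cotangent.\<close>

lemma osc_odd_Ai:
  assumes s: "s \<ge> 1"
  shows "osc_sc C1 0 (2 * s - 1) (s - 1) z = - (C1 ^ (2 * s - 1) * of_real (cos (psi (2 * s - 1) (s - 1) z)))"
    and "osc_cs C1 0 (2 * s - 1) (s - 1) z = C1 ^ (2 * s - 1) * of_real (sin (psi (2 * s - 1) (s - 1) z))"
proof -
  obtain m where m: "s = Suc m" using s by (cases s) auto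
  have r: "s - 1 \<le> 2 * s - 1" "1 \<le> 2 * s - 1" "2 * s - 1 - (s - 1) = s" using s by auto
  have h: "(- (\<i> * C1)) ^ m * (\<i> * C1) ^ m = C1 ^ (2 * m)"
    unfolding power_mult_distrib[symmetric] power_mult by (simp add: power2_eq_square algebra_simps)
  have P: "phase_coeff C1 0 (2 * s - 1) (s - 1) = - \<i> * C1 ^ (2 * s - 1)"
  proof -
    have "phase_coeff C1 0 (2 * s - 1) (s - 1) = - (\<i> * C1) * ((- (\<i> * C1)) ^ m * (\<i> * C1) ^ m)"
      by (simp add: phase_coeff_def m)
    thus ?thesis unfolding h by (simp add: m)
  qed
  have Q: "phase_coeff C1 0 (2 * s - 1) s = \<i> * C1 ^ (2 * s - 1)"
  proof -
    have "phase_coeff C1 0 (2 * s - 1) s = (\<i> * C1) * ((- (\<i> * C1)) ^ m * (\<i> * C1) ^ m)"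
      by (simp add: phase_coeff_def m)
    thus ?thesis unfolding h by (simp add: m)
  qed
  show "osc_sc C1 0 (2 * s - 1) (s - 1) z = - (C1 ^ (2 * s - 1) * of_real (cos (psi (2 * s - 1) (s - 1) z)))"
    "osc_cs C1 0 (2 * s - 1) (s - 1) z = C1 ^ (2 * s - 1) * of_real (sin (psi (2 * s - 1) (s - 1) z))"
    unfolding osc_sc_eq[OF r(1,2)] osc_cs_eq[OF r(1,2)] r(3) P Q cos_sin_cis by (simp_all add: field_simps)
qed

lemma osc_ratio_Ai:
  assumes "C1 \<noteq> 0" "s \<ge> 1"
  shows "- osc_sc C1 0 (2 * s - 1) (s - 1) z / osc_cs C1 0 (2 * s - 1) (s - 1) z = of_real (cot (psi (2 * s - 1) (s - 1) z))"
  unfolding osc_odd_Ai[OF assms(2)] using assms(1) by (simp add: cot_def)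

lemma osc_poles_Ai:
  assumes "C1 \<noteq> 0" "s \<ge> 1"
  shows "osc_poles C1 0 (2 * s - 1) (s - 1) = cot_poles (2 * s - 1) (s - 1)"
  unfolding osc_poles_def cot_poles_def osc_odd_Ai[OF assms(2)] using assms(1) by simp

theorem corollary2p7:
  fixes C1 C2 :: complex
  assumes nondegenerate: "C1\<^sup>2 + C2\<^sup>2 \<noteq> 0"
  shows
   "(C2 \<noteq> 0 \<longrightarrow>
      (\<forall>s::nat. s \<ge> 1 \<longrightarrow>
         (\<lambda>z::real. sigma_fun C1 C2 (2 * s) (of_real z) -
            (of_real (real s ^ 2 / (2 * z)) +
             of_real (real s / (2 * z)) * (osc_sc C1 C2 (2 * s) (s - 1) z / b_coeff C1 C2 (2 * s) s)))
           \<in> O[at_top](\<lambda>z. of_real (z powr (- 5 / 2))) \<and>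
         (\<forall>\<delta>>0. (\<lambda>z::real. sigma_fun C1 C2 (2 * s - 1) (of_real z) -
            of_real (sqrt (z / 2)) *
              (- osc_sc C1 C2 (2 * s - 1) (s - 1) z / osc_cs C1 C2 (2 * s - 1) (s - 1) z))
           \<in> O[at_top_away \<delta> (psi (2 * s - 1) (s - 1)) (osc_poles C1 C2 (2 * s - 1) (s - 1))](\<lambda>z. of_real (z powr (- 1)))) \<and>
         (\<lambda>z::real. p_fun C1 C2 (2 * s) (of_real z) -
            (- of_real (sqrt 2 * real s / sqrt z) *
               (osc_cs C1 C2 (2 * s) (s - 1) z / b_coeff C1 C2 (2 * s) s)))
           \<in> O[at_top](\<lambda>z. of_real (z powr (- 2))) \<and>
         (\<forall>\<delta>>0. (\<lambda>z::real. p_fun C1 C2 (2 * s - 1) (of_real z) -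
            of_real z *
              (1 + (osc_sc C1 C2 (2 * s - 1) (s - 1) z / osc_cs C1 C2 (2 * s - 1) (s - 1) z)\<^sup>2))
           \<in> O[at_top_away \<delta> (psi (2 * s - 1) (s - 1)) (osc_poles C1 C2 (2 * s - 1) (s - 1))](\<lambda>z. of_real (z powr (- 1 / 2))))) \<and>
      (\<forall>n s::nat. n \<ge> 1 \<and> int s = \<lceil>real n / 2\<rceil> \<longrightarrow>
         (\<forall>\<delta>>0. (\<lambda>z::real. q_fun C1 C2 n (of_real z) -
            (- 1) ^ n * of_real (sqrt (z / 2)) *
              (- osc_sc C1 C2 (2 * s - 1) (s - 1) z / osc_cs C1 C2 (2 * s - 1) (s - 1) z))
           \<in> O[at_top_away \<delta> (psi (2 * s - 1) (s - 1)) (osc_poles C1 C2 (2 * s - 1) (s - 1))](\<lambda>z. of_real (z powr (- 1)))))) \<and>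
    (C2 = 0 \<longrightarrow>
      (\<forall>s::nat. s \<ge> 1 \<longrightarrow>
         (\<lambda>z::real. sigma_fun C1 C2 (2 * s) (of_real z) -
            of_real (real s ^ 2 / (2 * z) - real s / (2 * z) * sin (psi (2 * s) (s - 1) z)))
           \<in> O[at_top](\<lambda>z. of_real (z powr (- 5 / 2))) \<and>
         (\<forall>\<delta>>0. (\<lambda>z::real. sigma_fun C1 C2 (2 * s - 1) (of_real z) -
            of_real (sqrt (z / 2) * cot (psi (2 * s - 1) (s - 1) z)))
           \<in> O[at_top_away \<delta> (psi (2 * s - 1) (s - 1)) (cot_poles (2 * s - 1) (s - 1))](\<lambda>z. of_real (z powr (- 1)))) \<and>
         (\<lambda>z::real. p_fun C1 C2 (2 * s) (of_real z) -
            of_real (sqrt 2 * real s / sqrt z * cos (psi (2 * s) (s - 1) z)))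
           \<in> O[at_top](\<lambda>z. of_real (z powr (- 2))) \<and>
         (\<forall>\<delta>>0. (\<lambda>z::real. p_fun C1 C2 (2 * s - 1) (of_real z) -
            of_real (z / (sin (psi (2 * s - 1) (s - 1) z))\<^sup>2))
           \<in> O[at_top_away \<delta> (psi (2 * s - 1) (s - 1)) (cot_poles (2 * s - 1) (s - 1))](\<lambda>z. of_real (z powr (- 1 / 2))))) \<and>
      (\<forall>n s::nat. n \<ge> 1 \<and> int s = \<lceil>real n / 2\<rceil> \<longrightarrow>
         (\<forall>\<delta>>0. (\<lambda>z::real. q_fun C1 C2 n (of_real z) -
            of_real ((- 1) ^ n * sqrt (z / 2) * cot (psi (2 * s - 1) (s - 1) z)))
           \<in> O[at_top_away \<delta> (psi (2 * s - 1) (s - 1)) (cot_poles (2 * s - 1) (s - 1))](\<lambda>z. of_real (z powr (- 1))))))"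
proof (intro conjI impI allI)
  fix s :: nat and \<delta> :: real assume s: "s \<ge> 1" and \<delta>: "\<delta> > 0"
  show "(\<lambda>z::real. sigma_fun C1 C2 (2 * s - 1) (of_real z) -
            of_real (sqrt (z / 2)) *
              (- osc_sc C1 C2 (2 * s - 1) (s - 1) z / osc_cs C1 C2 (2 * s - 1) (s - 1) z))
           \<in> O[at_top_away \<delta> (psi (2 * s - 1) (s - 1)) (osc_poles C1 C2 (2 * s - 1) (s - 1))](\<lambda>z. of_real (z powr (- 1)))"
    by (rule odd_expansions(2)[OF nondegenerate s \<delta>])
  show "(\<lambda>z::real. p_fun C1 C2 (2 * s - 1) (of_real z) -
            of_real z *
              (1 + (osc_sc C1 C2 (2 * s - 1) (s - 1) z / osc_cs C1 C2 (2 * s - 1) (s - 1) z)\<^sup>2))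
           \<in> O[at_top_away \<delta> (psi (2 * s - 1) (s - 1)) (osc_poles C1 C2 (2 * s - 1) (s - 1))](\<lambda>z. of_real (z powr (- 1 / 2)))"
    using odd_expansions(3)[OF nondegenerate s \<delta>] by (simp only: minus_divide_left[symmetric] power2_minus)
next
  fix s :: nat assume s: "s \<ge> 1"
  show "(\<lambda>z::real. sigma_fun C1 C2 (2 * s) (of_real z) -
            (of_real (real s ^ 2 / (2 * z)) +
             of_real (real s / (2 * z)) * (osc_sc C1 C2 (2 * s) (s - 1) z / b_coeff C1 C2 (2 * s) s)))
           \<in> O[at_top](\<lambda>z. of_real (z powr (- 5 / 2)))"
    by (rule even_expansions(1)[OF nondegenerate s])
  show "(\<lambda>z::real. p_fun C1 C2 (2 * s) (of_real z) -
            (- of_real (sqrt 2 * real s / sqrt z) *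
               (osc_cs C1 C2 (2 * s) (s - 1) z / b_coeff C1 C2 (2 * s) s)))
           \<in> O[at_top](\<lambda>z. of_real (z powr (- 2)))"
    by (rule even_expansions(2)[OF nondegenerate s])
next
  fix n s :: nat and \<delta> :: real assume "n \<ge> 1 \<and> int s = \<lceil>real n / 2\<rceil>" and \<delta>: "\<delta> > 0"
  thus "(\<lambda>z::real. q_fun C1 C2 n (of_real z) -
            (- 1) ^ n * of_real (sqrt (z / 2)) *
              (- osc_sc C1 C2 (2 * s - 1) (s - 1) z / osc_cs C1 C2 (2 * s - 1) (s - 1) z))
           \<in> O[at_top_away \<delta> (psi (2 * s - 1) (s - 1)) (osc_poles C1 C2 (2 * s - 1) (s - 1))](\<lambda>z. of_real (z powr (- 1)))"
    by (intro q_expansion[OF nondegenerate _ _ \<delta>]) auto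
next
  fix s :: nat assume C2: "C2 = 0" and s: "s \<ge> 1"
  \<comment> \<open>The common factor (C1^2)^s of \<open>osc_sc\<close>, \<open>osc_cs\<close> and
    \<open>b_coeff\<close> cancels, leaving a single sine or cosine.\<close>
  have C1: "(C1\<^sup>2) ^ s \<noteq> 0" using nondegenerate C2 by simp
  show "(\<lambda>z::real. sigma_fun C1 C2 (2 * s) (of_real z) -
            of_real (real s ^ 2 / (2 * z) - real s / (2 * z) * sin (psi (2 * s) (s - 1) z)))
           \<in> O[at_top](\<lambda>z. of_real (z powr (- 5 / 2)))"
  proof -
    have "complex_of_real (real s ^ 2 / (2 * z)) + of_real (real s / (2 * z)) * (osc_sc C1 C2 (2 * s) (s - 1) z / b_coeff C1 C2 (2 * s) s) =
        of_real (real s ^ 2 / (2 * z) - real s / (2 * z) * sin (psi (2 * s) (s - 1) z))" for z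
      unfolding b_coeff_diagonal C2 osc_even_Ai[OF s] using C1 by simp
    from even_expansions(1)[OF nondegenerate s, unfolded this] show ?thesis .
  qed
  show "(\<lambda>z::real. p_fun C1 C2 (2 * s) (of_real z) -
            of_real (sqrt 2 * real s / sqrt z * cos (psi (2 * s) (s - 1) z)))
           \<in> O[at_top](\<lambda>z. of_real (z powr (- 2)))"
  proof -
    have "- complex_of_real (sqrt 2 * real s / sqrt z) * (osc_cs C1 C2 (2 * s) (s - 1) z / b_coeff C1 C2 (2 * s) s) =
        of_real (sqrt 2 * real s / sqrt z * cos (psi (2 * s) (s - 1) z))" for z
      unfolding b_coeff_diagonal C2 osc_even_Ai[OF s] using C1 by simp
    from even_expansions(2)[OF nondegenerate s, unfolded this] show ?thesis .
  qed
next
  fix s :: nat and \<delta> :: real assume C2: "C2 = 0" and s: "s \<ge> 1" and \<delta>: "\<delta> > 0"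
  have C1: "C1 \<noteq> 0" using nondegenerate C2 by simp
  show "(\<lambda>z::real. sigma_fun C1 C2 (2 * s - 1) (of_real z) -
            of_real (sqrt (z / 2) * cot (psi (2 * s - 1) (s - 1) z)))
           \<in> O[at_top_away \<delta> (psi (2 * s - 1) (s - 1)) (cot_poles (2 * s - 1) (s - 1))](\<lambda>z. of_real (z powr (- 1)))"
    using odd_expansions(2)[OF nondegenerate s \<delta>] unfolding C2 osc_ratio_Ai[OF C1 s] osc_poles_Ai[OF C1 s] of_real_mult .
  have "eventually (\<lambda>z. osc_cs C1 0 (2 * s - 1) (s - 1) z \<noteq> 0) (at_top_away \<delta> (psi (2 * s - 1) (s - 1)) (cot_poles (2 * s - 1) (s - 1)))"
    using odd_expansions(1)[OF nondegenerate s \<delta>] unfolding C2 osc_poles_Ai[OF C1 s] .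
  \<comment> \<open>The identity 1 + cot^2 = 1/sin^2 breaks down at zeros of the sine, where
    division returns 0; along the filter these are eventually avoided.\<close>
  hence E: "eventually (\<lambda>z. of_real z * (1 + (complex_of_real (cot (psi (2 * s - 1) (s - 1) z)))\<^sup>2) = of_real (z / (sin (psi (2 * s - 1) (s - 1) z))\<^sup>2))
      (at_top_away \<delta> (psi (2 * s - 1) (s - 1)) (cot_poles (2 * s - 1) (s - 1)))"
  proof eventually_elim
    case (elim z)
    have nz: "sin (psi (2 * s - 1) (s - 1) z) \<noteq> 0" using elim unfolding osc_odd_Ai[OF s] by auto
    have "1 + (cot (psi (2 * s - 1) (s - 1) z))\<^sup>2 = 1 / (sin (psi (2 * s - 1) (s - 1) z))\<^sup>2"
      using nz sin_cos_squared_add[of "psi (2 * s - 1) (s - 1) z"] by (simp add: cot_def power_divide field_simps)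
    hence "z * (1 + (cot (psi (2 * s - 1) (s - 1) z))\<^sup>2) = z / (sin (psi (2 * s - 1) (s - 1) z))\<^sup>2" by simp
    from arg_cong[OF this, of complex_of_real] show ?case
      by (simp only: of_real_mult of_real_add of_real_1 of_real_power)
  qed
  note p = odd_expansions(3)[OF nondegenerate s \<delta>, unfolded C2 osc_ratio_Ai[OF C1 s] osc_poles_Ai[OF C1 s]]
  show "(\<lambda>z::real. p_fun C1 C2 (2 * s - 1) (of_real z) -
            of_real (z / (sin (psi (2 * s - 1) (s - 1) z))\<^sup>2))
           \<in> O[at_top_away \<delta> (psi (2 * s - 1) (s - 1)) (cot_poles (2 * s - 1) (s - 1))](\<lambda>z. of_real (z powr (- 1 / 2)))"
    unfolding C2 by (rule landau_o.big.in_cong[THEN iffD2, OF eventually_mono[OF E] p]) (simp only:)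
next
  fix n s :: nat and \<delta> :: real assume C2: "C2 = 0" and n: "n \<ge> 1 \<and> int s = \<lceil>real n / 2\<rceil>" and \<delta>: "\<delta> > 0"
  have C1: "C1 \<noteq> 0" using nondegenerate C2 by simp
  have s: "s \<ge> 1" using n by linarith
  have "(- 1) ^ n * complex_of_real (sqrt (z / 2)) * complex_of_real (cot (psi (2 * s - 1) (s - 1) z)) =
      of_real ((- 1) ^ n * sqrt (z / 2) * cot (psi (2 * s - 1) (s - 1) z))" for z by simp
  with q_expansion[OF nondegenerate conjunct1[OF n] conjunct2[OF n] \<delta>]
  show "(\<lambda>z::real. q_fun C1 C2 n (of_real z) -
            of_real ((- 1) ^ n * sqrt (z / 2) * cot (psi (2 * s - 1) (s - 1) z)))
           \<in> O[at_top_away \<delta> (psi (2 * s - 1) (s - 1)) (cot_poles (2 * s - 1) (s - 1))](\<lambda>z. of_real (z powr (- 1)))"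
    unfolding C2 osc_ratio_Ai[OF C1 s] osc_poles_Ai[OF C1 s] by (simp only:)
qed

end
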